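(* Let $\omega$ be a simplicial $(n-1)$-cycle on a finite set $[m]$, $k\in[m]$ a vertex, and let $\Delta'=(\omega,\lambda')$, $\Delta''=(\omega,\lambda'')$ be multi-fans in $V\cong\mathbb{R}^n$ with $\lambda'(i)=\lambda''(i)$ for all $i\neq k$. Regard both as multi-fans on $M=([m]\setminus\{k\})\sqcup\{x,y\}$ with the common characteristic function $\lambda$ given by $\lambda(i)=\lambda'(i)=\lambda''(i)$ for $i\ne k$, $\lambda(x)=\lambda'(k)$, $\lambda(y)=\lambda''(k)$, where the cycle of $\Delta'$ is $\omega$ with $k$ renamed $x$ (so $y$ is a ghost vertex) and the cycle of $\Delta''$ is $\omega$ with $k$ renamed $y$ (so $x$ is a ghost vertex), and let $T=\Delta''-\Delta'$ (the multi-fan on $M$ with characteristic function $\lambda$ and cycle the difference of these two cycles), which is suspension-shaped with suspension points $x,y$. If the link $(n-2)$-cycle $\omega_k$ is rigid and $T$ is editable, then $\operatorname{Hilb}(\mathcal{A}^*(\Delta');t)=\operatorname{Hilb}(\mathcal{A}^*(\Delta'');t)$.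
   Context: Fix a total order on a finite set $M$. A simplicial $(n-1)$-cycle on $M$ is a formal real linear combination $\omega=\sum_{I\subset M,|I|=n}w(I)\,I$ of $n$-element subsets (oriented by the order) with zero simplicial boundary; vertices of $M$ lying in no $I$ with $w(I)\ne0$ are called ghost vertices. A multi-fan is a pair $\Delta=(\omega,\lambda)$ with $\lambda\colon M\to V$ such that $\{\lambda(i)\}_{i\in I}$ is a basis of $V$ whenever $w(I)\ne0$. Its volume polynomial is $V_\Delta=\frac{1}{n!}\sum_{I:\,w(I)\ne0}\frac{w(I)}{\det\lambda(I)\prod_{j}\alpha_{I,j}}(\alpha_{I,1}c_{i_1}+\dots+\alpha_{I,n}c_{i_n})^n\in\mathbb{R}[c_i:i\in M]$, where $I=\{i_1<\dots<i_n\}$, $\det\lambda(I)$ is the determinant of the matrix with columns $\lambda(i_1),\dots,\lambda(i_n)$, and $\alpha_{I,j}$ are the (all nonzero) coordinates of a fixed generic $v\in V$ in that basis (independent of $v$). With $\mathcal{D}=\mathbb{R}[\partial_i:i\in M]$, $\partial_i=\partial/\partial c_i$, $\deg\partial_i=2$, the multi-fan algebra is $\mathcal{A}^*(\Delta)=\mathcal{D}/\{D:DV_\Delta=0\}$ and $\operatorname{Hilb}(\mathcal{A}^*(\Delta);t)=\sum_j\dim\mathcal{A}^{2j}(\Delta)t^{2j}$. The link of a vertex $k$ in $\omega$ is the $(n-2)$-cycle $\omega_k=\sum_{I\ni k}\pm w(I)(I\setminus\{k\})$ (induced orientation signs). A cycle is rigid if the dimensions $\dim\mathcal{A}^{2j}$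 of all multi-fans with that cycle are independent of the characteristic function. A multi-fan is suspension-shaped with suspension points $x,y$ if its cycle is the join of some cycle with the $0$-cycle $x-y$; it is editable if $\operatorname{im}(\times\partial_y)=\operatorname{Ker}(\times\partial_x)$ for the multiplication maps $\times\partial_x,\times\partial_y\colon\mathcal{A}^*\to\mathcal{A}^{*+2}$. *)

theory Defs
  imports
    "HOL-Library.Poly_Mapping"
    "HOL-Computational_Algebra.Formal_Power_Series"
    "HOL-Algebra.QuotRing"
    "Jordan_Normal_Form.VS_Connect"
begin

section \<open>Simplicial chains and cycles\<close>

text \<open>
  A chain is the function \<open>w\<close> sending a vertex set \<open>I\<close> to the coefficient of the simplex \<open>I\<close>,
  oriented by the linear order of the vertex type.  The position of \<open>i\<close> in \<open>insert i J\<close> is the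
  number of elements of \<open>J\<close> below \<open>i\<close>; its parity is both the incidence sign of \<open>J\<close> in the
  boundary of \<open>insert i J\<close> and the sign comparing the orientation \<open>(i, J)\<close> with the sorted one.
\<close>

definition vsign :: "'a::linorder \<Rightarrow> 'a set \<Rightarrow> real" where
  "vsign i J = (- 1) ^ card {j \<in> J. j < i}"

definition chain_boundary :: "'a::linorder set \<Rightarrow> ('a set \<Rightarrow> real) \<Rightarrow> 'a set \<Rightarrow> real" where
  "chain_boundary M w J = (\<Sum>i\<in>M - J. vsign i J * w (insert i J))"

text \<open>
  \<open>simplicial_cycle n M w\<close>: \<open>w\<close> is an \<open>(n-1)\<close>-cycle on \<open>M\<close>.  The boundary is augmented: for
  \<open>n = 1\<close> the coefficient of the empty simplex is the sum of all \<open>w {i}\<close>, and for \<open>n = 0\<close> every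
  multiple of the empty simplex is a \<open>(-1)\<close>-cycle.
\<close>

definition simplicial_cycle :: "nat \<Rightarrow> 'a::linorder set \<Rightarrow> ('a set \<Rightarrow> real) \<Rightarrow> bool" where
  "simplicial_cycle n M w \<longleftrightarrow>
     finite M \<and>
     (\<forall>I. w I \<noteq> 0 \<longrightarrow> I \<subseteq> M \<and> card I = n) \<and>
     (\<forall>J\<subseteq>M. chain_boundary M w J = 0)"

definition vertex_link :: "'a::linorder \<Rightarrow> ('a set \<Rightarrow> real) \<Rightarrow> 'a set \<Rightarrow> real" where
  "vertex_link k w J = (if k \<in> J then 0 else vsign k J * w (insert k J))"

text \<open>
  Renaming \<open>k\<close> to a vertex \<open>x\<close> that is either \<open>k\<close> itself or does not occur in \<open>w\<close>: the oriented
  simplex \<open>(k, J)\<close> is sent to \<open>(x, J)\<close>.  Since \<open>x\<close> need not occupy the place of \<open>k\<close> in the linear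
  order, sorting both sides contributes the sign \<open>vsign x J\<close> here and \<open>vsign k J\<close> in the link.
\<close>

definition rename_vertex :: "'a::linorder \<Rightarrow> 'a \<Rightarrow> ('a set \<Rightarrow> real) \<Rightarrow> 'a set \<Rightarrow> real" where
  "rename_vertex k x w I =
     (if x \<in> I then vsign x (I - {x}) * vertex_link k w (I - {x})
      else if k \<in> I then 0 else w I)"

text \<open>
  The join of chains with disjoint vertex sets.  The simplex \<open>A * B\<close> is ordered by \<open>A\<close> followed by
  \<open>B\<close>, so its sign counts the inversions between \<open>A\<close> and \<open>B\<close>.
\<close>

definition chain_join ::
    "('a::linorder set \<Rightarrow> real) \<Rightarrow> ('a set \<Rightarrow> real) \<Rightarrow> 'a set \<Rightarrow> real" where
  "chain_join \<sigma> \<tau> I =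
     (\<Sum>A\<in>Pow I. (- 1) ^ card {(a, b). a \<in> A \<and> b \<in> I - A \<and> b < a} * \<sigma> A * \<tau> (I - A))"

definition point_difference :: "'a \<Rightarrow> 'a \<Rightarrow> 'a set \<Rightarrow> real" where
  "point_difference x y I = (if I = {x} then 1 else 0) - (if I = {y} then 1 else 0)"

section \<open>Multi-fans\<close>

text \<open>A multi-fan with cycle \<open>w\<close> and characteristic function \<open>l\<close> in the space of real
  \<open>n\<close>-vectors.\<close>

definition multi_fan ::
    "nat \<Rightarrow> 'a::linorder set \<Rightarrow> ('a set \<Rightarrow> real) \<Rightarrow> ('a \<Rightarrow> real vec) \<Rightarrow> bool" where
  "multi_fan n M w l \<longleftrightarrow>
     simplicial_cycle n M w \<and>
     (\<forall>i\<in>M. l i \<in> carrier_vec n) \<and>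
     (\<forall>I. w I \<noteq> 0 \<longrightarrow>
        inj_on l I \<and> vectorspace.basis class_ring (module_vec TYPE(real) n) (l ` I))"

definition suspension_shaped ::
    "nat \<Rightarrow> 'a::linorder set \<Rightarrow> ('a set \<Rightarrow> real) \<Rightarrow> 'a \<Rightarrow> 'a \<Rightarrow> bool" where
  "suspension_shaped n M w x y \<longleftrightarrow>
     x \<in> M \<and> y \<in> M \<and> x \<noteq> y \<and>
     (\<exists>\<eta>. simplicial_cycle (n - 1) (M - {x, y}) \<eta> \<and> w = chain_join \<eta> (point_difference x y))"

section \<open>Multivariate polynomials and differential operators\<close>

text \<open>
  The same type serves for polynomials in the variables \<open>c\<^sub>i\<close> and for constant-coefficient
  differential operators, i.e. polynomials in the \<open>\<partial>\<^sub>i\<close>.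
\<close>

type_synonym 'a mpoly = "('a \<Rightarrow>\<^sub>0 nat) \<Rightarrow>\<^sub>0 real"

definition mconst :: "real \<Rightarrow> 'a mpoly" where
  "mconst c = Poly_Mapping.single 0 c"

definition mvar :: "'a \<Rightarrow> 'a mpoly" where
  "mvar i = Poly_Mapping.single (Poly_Mapping.single i 1) 1"

definition homogeneous :: "nat \<Rightarrow> 'a mpoly \<Rightarrow> bool" where
  "homogeneous d p \<longleftrightarrow>
     (\<forall>a\<in>Poly_Mapping.keys p. (\<Sum>i\<in>Poly_Mapping.keys a. Poly_Mapping.lookup a i) = d)"

definition partial :: "'a \<Rightarrow> 'a mpoly \<Rightarrow> 'a mpoly" where
  "partial i f =
     (\<Sum>a\<in>Poly_Mapping.keys f.
        Poly_Mapping.single (a - Poly_Mapping.single i 1)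
          (of_nat (Poly_Mapping.lookup a i) * Poly_Mapping.lookup f a))"

definition partial_monomial :: "('a::linorder \<Rightarrow>\<^sub>0 nat) \<Rightarrow> 'a mpoly \<Rightarrow> 'a mpoly" where
  "partial_monomial a =
     foldr (\<lambda>i. partial i ^^ Poly_Mapping.lookup a i) (sorted_list_of_set (Poly_Mapping.keys a))"

definition apply_operator :: "'a::linorder mpoly \<Rightarrow> 'a mpoly \<Rightarrow> 'a mpoly" where
  "apply_operator D f =
     (\<Sum>a\<in>Poly_Mapping.keys D. mconst (Poly_Mapping.lookup D a) * partial_monomial a f)"

definition operator_ring :: "'a set \<Rightarrow> 'a mpoly ring" where
  "operator_ring M =
     \<lparr>carrier = {D. \<forall>a\<in>Poly_Mapping.keys D. Poly_Mapping.keys a \<subseteq> M},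
      mult = (*), one = 1, zero = 0, add = (+)\<rparr>"

section \<open>The volume polynomial\<close>

definition cone_matrix :: "nat \<Rightarrow> ('a::linorder \<Rightarrow> real vec) \<Rightarrow> 'a set \<Rightarrow> real mat" where
  "cone_matrix n l I = mat_of_cols n (map l (sorted_list_of_set I))"

definition cone_coordinates ::
    "nat \<Rightarrow> ('a::linorder \<Rightarrow> real vec) \<Rightarrow> 'a set \<Rightarrow> real vec \<Rightarrow> real vec" where
  "cone_coordinates n l I v =
     (THE \<alpha>. \<alpha> \<in> carrier_vec n \<and> cone_matrix n l I *\<^sub>v \<alpha> = v)"

definition generic_vector ::
    "nat \<Rightarrow> ('a::linorder set \<Rightarrow> real) \<Rightarrow> ('a \<Rightarrow> real vec) \<Rightarrow> real vec \<Rightarrow> bool" where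
  "generic_vector n w l v \<longleftrightarrow>
     v \<in> carrier_vec n \<and> (\<forall>I. w I \<noteq> 0 \<longrightarrow> (\<forall>j<n. cone_coordinates n l I v $ j \<noteq> 0))"

definition volume_polynomial ::
    "nat \<Rightarrow> ('a::linorder set \<Rightarrow> real) \<Rightarrow> ('a \<Rightarrow> real vec) \<Rightarrow> 'a mpoly" where
  "volume_polynomial n w l =
     (let v = (SOME v. generic_vector n w l v) in
      mconst (1 / fact n) *
      (\<Sum>I | w I \<noteq> 0.
         let \<alpha> = cone_coordinates n l I v in
         mconst (w I / (det (cone_matrix n l I) * (\<Prod>j<n. \<alpha> $ j))) *
         (\<Sum>j<n. mconst (\<alpha> $ j) * mvar (sorted_list_of_set I ! j)) ^ n))"

section \<open>The multi-fan algebra\<close>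

definition annihilator ::
    "nat \<Rightarrow> 'a::linorder set \<Rightarrow> ('a set \<Rightarrow> real) \<Rightarrow> ('a \<Rightarrow> real vec) \<Rightarrow> 'a mpoly set" where
  "annihilator n M w l =
     {D \<in> carrier (operator_ring M). apply_operator D (volume_polynomial n w l) = 0}"

definition multi_fan_algebra ::
    "nat \<Rightarrow> 'a::linorder set \<Rightarrow> ('a set \<Rightarrow> real) \<Rightarrow> ('a \<Rightarrow> real vec) \<Rightarrow> 'a mpoly set ring" where
  "multi_fan_algebra n M w l = operator_ring M Quot annihilator n M w l"

definition operator_class ::
    "nat \<Rightarrow> 'a::linorder set \<Rightarrow> ('a set \<Rightarrow> real) \<Rightarrow> ('a \<Rightarrow> real vec) \<Rightarrow> 'a mpoly \<Rightarrow> 'a mpoly set"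
  where
  "operator_class n M w l D = annihilator n M w l +>\<^bsub>operator_ring M\<^esub> D"

text \<open>
  The graded component of degree \<open>2 * d\<close> (each \<open>\<partial>\<^sub>i\<close> has degree 2), as a real vector space;
  scalars act through the constant operators.
\<close>

definition algebra_component ::
    "nat \<Rightarrow> 'a::linorder set \<Rightarrow> ('a set \<Rightarrow> real) \<Rightarrow> ('a \<Rightarrow> real vec) \<Rightarrow> nat \<Rightarrow>
     (real, 'a mpoly set) module" where
  "algebra_component n M w l d =
     (let A = multi_fan_algebra n M w l in
      \<lparr>carrier = operator_class n M w l ` {D \<in> carrier (operator_ring M). homogeneous d D},
       mult = mult A, one = one A, zero = zero A, add = add A,
       smult = (\<lambda>c X. operator_class n M w l (mconst c) \<otimes>\<^bsub>A\<^esub> X)\<rparr>)"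

definition component_dim ::
    "nat \<Rightarrow> 'a::linorder set \<Rightarrow> ('a set \<Rightarrow> real) \<Rightarrow> ('a \<Rightarrow> real vec) \<Rightarrow> nat \<Rightarrow> nat" where
  "component_dim n M w l d = vectorspace.dim class_ring (algebra_component n M w l d)"

definition Hilb ::
    "nat \<Rightarrow> 'a::linorder set \<Rightarrow> ('a set \<Rightarrow> real) \<Rightarrow> ('a \<Rightarrow> real vec) \<Rightarrow> nat fps" where
  "Hilb n M w l = Abs_fps (\<lambda>e. if even e then component_dim n M w l (e div 2) else 0)"

definition rigid :: "nat \<Rightarrow> 'a::linorder set \<Rightarrow> ('a set \<Rightarrow> real) \<Rightarrow> bool" where
  "rigid n M w \<longleftrightarrow>
     (\<forall>l\<^sub>1 l\<^sub>2. multi_fan n M w l\<^sub>1 \<and> multi_fan n M w l\<^sub>2 \<longrightarrow>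
        (\<forall>d. component_dim n M w l\<^sub>1 d = component_dim n M w l\<^sub>2 d))"

text \<open>Only suspension-shaped multi-fans are called editable.\<close>

definition editable ::
    "nat \<Rightarrow> 'a::linorder set \<Rightarrow> ('a set \<Rightarrow> real) \<Rightarrow> ('a \<Rightarrow> real vec) \<Rightarrow> 'a \<Rightarrow> 'a \<Rightarrow> bool" where
  "editable n M w l x y \<longleftrightarrow>
     suspension_shaped n M w x y \<and>
     (let A = multi_fan_algebra n M w l; \<delta> = (\<lambda>i. operator_class n M w l (mvar i)) in
      (\<lambda>a. a \<otimes>\<^bsub>A\<^esub> \<delta> y) ` carrier A = {a \<in> carrier A. a \<otimes>\<^bsub>A\<^esub> \<delta> x = \<zero>\<^bsub>A\<^esub>})"

section \<open>The difference of two renamed cycles is a suspension\<close>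

lemma vsign_insert:
  assumes "finite J" "i \<notin> J"
  shows "vsign k (insert i J) = (if i < k then - vsign k J else vsign k J)"
proof -
  have "{j \<in> insert i J. j < k} =
      (if i < k then insert i {j \<in> J. j < k} else {j \<in> J. j < k})"
    by auto
  with assms show ?thesis by (simp add: vsign_def)
qed

lemma simplicial_cycle_vertex_link:
  assumes "simplicial_cycle n M w" "k \<in> M"
  shows "simplicial_cycle (n - 1) (M - {k}) (vertex_link k w)"
proof -
  have fin: "finite M" and supp: "\<And>I. w I \<noteq> 0 \<Longrightarrow> I \<subseteq> M \<and> card I = n"
    and bd: "\<And>J. J \<subseteq> M \<Longrightarrow> chain_boundary M w J = 0"
    using assms(1) by (auto simp: simplicial_cycle_def)
  have "I \<subseteq> M - {k} \<and> card I = n - 1" if "vertex_link k w I \<noteq> 0" for I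
  proof -
    have k: "k \<notin> I" and "w (insert k I) \<noteq> 0"
      using that by (auto simp: vertex_link_def split: if_splits)
    from supp[OF this(2)] have "insert k I \<subseteq> M" "card (insert k I) = n" by auto
    moreover from this have "finite I" using fin by (meson finite_insert finite_subset)
    ultimately show ?thesis using k by auto
  qed
  moreover have "chain_boundary (M - {k}) (vertex_link k w) J = 0" if J: "J \<subseteq> M - {k}" for J
  proof -
    have fJ: "finite J" and kJ: "k \<notin> J" using J fin finite_subset by auto
    have "vsign i J * vertex_link k w (insert i J) =
        - vsign k J * (vsign i (insert k J) * w (insert i (insert k J)))"
      if "i \<in> M - insert k J" for i
    proof -
      have "i \<noteq> k" "i \<notin> J" using that by auto
      then have "vsign i J * vsign k (insert i J) = - vsign k J * vsign i (insert k J)"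
        using kJ by (auto simp: vsign_insert[OF fJ])
      then show ?thesis using \<open>i \<noteq> k\<close> kJ
        by (simp add: vertex_link_def insert_commute) (metis mult.assoc mult_minus_left)
    qed
    moreover have "M - {k} - J = M - insert k J" by auto
    ultimately have "chain_boundary (M - {k}) (vertex_link k w) J =
        - vsign k J * chain_boundary M w (insert k J)"
      unfolding chain_boundary_def sum_distrib_left by (intro sum.cong) auto
    also have "\<dots> = 0" using bd[of "insert k J"] J assms(2) by auto
    finally show ?thesis .
  qed
  ultimately show ?thesis using fin by (auto simp: simplicial_cycle_def)
qed

lemma chain_join_point_difference:
  assumes "finite I" "x \<noteq> y" "\<And>J. \<eta> J \<noteq> 0 \<Longrightarrow> card J = d"
  shows "chain_join \<eta> (point_difference x y) I =
     (- 1) ^ d * ((if x \<in> I then vsign x (I - {x}) * \<eta> (I - {x}) else 0)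
                - (if y \<in> I then vsign y (I - {y}) * \<eta> (I - {y}) else 0))"
proof -
  define s :: "'a set \<Rightarrow> real"
    where "s A = (- 1) ^ card {(a, b). a \<in> A \<and> b \<in> I - A \<and> b < a}" for A
  have sgn: "s (I - {z}) * \<eta> (I - {z}) = (- 1) ^ d * (vsign z (I - {z}) * \<eta> (I - {z}))"
    if "z \<in> I" for z
  proof (cases "\<eta> (I - {z}) = 0")
    case False
    let ?A = "I - {z}"
    have "{(a, b). a \<in> ?A \<and> b \<in> I - ?A \<and> b < a} = (\<lambda>a. (a, z)) ` {a \<in> ?A. z < a}"
      using that by auto
    then have 1: "s ?A = (- 1) ^ card {a \<in> ?A. z < a}"
      unfolding s_def by (simp add: card_image inj_on_def)
    have "card ({a \<in> ?A. z < a} \<union> {a \<in> ?A. a < z}) =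
        card {a \<in> ?A. z < a} + card {a \<in> ?A. a < z}"
      using assms(1) by (intro card_Un_disjoint) auto
    moreover have "{a \<in> ?A. z < a} \<union> {a \<in> ?A. a < z} = ?A" by auto
    moreover have "card ?A = d" using assms(3) False by blast
    ultimately have d: "d = card {a \<in> ?A. z < a} + card {a \<in> ?A. a < z}" by metis
    have "(- 1) ^ d * vsign z ?A = s ?A"
      unfolding vsign_def 1 d by (simp add: power_add mult.assoc flip: power_mult_distrib)
    then show ?thesis by (metis mult.assoc)
  qed simp
  have one: "(\<Sum>A\<in>Pow I. s A * \<eta> A * (if I - A = {z} then 1 else 0)) =
      (if z \<in> I then s (I - {z}) * \<eta> (I - {z}) else 0)" for z
  proof -
    have "s A * \<eta> A * (if I - A = {z} then 1 else 0) =
        (if A = I - {z} then (if z \<in> I then s A * \<eta> A else 0) else 0)" if "A \<in> Pow I" for A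
    proof -
      have "I - A = {z} \<longleftrightarrow> A = I - {z} \<and> z \<in> I" using that by blast
      then show ?thesis by simp
    qed
    then have "(\<Sum>A\<in>Pow I. s A * \<eta> A * (if I - A = {z} then 1 else 0)) =
        (\<Sum>A\<in>Pow I. if A = I - {z} then (if z \<in> I then s A * \<eta> A else 0) else 0)"
      by (rule sum.cong[OF refl])
    also have "\<dots> = (if z \<in> I then s (I - {z}) * \<eta> (I - {z}) else 0)"
      using assms(1) by (subst sum.delta) auto
    finally show ?thesis .
  qed
  have "chain_join \<eta> (point_difference x y) I =
      (\<Sum>A\<in>Pow I. s A * \<eta> A * (if I - A = {x} then 1 else 0)) -
      (\<Sum>A\<in>Pow I. s A * \<eta> A * (if I - A = {y} then 1 else 0))"
    unfolding chain_join_def point_difference_def s_def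
    by (simp only: right_diff_distrib sum_subtractf)
  also have "\<dots> =
      (if x \<in> I then s (I - {x}) * \<eta> (I - {x}) else 0) -
      (if y \<in> I then s (I - {y}) * \<eta> (I - {y}) else 0)"
    by (simp only: one)
  also have "\<dots> = (- 1) ^ d * ((if x \<in> I then vsign x (I - {x}) * \<eta> (I - {x}) else 0)
                - (if y \<in> I then vsign y (I - {y}) * \<eta> (I - {y}) else 0))"
    by (auto simp only: sgn right_diff_distrib if_True if_False mult_zero_right split: if_split)
  finally show ?thesis .
qed

lemma suspension_shaped_rename_difference:
  assumes w: "simplicial_cycle n S w" and n: "1 \<le> n" and k: "k \<in> S"
    and xy: "x \<notin> S - {k}" "y \<notin> S - {k}" "x \<noteq> y"
  shows "suspension_shaped n (S - {k} \<union> {x, y})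
           (\<lambda>I. rename_vertex k y w I - rename_vertex k x w I) x y"
proof -
  let ?T = "\<lambda>I. rename_vertex k y w I - rename_vertex k x w I"
  define \<eta> where "\<eta> J = (- 1) ^ n * vertex_link k w J" for J
  have lk: "simplicial_cycle (n - 1) (S - {k}) (vertex_link k w)"
    using simplicial_cycle_vertex_link[OF w k] .
  then have fin: "finite S" and
    supp: "\<And>J. vertex_link k w J \<noteq> 0 \<Longrightarrow> J \<subseteq> S - {k} \<and> card J = n - 1"
    and "\<And>J. J \<subseteq> S - {k} \<Longrightarrow> chain_boundary (S - {k}) (vertex_link k w) J = 0"
    by (auto simp: simplicial_cycle_def)
  moreover have "chain_boundary X \<eta> J = (- 1) ^ n * chain_boundary X (vertex_link k w) J" for X J
    unfolding chain_boundary_def \<eta>_def sum_distrib_left by (simp add: mult_ac)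
  moreover have "S - {k} \<union> {x, y} - {x, y} = S - {k}" using xy by auto
  ultimately have \<eta>: "simplicial_cycle (n - 1) (S - {k} \<union> {x, y} - {x, y}) \<eta>"
    by (auto simp: simplicial_cycle_def \<eta>_def)
  have supp_w: "\<And>I. w I \<noteq> 0 \<Longrightarrow> I \<subseteq> S" using w by (auto simp: simplicial_cycle_def)
  have "?T I = chain_join \<eta> (point_difference x y) I" for I
  proof (cases "finite I")
    case True
    have sgn: "(- 1) ^ (n - 1) * (- 1) ^ n = (- 1 :: real)"
      using n by (cases n) (auto simp flip: power_mult_distrib)
    have J: "chain_join \<eta> (point_difference x y) I =
        (if y \<in> I then vsign y (I - {y}) * vertex_link k w (I - {y}) else 0) -
        (if x \<in> I then vsign x (I - {x}) * vertex_link k w (I - {x}) else 0)"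
    proof -
      have e: "(- 1) ^ (n - 1) * (vsign z A * \<eta> A) = - (vsign z A * vertex_link k w A)" for z A
        unfolding \<eta>_def using sgn
        by (metis (no_types, opaque_lifting) mult.assoc mult.left_commute mult_minus1)
      have "\<eta> J \<noteq> 0 \<Longrightarrow> card J = n - 1" for J using supp[of J] by (auto simp: \<eta>_def)
      from chain_join_point_difference[OF True xy(3) this] show ?thesis
        using e by (simp add: right_diff_distrib)
    qed
    have zero: "vertex_link k w (I - {a}) = 0" if "a \<noteq> b" "b \<in> I" "b \<notin> S - {k}" for a b
      using supp[of "I - {a}"] that by auto
    have out: "w I = 0" if "b \<in> I" "b \<notin> S - {k}" "k \<notin> I" for b
      using supp_w[of I] that by auto
    show ?thesis
      unfolding J rename_vertex_def using zero[of x y] zero[of y x] out[of x] out[of y] xy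
      by auto
  next
    case False
    then have inf: "\<And>z. infinite (I - {z})" by simp
    have "w I = 0" using supp_w[of I] fin False finite_subset by blast
    moreover have "vertex_link k w (I - {z}) = 0" for z
      using supp[of "I - {z}"] inf fin by (meson finite_Diff finite_subset)
    moreover have "chain_join \<eta> (point_difference x y) I = 0"
      using False by (simp add: chain_join_def)
    ultimately show ?thesis by (simp add: rename_vertex_def)
  qed
  then show ?thesis using \<eta> xy unfolding suspension_shaped_def by blast
qed

end

theory Submission
  imports Defs "Jordan_Normal_Form.DL_Rank"
begin

text \<open>
  Let \<open>N'\<close>, \<open>N''\<close>, \<open>N\<close> be the annihilators of \<open>V\<^sub>\<Delta>\<^sub>'\<close>, \<open>V\<^sub>\<Delta>\<^sub>'\<^sub>'\<close> and \<open>V\<^sub>T = V\<^sub>\<Delta>\<^sub>'\<^sub>' - V\<^sub>\<Delta>\<^sub>'\<close>; here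
  \<open>\<partial>\<^sub>y\<close> kills the first polynomial and \<open>\<partial>\<^sub>x\<close> the second.  Editability says that the annihilator of
  \<open>\<partial>\<^sub>x V\<^sub>T\<close> is \<open>N + (\<partial>\<^sub>y)\<close>.  Up to a linear substitution \<open>\<partial>\<^sub>x V\<^sub>\<Delta>\<^sub>'\<close> and \<open>\<partial>\<^sub>y V\<^sub>\<Delta>\<^sub>'\<^sub>'\<close> are multiples of the volume
  polynomials of two multi-fans over the link of \<open>k\<close>, so by rigidity their annihilators have equal
  dimensions in every degree; counting dimensions, the annihilator of \<open>\<partial>\<^sub>y V\<^sub>T\<close> is \<open>N + (\<partial>\<^sub>x)\<close>.
  An element of \<open>N'\<close> annihilates \<open>\<partial>\<^sub>x V\<^sub>T\<close>, hence lies in \<open>N + (\<partial>\<^sub>y)\<close>, and its component in \<open>N\<close>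
  annihilates \<open>V\<^sub>\<Delta>\<^sub>'\<^sub>'\<close>; by symmetry \<open>N' + (\<partial>\<^sub>x) = N'' + (\<partial>\<^sub>y)\<close>.  The codimension of \<open>N' + (\<partial>\<^sub>x)\<close> in degree
  \<open>d\<close> is \<open>dim \<A>\<^sup>2\<^sup>d(\<Delta>')\<close> minus a dimension belonging to the link, and likewise for \<open>\<Delta>''\<close>.

  That the volume polynomial is independent of \<open>v\<close> follows by coning the cycle off with a generic
  vector \<open>u\<close>: each summand changes by a divided difference over the faces of a simplex, and the
  contributions of the coned facets cancel because the boundary of the cycle vanishes.
\<close>

subsection \<open>Dimensions of spaces of operators\<close>

text \<open>The fans and the link live on different vertex sets, while volume polynomials can be
  subtracted only over \<open>M\<close>. All dimensions are therefore taken inside one space, the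
  operators of a fixed degree on \<open>M\<close>; the algebras of both fans and of the link of
  \<open>k\<close> become its quotients along linear substitutions that send ghost variables to 0.
  The substitution for the link comes from a linear functional h with value 1 at \<open>l' k\<close>
  and 0 at \<open>v\<close>. Since h(v) = 0, the sum of all \<open>h (l' i)\<close> times
  \<open>\<partial>\<^sub>i\<close> kills each single summand of the volume polynomial, so on the
  star of \<open>k\<close> the derivative at \<open>k\<close> can be traded for a linear form in the
  other derivatives. The difference \<open>V\<^sub>T\<close> is formed with the same
  \<open>v\<close> in all sums, whereas each volume polynomial comes with its own choice of
  \<open>v\<close>; this is why independence of \<open>v\<close> has to be proved. Editability
  treats \<open>x\<close> and \<open>y\<close> asymmetrically. Rigidity enters exactly once, to
  recover the mirrored statement: the links of the two fans have the same cycle but are projected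
  along different vectors.\<close>

definition poly_space :: "'a mpoly set \<Rightarrow> (real, 'a mpoly) module" where
  "poly_space U =
     \<lparr>carrier = U, mult = (*), one = 1, zero = 0, add = (+), smult = (\<lambda>c p. mconst c * p)\<rparr>"

definition poly_subspace :: "'a mpoly set \<Rightarrow> bool" where
  "poly_subspace U \<longleftrightarrow>
     0 \<in> U \<and> (\<forall>p\<in>U. \<forall>q\<in>U. p + q \<in> U) \<and> (\<forall>c. \<forall>p\<in>U. mconst c * p \<in> U)"

definition poly_dim :: "'a mpoly set \<Rightarrow> nat" where
  "poly_dim U = vectorspace.dim class_ring (poly_space U)"

definition poly_fin_dim :: "'a mpoly set \<Rightarrow> bool" where
  "poly_fin_dim U \<longleftrightarrow> vectorspace.fin_dim class_ring (poly_space U)"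

lemma poly_space_sel [simp]:
  "carrier (poly_space U) = U" "zero (poly_space U) = 0" "add (poly_space U) = (+)"
  "smult (poly_space U) c p = mconst c * p" "(poly_space U)\<lparr>carrier := W\<rparr> = poly_space W"
  by (auto simp: poly_space_def)

lemma mconst_simps:
  "mconst (a + b) = mconst a + mconst b" "mconst (a * b) = mconst a * mconst b"
  "mconst 1 = 1" "mconst 0 = 0" "mconst (- a) = - mconst a"
  by (auto simp: mconst_def single_add mult_single single_uminus)

lemma poly_subspace_uminus: "poly_subspace U \<Longrightarrow> p \<in> U \<Longrightarrow> - p \<in> U"
  unfolding poly_subspace_def by (metis mconst_simps(3,5) mult_minus1)

lemma vectorspace_poly_space:
  assumes "poly_subspace U"
  shows "vectorspace class_ring (poly_space U)"
proof (rule vs_criteria)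
  show "\<forall>v\<in>carrier (poly_space U). \<exists>w\<in>carrier (poly_space U).
      v \<oplus>\<^bsub>poly_space U\<^esub> w = \<zero>\<^bsub>poly_space U\<^esub>"
    using poly_subspace_uminus[OF assms] by (auto intro!: bexI[of _ "- _"])
qed (use assms in \<open>auto simp: class_field class_ring_simps mconst_simps algebra_simps
      poly_subspace_def\<close>)

lemma subspace_poly_space:
  assumes "poly_subspace U" "poly_subspace W" "W \<subseteq> U"
  shows "VectorSpace.subspace class_ring W (poly_space U)"
  using assms vectorspace_poly_space[OF assms(1)]
  by (auto simp: subspace_def submodule_def vectorspace_def poly_subspace_def)

text \<open>The target is an arbitrary vector space, since it will be a graded component of a
  quotient algebra or a space of functions; linearity is asked on \<open>U\<close> only, where
  classes of operators are known to add.\<close>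

definition poly_linear ::
    "'a mpoly set \<Rightarrow> (real, 'b, 'c) module_scheme \<Rightarrow> ('a mpoly \<Rightarrow> 'b) \<Rightarrow> bool" where
  "poly_linear U W T \<longleftrightarrow>
     T ` U \<subseteq> carrier W \<and> (\<forall>p\<in>U. \<forall>q\<in>U. T (p + q) = T p \<oplus>\<^bsub>W\<^esub> T q) \<and>
     (\<forall>c. \<forall>p\<in>U. T (mconst c * p) = c \<odot>\<^bsub>W\<^esub> T p)"

lemma linear_map_poly_space:
  assumes "poly_subspace U" "vectorspace class_ring W" "poly_linear U W T"
  shows "linear_map class_ring (poly_space U) W T"
proof -
  interpret V: vectorspace class_ring "poly_space U" by (rule vectorspace_poly_space[OF assms(1)])
  interpret W: vectorspace class_ring W by (rule assms(2))
  show ?thesis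
    by unfold_locales
      (use assms(3) in \<open>auto simp: module_hom_def poly_linear_def class_ring_simps\<close>)
qed

lemma poly_rank_nullity:
  assumes "poly_subspace U" "poly_fin_dim U" "vectorspace class_ring W" "poly_linear U W T"
  shows "vectorspace.dim class_ring (W\<lparr>carrier := T ` U\<rparr>) +
    poly_dim {p \<in> U. T p = \<zero>\<^bsub>W\<^esub>} = poly_dim U"
proof -
  interpret T: linear_map class_ring "poly_space U" W T
    by (rule linear_map_poly_space[OF assms(1,3,4)])
  show ?thesis
    using T.rank_nullity assms(2)
    by (simp add: T.im_def T.ker_def poly_dim_def poly_fin_dim_def)
qed

text \<open>Each vector space axiom for \<open>W\<close> is the \<open>T\<close>-image of the same
  axiom in \<open>U\<close>. Graded components of the algebra, and the function space in which
  annihilators appear as kernels, are recognised as vector spaces in this way.\<close>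

lemma vectorspace_image:
  fixes W :: "(real, 'b, 'c) module_scheme"
  assumes U: "poly_subspace U" and im: "carrier W = T ` U"
    and zero: "zero W = T 0"
    and add: "\<And>p q. p \<in> U \<Longrightarrow> q \<in> U \<Longrightarrow> T p \<oplus>\<^bsub>W\<^esub> T q = T (p + q)"
    and smult: "\<And>c p. p \<in> U \<Longrightarrow> c \<odot>\<^bsub>W\<^esub> T p = T (mconst c * p)"
  shows "vectorspace class_ring W"
proof -
  have cl: "0 \<in> U" "\<And>p q. p \<in> U \<Longrightarrow> q \<in> U \<Longrightarrow> p + q \<in> U" "\<And>c p. p \<in> U \<Longrightarrow> mconst c * p \<in> U"
    using U by (auto simp: poly_subspace_def)
  show ?thesis
  proof (rule vs_criteria)
    show "\<forall>v\<in>carrier W. \<exists>w\<in>carrier W. v \<oplus>\<^bsub>W\<^esub> w = \<zero>\<^bsub>W\<^esub>"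
    proof
      fix v assume "v \<in> carrier W"
      then obtain p where "p \<in> U" "v = T p" using im by auto
      then show "\<exists>w\<in>carrier W. v \<oplus>\<^bsub>W\<^esub> w = \<zero>\<^bsub>W\<^esub>"
        using poly_subspace_uminus[OF U] by (auto simp: im zero add intro!: bexI[of _ "- p"])
    qed
  qed (auto simp: class_field class_ring_simps im zero add smult cl mconst_simps add_ac
      distrib_left distrib_right mult.assoc)
qed

text \<open>Independence does not depend on the ambient space, so independent subsets of
  \<open>W\<close> have at most dim \<open>U\<close> elements, and a maximal one generates
  \<open>W\<close>.\<close>

lemma poly_fin_dim_subset:
  assumes "poly_subspace U" "poly_subspace W" "W \<subseteq> U" "poly_fin_dim U"
  shows "poly_fin_dim W"
proof -
  interpret V: vectorspace class_ring "poly_space U" by (rule vectorspace_poly_space[OF assms(1)])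
  interpret W: vectorspace class_ring "poly_space W" by (rule vectorspace_poly_space[OF assms(2)])
  have fd: "V.fin_dim" using assms(4) by (simp add: poly_fin_dim_def)
  have sub: "submodule class_ring W (poly_space U)"
    using subspace_poly_space[OF assms(1-3)] by (simp add: subspace_def)
  have li: "finite A \<and> card A \<le> V.dim" if "A \<subseteq> W" "W.lin_indpt A" for A
  proof -
    have "V.lin_indpt A" using V.span_li_not_depend(2)[OF that(1) sub] that(2) by simp
    then show ?thesis using V.li_le_dim[OF fd, of A] that assms(3) by auto
  qed
  have "W.lin_indpt {}" by (simp add: W.lin_dep_def)
  from maximal_exists[of "\<lambda>A. A \<subseteq> W \<and> W.lin_indpt A" V.dim "{}"] li this
  obtain A where A: "finite A" "maximal A (\<lambda>A. A \<subseteq> W \<and> W.lin_indpt A)"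
    by auto
  then have "A \<subseteq> W" "W.gen_set A"
    using W.max_li_is_gen[of A] by (auto simp: maximal_def)
  then show ?thesis unfolding poly_fin_dim_def W.fin_dim_def using A(1) by auto
qed

text \<open>A basis of \<open>W\<close> is independent in \<open>U\<close> and has as many elements
  as a basis of \<open>U\<close>, so it spans \<open>U\<close>.\<close>

lemma poly_subspace_eqI:
  assumes "poly_subspace U" "poly_subspace W" "W \<subseteq> U" "poly_fin_dim U" "poly_dim W = poly_dim U"
  shows "W = U"
proof -
  interpret V: vectorspace class_ring "poly_space U" by (rule vectorspace_poly_space[OF assms(1)])
  interpret W: vectorspace class_ring "poly_space W" by (rule vectorspace_poly_space[OF assms(2)])
  have fd: "V.fin_dim" using assms(4) by (simp add: poly_fin_dim_def)
  have sub: "submodule class_ring W (poly_space U)"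
    using subspace_poly_space[OF assms(1-3)] by (simp add: subspace_def)
  have "W.fin_dim" using poly_fin_dim_subset[OF assms(1-4)] by (simp add: poly_fin_dim_def)
  then obtain B where B: "finite B" "W.basis B" using W.finite_basis_exists by auto
  then have "card B = V.dim" using W.dim_basis[OF B] assms(5) by (simp add: poly_dim_def)
  have BW: "B \<subseteq> W" "W.lin_indpt B" "W.span B = W" using B(2) by (auto simp: W.basis_def)
  have "V.lin_indpt B" using V.span_li_not_depend(2)[OF BW(1) sub] BW(2) by simp
  then have "V.basis B"
    using V.dim_li_is_basis[OF fd B(1)] BW assms(3) \<open>card B = V.dim\<close> by auto
  then have "V.span B = U" by (auto simp: V.basis_def)
  then show ?thesis using V.span_li_not_depend(1)[OF BW(1) sub] BW(3) by simp
qed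

text \<open>Because \<open>q\<close> kills \<open>N\<close>, it has the same image on N + m(U) as
  \<open>q\<close> after \<open>m\<close> has on \<open>U\<close>. The kernels are \<open>N\<close>
  and the preimage of \<open>N\<close> under \<open>m\<close>, so two applications of rank-nullity
  give the count without forming a quotient.\<close>

lemma poly_dim_kernel_sum:
  assumes V: "poly_subspace V" "poly_fin_dim V" and W: "vectorspace class_ring W" "poly_linear V W q"
    and U: "poly_subspace U" "poly_fin_dim U"
    and m: "\<And>p. p \<in> U \<Longrightarrow> m p \<in> V" "\<And>p p'. p \<in> U \<Longrightarrow> p' \<in> U \<Longrightarrow> m (p + p') = m p + m p'"
      "\<And>c p. p \<in> U \<Longrightarrow> m (mconst c * p) = mconst c * m p"
  defines "N \<equiv> {p \<in> V. q p = \<zero>\<^bsub>W\<^esub>}"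
  shows "poly_dim {a + m b | a b. a \<in> N \<and> b \<in> U} + poly_dim {b \<in> U. m b \<in> N} =
    poly_dim N + poly_dim U"
proof -
  let ?S = "{a + m b | a b. a \<in> N \<and> b \<in> U}"
  interpret W: vectorspace class_ring W by (rule W(1))
  interpret q: linear_map class_ring "poly_space V" W q
    by (rule linear_map_poly_space[OF V(1) W])
  have cl: "0 \<in> V" "\<And>p q. p \<in> V \<Longrightarrow> q \<in> V \<Longrightarrow> p + q \<in> V" "\<And>c p. p \<in> V \<Longrightarrow> mconst c * p \<in> V"
    using V by (auto simp: poly_subspace_def)
  have clU: "0 \<in> U" "\<And>p q. p \<in> U \<Longrightarrow> q \<in> U \<Longrightarrow> p + q \<in> U" "\<And>c p. p \<in> U \<Longrightarrow> mconst c * p \<in> U"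
    using U by (auto simp: poly_subspace_def)
  have ql: "\<And>p p'. p \<in> V \<Longrightarrow> p' \<in> V \<Longrightarrow> q (p + p') = q p \<oplus>\<^bsub>W\<^esub> q p'"
    "\<And>c p. p \<in> V \<Longrightarrow> q (mconst c * p) = c \<odot>\<^bsub>W\<^esub> q p" "\<And>p. p \<in> V \<Longrightarrow> q p \<in> carrier W"
    using W(2) by (auto simp: poly_linear_def)
  have q0: "q 0 = \<zero>\<^bsub>W\<^esub>" using q.f0_is_0 by simp
  have Nsub: "poly_subspace N"
    unfolding poly_subspace_def N_def by (auto simp: cl ql q0 class_ring_simps)
  have m0: "m 0 = 0" using m(3)[of 0 0] clU(1) by (simp add: mconst_simps)
  have NV: "N \<subseteq> V" by (auto simp: N_def)
  have Ssub: "poly_subspace ?S"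
    unfolding poly_subspace_def
  proof (intro conjI ballI allI)
    show "0 \<in> ?S" using Nsub clU(1) m0 by (force simp: poly_subspace_def)
    show "p + r \<in> ?S" if pr: "p \<in> ?S" "r \<in> ?S" for p r
    proof -
      obtain a b a' b' where "p = a + m b" "r = a' + m b'" "a \<in> N" "b \<in> U" "a' \<in> N" "b' \<in> U"
        using pr by auto
      then have "p + r = (a + a') + m (b + b')" "a + a' \<in> N" "b + b' \<in> U"
        using Nsub clU m by (auto simp: poly_subspace_def)
      then show ?thesis by blast
    qed
    show "mconst c * p \<in> ?S" if p: "p \<in> ?S" for c p
    proof -
      obtain a b where "p = a + m b" "a \<in> N" "b \<in> U" using p by auto
      then have "mconst c * p = mconst c * a + m (mconst c * b)" "mconst c * a \<in> N" "mconst c * b \<in> U"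
        using Nsub clU m by (auto simp: poly_subspace_def algebra_simps)
      then show ?thesis by blast
    qed
  qed
  have SV: "?S \<subseteq> V" using m(1) NV cl by auto
  have lS: "poly_linear ?S W q" unfolding poly_linear_def using SV ql by (blast dest: subsetD)
  have fS: "poly_fin_dim ?S" by (rule poly_fin_dim_subset[OF V(1) Ssub SV V(2)])
  have l2: "poly_linear U W (\<lambda>b. q (m b))"
    using m ql by (auto simp: poly_linear_def)
  have "q ` ?S = (\<lambda>b. q (m b)) ` U"
  proof
    show "q ` ?S \<subseteq> (\<lambda>b. q (m b)) ` U"
    proof
      fix z assume "z \<in> q ` ?S"
      then obtain a b where ab: "z = q (a + m b)" "a \<in> N" "b \<in> U" by auto
      then have "z = q (m b)" using ql m(1) by (auto simp: N_def)
      then show "z \<in> (\<lambda>b. q (m b)) ` U" using ab by auto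
    qed
    show "(\<lambda>b. q (m b)) ` U \<subseteq> q ` ?S"
      using Nsub by (force simp: poly_subspace_def)
  qed
  moreover have "{p \<in> ?S. q p = \<zero>\<^bsub>W\<^esub>} = N"
    using SV m0 clU(1) by (force simp: N_def)
  moreover have "{b \<in> U. q (m b) = \<zero>\<^bsub>W\<^esub>} = {b \<in> U. m b \<in> N}"
    using m(1) by (auto simp: N_def)
  ultimately show ?thesis
    using poly_rank_nullity[OF Ssub fS W(1) lS] poly_rank_nullity[OF U W(1) l2] by simp
qed

abbreviation "lookup \<equiv> Poly_Mapping.lookup"
abbreviation "keys \<equiv> Poly_Mapping.keys"

subsection \<open>Monomials\<close>

lemma mpoly_expand: "p = (\<Sum>a\<in>keys p. Poly_Mapping.single a (lookup p a))"
  by (intro poly_mapping_eqI)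
    (auto simp: lookup_sum lookup_single when_def not_in_keys_iff_lookup_eq_zero
      sum.delta intro!: sum.neutral sum.cong)

lemma mpoly_induct [case_names single add]:
  fixes p :: "'a mpoly"
  assumes "\<And>a c. P (Poly_Mapping.single a c)" "\<And>p q. P p \<Longrightarrow> P q \<Longrightarrow> P (p + q)"
  shows "P p"
proof -
  have P0: "P 0" using assms(1)[of 0 0] by simp
  have "P (\<Sum>a\<in>A. Poly_Mapping.single a (lookup p a))" if "finite A" for A
    using that by induction (simp_all add: P0 assms)
  from this[of "keys p"] show ?thesis using mpoly_expand[of p] by simp
qed

definition mon :: "('a \<Rightarrow> 'b::comm_monoid_mult) \<Rightarrow> ('a \<Rightarrow>\<^sub>0 nat) \<Rightarrow> 'b" where
  "mon z a = (\<Prod>i\<in>keys a. z i ^ lookup a i)"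

lemma mon_superset: "finite A \<Longrightarrow> keys a \<subseteq> A \<Longrightarrow> mon z a = (\<Prod>i\<in>A. z i ^ lookup a i)"
  unfolding mon_def by (intro prod.mono_neutral_left) (auto simp: not_in_keys_iff_lookup_eq_zero)

lemma mon_add: "mon z (a + b) = mon z a * mon z b"
proof -
  let ?A = "keys a \<union> keys b"
  have "keys (a + b) \<subseteq> ?A" by (rule keys_add)
  then show ?thesis
    by (simp add: mon_superset[of ?A] lookup_add power_add prod.distrib)
qed

lemma mon_single: "mon z (Poly_Mapping.single i m) = z i ^ m"
  by (cases "m = 0") (simp_all add: mon_def)

lemma mon_0 [simp]: "mon z 0 = 1"
  by (simp add: mon_def)

definition mdeg :: "('a \<Rightarrow>\<^sub>0 nat) \<Rightarrow> nat" where
  "mdeg a = (\<Sum>i\<in>keys a. lookup a i)"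

lemma mdeg_superset: "finite A \<Longrightarrow> keys a \<subseteq> A \<Longrightarrow> mdeg a = (\<Sum>i\<in>A. lookup a i)"
  unfolding mdeg_def by (intro sum.mono_neutral_left) (auto simp: not_in_keys_iff_lookup_eq_zero)

lemma mdeg_add: "mdeg (a + b) = mdeg a + mdeg b"
proof -
  let ?A = "keys a \<union> keys b"
  have "keys (a + b) \<subseteq> ?A" by (rule keys_add)
  then show ?thesis
    by (simp add: mdeg_superset[of ?A] lookup_add sum.distrib)
qed

lemma mdeg_single [simp]: "mdeg (Poly_Mapping.single i m) = m"
  by (cases "m = 0") (simp_all add: mdeg_def)

lemma mdeg_0 [simp]: "mdeg 0 = 0"
  by (simp add: mdeg_def)

text \<open>The multi-index factorial, i.e. the derivative of the monomial \<open>a\<close> by its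
  own exponent. Weighting coefficients by it removes the numerical factors of
  differentiation.\<close>

definition mfact :: "('a \<Rightarrow>\<^sub>0 nat) \<Rightarrow> real" where
  "mfact a = (\<Prod>i\<in>keys a. fact (lookup a i))"

lemma mfact_nonzero [simp]: "mfact a \<noteq> 0"
  by (simp add: mfact_def)

lemma mfact_add_single:
  "mfact (a + Poly_Mapping.single i 1) = real (lookup a i + 1) * mfact a"
proof -
  let ?A = "insert i (keys a)" and ?b = "a + Poly_Mapping.single i 1"
  have "keys ?b \<subseteq> ?A" using keys_add[of a "Poly_Mapping.single i 1"] by auto
  then have "mfact ?b = (\<Prod>j\<in>?A. fact (lookup ?b j))"
    unfolding mfact_def
    by (intro prod.mono_neutral_left) (auto simp: not_in_keys_iff_lookup_eq_zero)
  also have "\<dots> = fact (lookup a i + 1) * (\<Prod>j\<in>?A - {i}. fact (lookup ?b j))"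
    by (subst prod.remove[of _ i]) (auto simp: lookup_add)
  also have "(\<Prod>j\<in>?A - {i}. fact (lookup ?b j)) = (\<Prod>j\<in>?A - {i}. fact (lookup a j) :: real)"
    by (rule prod.cong[OF refl]) (auto simp: lookup_add lookup_single when_def)
  also have "fact (lookup a i + 1) * (\<Prod>j\<in>?A - {i}. fact (lookup a j)) =
      real (lookup a i + 1) * (fact (lookup a i) * (\<Prod>j\<in>?A - {i}. fact (lookup a j)))"
    by simp
  also have "fact (lookup a i) * (\<Prod>j\<in>?A - {i}. fact (lookup a j)) =
      (\<Prod>j\<in>?A. fact (lookup a j) :: real)"
    by (rule prod.remove[symmetric]) auto
  also have "(\<Prod>j\<in>?A. fact (lookup a j)) = mfact a"
    unfolding mfact_def
    by (intro prod.mono_neutral_right) (auto simp: not_in_keys_iff_lookup_eq_zero)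
  finally show ?thesis .
qed

subsection \<open>Evaluation\<close>

text \<open>The map \<open>c\<close> on coefficients is left open so that evaluation at real points
  (\<open>peval\<close>) and substitution of polynomials (\<open>psubst\<close>) share their
  lemmas.\<close>

definition insertion :: "(real \<Rightarrow> 'b::comm_ring_1) \<Rightarrow> ('a \<Rightarrow> 'b) \<Rightarrow> 'a mpoly \<Rightarrow> 'b" where
  "insertion c z p = (\<Sum>a\<in>keys p. c (lookup p a) * mon z a)"

locale real_algebra_hom = comm_ring_hom hom for hom :: "real \<Rightarrow> 'b::comm_ring_1"
begin

lemma insertion_superset:
  "finite A \<Longrightarrow> keys p \<subseteq> A \<Longrightarrow> insertion hom z p = (\<Sum>a\<in>A. hom (lookup p a) * mon z a)"
  unfolding insertion_def
  by (intro sum.mono_neutral_left) (auto simp: not_in_keys_iff_lookup_eq_zero)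

lemma insertion_add: "insertion hom z (p + q) = insertion hom z p + insertion hom z q"
proof -
  let ?A = "keys p \<union> keys q"
  have "keys (p + q) \<subseteq> ?A" by (rule keys_add)
  then show ?thesis
    by (simp add: insertion_superset[of ?A] lookup_add hom_distribs distrib_right sum.distrib)
qed

lemma insertion_single: "insertion hom z (Poly_Mapping.single a r) = hom r * mon z a"
  by (cases "r = 0") (simp_all add: insertion_def)

lemma insertion_mult: "insertion hom z (p * q) = insertion hom z p * insertion hom z q"
proof (induction p rule: mpoly_induct)
  case (single a r)
  show ?case
    by (induction q rule: mpoly_induct)
      (simp_all add: mult_single insertion_single mon_add hom_distribs insertion_add
        distrib_left mult.assoc mult.left_commute)
next
  case (add p p')
  then show ?case by (simp add: distrib_right insertion_add)
qed

lemma insertion_0 [simp]: "insertion hom z 0 = 0"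
  by (simp add: insertion_def)

lemma insertion_1 [simp]: "insertion hom z 1 = 1"
  using insertion_single[of z 0 1] by simp

lemma insertion_mconst: "insertion hom z (mconst r) = hom r"
  by (simp add: mconst_def insertion_single)

lemma insertion_mvar: "insertion hom z (mvar i) = z i"
  by (simp add: mvar_def insertion_single mon_single)

lemma insertion_uminus: "insertion hom z (- p) = - insertion hom z p"
  using insertion_add[of z p "- p"] by (simp add: add_eq_0_iff)

lemma insertion_sum: "insertion hom z (sum f A) = (\<Sum>x\<in>A. insertion hom z (f x))"
  by (induction A rule: infinite_finite_induct) (simp_all add: insertion_add)

end

abbreviation peval :: "('a \<Rightarrow> real) \<Rightarrow> 'a mpoly \<Rightarrow> real" where
  "peval \<equiv> insertion (\<lambda>x. x)"

abbreviation psubst :: "('a \<Rightarrow> 'b mpoly) \<Rightarrow> 'a mpoly \<Rightarrow> 'b mpoly" where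
  "psubst \<equiv> insertion mconst"

lemma real_algebra_hom_id: "real_algebra_hom (\<lambda>x::real. x)"
  by unfold_locales auto

lemmas peval_add = real_algebra_hom.insertion_add[OF real_algebra_hom_id]
  and peval_single = real_algebra_hom.insertion_single[OF real_algebra_hom_id]
  and peval_mult = real_algebra_hom.insertion_mult[OF real_algebra_hom_id]
  and peval_0 [simp] = real_algebra_hom.insertion_0[OF real_algebra_hom_id]
  and peval_1 [simp] = real_algebra_hom.insertion_1[OF real_algebra_hom_id]
  and peval_mconst = real_algebra_hom.insertion_mconst[OF real_algebra_hom_id]
  and peval_mvar = real_algebra_hom.insertion_mvar[OF real_algebra_hom_id]

interpretation psubst: real_algebra_hom "mconst :: real \<Rightarrow> 'a mpoly"
  by unfold_locales (auto simp: mconst_simps)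

lemma peval_mon:
  fixes \<phi> :: "'a \<Rightarrow> 'b mpoly"
  shows "peval z (mon \<phi> a) = mon (\<lambda>i. peval z (\<phi> i)) a"
proof -
  have "peval z (prod f A) = (\<Prod>x\<in>A. peval z (f x))" for f :: "'a \<Rightarrow> 'b mpoly" and A
    by (induction A rule: infinite_finite_induct) (simp_all add: peval_mult)
  moreover have "peval z (p ^ m) = peval z p ^ m" for p m
    by (induction m) (simp_all add: peval_mult)
  ultimately show ?thesis by (simp add: mon_def)
qed

lemma peval_psubst: "peval z (psubst \<phi> p) = peval (\<lambda>i. peval z (\<phi> i)) p"
  by (induction p rule: mpoly_induct)
    (simp_all add: psubst.insertion_single peval_single peval_mult
      peval_mconst peval_mon psubst.insertion_add peval_add)

subsection \<open>Homogeneous operators\<close>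

definition operators :: "'a set \<Rightarrow> 'a mpoly set" where
  "operators M = {D. \<forall>a\<in>keys D. keys a \<subseteq> M}"

lemma carrier_operator_ring: "carrier (operator_ring M) = operators M"
  by (simp add: operator_ring_def operators_def)

lemma operators_single: "keys a \<subseteq> M \<Longrightarrow> Poly_Mapping.single a r \<in> operators M"
  by (simp add: operators_def)

lemma operators_add: "p \<in> operators M \<Longrightarrow> q \<in> operators M \<Longrightarrow> p + q \<in> operators M"
  using keys_add[of p q] by (fastforce simp: operators_def)

lemma operators_mult: "p \<in> operators M \<Longrightarrow> q \<in> operators M \<Longrightarrow> p * q \<in> operators M"
proof -
  assume pq: "p \<in> operators M" "q \<in> operators M"
  { fix e assume "e \<in> keys (p * q)"
    then obtain a b where "a \<in> keys p" "b \<in> keys q" "e = a + b" using keys_mult[of p q] by blast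
    then have "keys e \<subseteq> M" using keys_add[of a b] pq by (fastforce simp: operators_def) }
  then show ?thesis by (simp add: operators_def)
qed

lemma operators_simps [simp]:
  "0 \<in> operators M" "1 \<in> operators M" "mconst r \<in> operators M" "i \<in> M \<Longrightarrow> mvar i \<in> operators M"
  by (auto simp: operators_def mconst_def mvar_def split: if_splits)

lemma operators_uminus: "p \<in> operators M \<Longrightarrow> - p \<in> operators M"
  by (auto simp: operators_def in_keys_iff)

definition hom_operators :: "'a set \<Rightarrow> nat \<Rightarrow> 'a mpoly set" where
  "hom_operators M d = {D \<in> operators M. \<forall>a\<in>keys D. mdeg a = d}"

lemma hom_operators_eq: "hom_operators M d = {D \<in> operators M. homogeneous d D}"
  by (simp add: hom_operators_def homogeneous_def mdeg_def)

lemma hom_operatorsD: "p \<in> hom_operators M d \<Longrightarrow> p \<in> operators M"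
  by (simp add: hom_operators_def)

lemma hom_operators_add: "p \<in> hom_operators M d \<Longrightarrow> q \<in> hom_operators M d \<Longrightarrow> p + q \<in> hom_operators M d"
  using keys_add[of p q] operators_add[of p M q] by (auto simp: hom_operators_def)

lemma hom_operators_mult:
  assumes "p \<in> hom_operators M d" "q \<in> hom_operators M e"
  shows "p * q \<in> hom_operators M (d + e)"
proof -
  { fix g assume "g \<in> keys (p * q)"
    then obtain a b where "a \<in> keys p" "b \<in> keys q" "g = a + b" using keys_mult[of p q] by blast
    then have "mdeg g = d + e" using assms by (auto simp: hom_operators_def mdeg_add) }
  then show ?thesis using operators_mult assms by (auto simp: hom_operators_def)
qed

lemma hom_operators_simps [simp]:
  "0 \<in> hom_operators M d" "1 \<in> hom_operators M 0" "mconst r \<in> hom_operators M 0"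
  "i \<in> M \<Longrightarrow> mvar i \<in> hom_operators M (Suc 0)"
  by (auto simp: hom_operators_def) (auto simp: mconst_def mvar_def split: if_splits)

lemma hom_operators_mconst_mult: "p \<in> hom_operators M d \<Longrightarrow> mconst r * p \<in> hom_operators M d"
  using hom_operators_mult[of "mconst r" M 0 p d] by simp

lemma hom_operators_uminus: "p \<in> hom_operators M d \<Longrightarrow> - p \<in> hom_operators M d"
  using operators_uminus[of p M] by (auto simp: hom_operators_def in_keys_iff)

lemma hom_operators_single:
  "keys a \<subseteq> M \<Longrightarrow> mdeg a = d \<Longrightarrow> Poly_Mapping.single a r \<in> hom_operators M d"
  by (auto simp: hom_operators_def operators_single split: if_splits)

lemma hom_operators_sum:
  "(\<And>x. x \<in> A \<Longrightarrow> f x \<in> hom_operators M d) \<Longrightarrow> sum f A \<in> hom_operators M d"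
  by (induction A rule: infinite_finite_induct) (auto intro: hom_operators_add)

lemma poly_subspace_hom_operators: "poly_subspace (hom_operators M d)"
  by (simp add: poly_subspace_def hom_operators_add hom_operators_mconst_mult)

lemma finite_monomials: "finite M \<Longrightarrow> finite {a. keys a \<subseteq> M \<and> mdeg a = d}"
proof -
  assume M: "finite M"
  have "lookup a i \<le> d" if "mdeg a = d" for a :: "'a \<Rightarrow>\<^sub>0 nat" and i
    using that by (cases "i \<in> keys a")
      (auto simp: mdeg_def member_le_sum not_in_keys_iff_lookup_eq_zero)
  then have "lookup ` {a. keys a \<subseteq> M \<and> mdeg a = d} \<subseteq>
      {f. \<forall>i. (i \<in> M \<longrightarrow> f i \<in> {..d}) \<and> (i \<notin> M \<longrightarrow> f i = 0)}"
    by (auto simp: not_in_keys_iff_lookup_eq_zero)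
  moreover have "finite {f. \<forall>i. (i \<in> M \<longrightarrow> f i \<in> {..d}) \<and> (i \<notin> M \<longrightarrow> f i = (0::nat))}"
    by (rule finite_set_of_finite_funs) (use M in auto)
  ultimately have "finite (lookup ` {a. keys a \<subseteq> M \<and> mdeg a = d})"
    by (rule finite_subset)
  then show ?thesis
    by (rule finite_imageD) (rule inj_onI, rule poly_mapping_eqI, simp)
qed

lemma poly_fin_dim_hom_operators:
  assumes "finite M"
  shows "poly_fin_dim (hom_operators M d)"
proof -
  let ?U = "hom_operators M d" and ?A = "{a. keys a \<subseteq> M \<and> mdeg a = d}"
  let ?G = "(\<lambda>a. Poly_Mapping.single a (1::real)) ` ?A"
  interpret V: vectorspace class_ring "poly_space ?U"
    by (rule vectorspace_poly_space[OF poly_subspace_hom_operators])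
  have G: "?G \<subseteq> ?U" by (auto intro: hom_operators_single)
  have sub: "submodule class_ring (V.span ?G) (poly_space ?U)"
    using V.span_is_submodule[of ?G] G by simp
  note cl = submodule.m_closed[OF sub, simplified] submodule.zero_closed[OF sub, simplified]
    submodule.smult_closed[OF sub, simplified]
  have "p \<in> V.span ?G" if "p \<in> ?U" for p
  proof -
    have "(\<Sum>a\<in>B. Poly_Mapping.single a (lookup p a)) \<in> V.span ?G"
      if "finite B" "B \<subseteq> keys p" for B
      using that
    proof induction
      case (insert a B)
      have "a \<in> ?A" using insert.prems \<open>p \<in> ?U\<close> by (auto simp: hom_operators_def operators_def)
      then have "Poly_Mapping.single a 1 \<in> V.span ?G" using V.in_own_span[of ?G] G by auto
      then have "mconst (lookup p a) * Poly_Mapping.single a 1 \<in> V.span ?G"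
        using cl(3) by (simp add: class_ring_simps)
      then have "Poly_Mapping.single a (lookup p a) \<in> V.span ?G"
        by (simp add: mconst_def mult_single)
      then show ?case using insert cl by simp
    qed (use cl in simp)
    from this[of "keys p"] show ?thesis using mpoly_expand[of p] by simp
  qed
  moreover have "V.span ?G \<subseteq> ?U" using V.span_is_subset2[of ?G] G by simp
  ultimately have "V.gen_set ?G" by auto
  then show ?thesis
    unfolding poly_fin_dim_def V.fin_dim_def
    using G finite_monomials[OF assms] by (intro exI[of _ ?G]) auto
qed

definition hpart :: "nat \<Rightarrow> 'a mpoly \<Rightarrow> 'a mpoly" where
  "hpart d p = (\<Sum>a\<in>keys p. Poly_Mapping.single a (if mdeg a = d then lookup p a else 0))"

lemma lookup_hpart: "lookup (hpart d p) a = (if mdeg a = d then lookup p a else 0)"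
proof -
  have "lookup (hpart d p) a = (\<Sum>b\<in>keys p. if b = a then (if mdeg a = d then lookup p a else 0) else 0)"
    unfolding hpart_def lookup_sum by (intro sum.cong) (auto simp: lookup_single when_def)
  then show ?thesis by (auto simp: not_in_keys_iff_lookup_eq_zero)
qed

lemma hpart_add: "hpart d (p + q) = hpart d p + hpart d q"
  by (intro poly_mapping_eqI) (simp add: lookup_hpart lookup_add)

lemma hpart_diff: "hpart d (p - q) = hpart d p - hpart d q"
  by (intro poly_mapping_eqI) (simp add: lookup_hpart lookup_minus)

lemma hpart_hom: "p \<in> hom_operators M e \<Longrightarrow> hpart d p = (if d = e then p else 0)"
  by (intro poly_mapping_eqI)
    (auto simp: lookup_hpart hom_operators_def in_keys_iff split: if_splits)

lemma hpart_in_hom_operators: "p \<in> operators M \<Longrightarrow> hpart d p \<in> hom_operators M d"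
  by (auto simp: hom_operators_def operators_def in_keys_iff lookup_hpart split: if_splits)

lemma hpart_single:
  "hpart d (Poly_Mapping.single a r) = (if mdeg a = d then Poly_Mapping.single a r else 0)"
  by (intro poly_mapping_eqI) (auto simp: lookup_hpart lookup_single when_def)

lemma hpart_mult_single:
  "hpart (mdeg b + d) (p * Poly_Mapping.single b r) = hpart d p * Poly_Mapping.single b r"
  by (induction p rule: mpoly_induct)
    (simp_all add: mult_single hpart_single mdeg_add distrib_right hpart_add)

subsection \<open>Action of operators on coefficients\<close>

lemma lookup_partial:
  "lookup (partial i f) b = real (lookup b i + 1) * lookup f (b + Poly_Mapping.single i 1)"
proof -
  let ?e = "Poly_Mapping.single i (1::nat)"
  have one: "lookup (Poly_Mapping.single (a - ?e) (real (lookup a i) * lookup f a)) b =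
      (if a = b + ?e then real (lookup a i) * lookup f a else 0)" for a
  \<comment> \<open>Subtraction of exponents is truncated: a monomial without the variable
    \<open>i\<close> is not lowered, but then the factor \<open>lookup a i\<close> is 0.\<close>
  proof (cases "a - ?e = b \<and> lookup a i \<noteq> 0")
    case True
    then have "lookup b j = lookup a j - lookup ?e j" "lookup a i \<noteq> 0" for j
      by (auto simp: lookup_minus)
    then have "a = b + ?e"
      by (intro poly_mapping_eqI) (auto simp: lookup_add lookup_single when_def)
    then show ?thesis by (simp add: lookup_single)
  next
    case False
    then have "a \<noteq> b + ?e" by (auto simp: lookup_add)
    with False show ?thesis by (auto simp: lookup_single when_def)
  qed
  have "lookup (partial i f) b =
      (\<Sum>a\<in>keys f. if a = b + ?e then real (lookup a i) * lookup f a else 0)"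
    unfolding partial_def lookup_sum one ..
  then show ?thesis
    by (simp add: lookup_add not_in_keys_iff_lookup_eq_zero)
qed

text \<open>On coefficients weighted by factorials a partial derivative is a mere shift of exponents.\<close>

definition shifts :: "('a \<Rightarrow>\<^sub>0 nat) \<Rightarrow> ('a mpoly \<Rightarrow> 'a mpoly) \<Rightarrow> bool" where
  "shifts e F \<longleftrightarrow> (\<forall>f b. mfact b * lookup (F f) b = mfact (b + e) * lookup f (b + e))"

lemma shifts_partial: "shifts (Poly_Mapping.single i 1) (partial i)"
  unfolding shifts_def
  using mfact_add_single[of _ i] by (simp add: lookup_partial)

lemma shifts_comp: "shifts e F \<Longrightarrow> shifts e' G \<Longrightarrow> shifts (e + e') (\<lambda>f. F (G f))"
  by (simp add: shifts_def add.assoc)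

lemma shifts_funpow: "shifts (Poly_Mapping.single i m) (partial i ^^ m)"
proof (induction m)
  case 0
  then show ?case by (simp add: shifts_def)
next
  case (Suc m)
  have "Poly_Mapping.single i (Suc m) = Poly_Mapping.single i 1 + Poly_Mapping.single i m"
    by (simp flip: single_add)
  then show ?case using shifts_comp[OF shifts_partial Suc.IH] by simp
qed

lemma shifts_foldr:
  "shifts (\<Sum>i\<leftarrow>xs. Poly_Mapping.single i (m i)) (foldr (\<lambda>i. partial i ^^ m i) xs)"
proof (induction xs)
  case Nil
  then show ?case by (simp add: shifts_def)
next
  case (Cons i xs)
  then show ?case using shifts_comp[OF shifts_funpow[of i "m i"] Cons.IH] by simp
qed

lemma monomial_expand: "(\<Sum>i\<in>keys a. Poly_Mapping.single i (lookup a i)) = a"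
  by (intro poly_mapping_eqI)
    (auto simp: lookup_sum lookup_single when_def not_in_keys_iff_lookup_eq_zero)

lemma lookup_partial_monomial:
  "mfact b * lookup (partial_monomial a f) b = mfact (a + b) * lookup f (a + b)"
proof -
  have "(\<Sum>i\<leftarrow>sorted_list_of_set (keys a). Poly_Mapping.single i (lookup a i)) = a"
    by (simp add: sum_list_distinct_conv_sum_set monomial_expand)
  then have "shifts a (partial_monomial a)"
    unfolding partial_monomial_def
    using shifts_foldr[of "lookup a" "sorted_list_of_set (keys a)"] by simp
  then show ?thesis by (simp add: shifts_def add.commute)
qed

text \<open>The constant term of \<open>p\<close> applied to \<open>f\<close>, known as the
  apolarity pairing of operators with polynomials.\<close>

definition pairing :: "'a mpoly \<Rightarrow> 'a mpoly \<Rightarrow> real" where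
  "pairing f p = (\<Sum>a\<in>keys p. lookup p a * (mfact a * lookup f a))"

lemma pairing_superset:
  "finite A \<Longrightarrow> keys p \<subseteq> A \<Longrightarrow> pairing f p = (\<Sum>a\<in>A. lookup p a * (mfact a * lookup f a))"
  unfolding pairing_def
  by (intro sum.mono_neutral_left) (auto simp: not_in_keys_iff_lookup_eq_zero)

lemma pairing_add: "pairing f (p + q) = pairing f p + pairing f q"
proof -
  let ?A = "keys p \<union> keys q"
  have "keys (p + q) \<subseteq> ?A" by (rule keys_add)
  then show ?thesis
    by (simp add: pairing_superset[of ?A] lookup_add distrib_right sum.distrib)
qed

lemma pairing_single: "pairing f (Poly_Mapping.single a r) = r * (mfact a * lookup f a)"
  by (cases "r = 0") (simp_all add: pairing_def)

lemma lookup_mconst_mult: "lookup (mconst c * p) b = c * lookup p b"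
proof (induction p rule: mpoly_induct)
  case (single a r)
  then show ?case by (simp add: mconst_def mult_single lookup_single when_def)
next
  case (add p q)
  then show ?case by (simp add: distrib_left lookup_add)
qed

lemma lookup_apply_operator:
  "mfact b * lookup (apply_operator D f) b = pairing f (D * Poly_Mapping.single b 1)"
proof -
  have "mfact b * lookup (apply_operator D f) b =
      (\<Sum>a\<in>keys D. lookup D a * (mfact (a + b) * lookup f (a + b)))"
    unfolding apply_operator_def lookup_sum sum_distrib_left lookup_mconst_mult
    by (intro sum.cong refl) (simp add: lookup_partial_monomial[symmetric] mult_ac)
  also have "\<dots> = (\<Sum>a\<in>keys D. pairing f (Poly_Mapping.single (a + b) (lookup D a)))"
    by (simp add: pairing_single)
  also have "\<dots> = pairing f (\<Sum>a\<in>keys D. Poly_Mapping.single (a + b) (lookup D a))"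
  proof -
    have "(\<Sum>a\<in>A. pairing f (g a)) = pairing f (sum g A)" if "finite A"
      for A and g :: "('a \<Rightarrow>\<^sub>0 nat) \<Rightarrow> 'a mpoly"
      using that by induction (simp_all add: pairing_add pairing_def[of f 0])
    then show ?thesis by simp
  qed
  also have "(\<Sum>a\<in>keys D. Poly_Mapping.single (a + b) (lookup D a)) = D * Poly_Mapping.single b 1"
    by (subst (3) mpoly_expand) (simp add: sum_distrib_right mult_single)
  finally show ?thesis .
qed

text \<open>Up to a factorial, the coefficient at \<open>b\<close> of \<open>D\<close> applied to
  \<open>f\<close> is the pairing of \<open>f\<close> with \<open>D\<close> times the monomial
  \<open>b\<close>. All coefficients vanish exactly when every multiple of \<open>D\<close> pairs to
  zero, so from here on annihilators can be handled through values of a functional on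
  products.\<close>

lemma apply_operator_eq_0_iff:
  "apply_operator D f = 0 \<longleftrightarrow> (\<forall>E. pairing f (D * E) = 0)"
proof
  assume *: "apply_operator D f = 0"
  have s: "pairing f (D * Poly_Mapping.single b r) = 0" for b r
  proof -
    have "pairing f (mconst r * p) = r * pairing f p" for p
      by (induction p rule: mpoly_induct)
        (simp_all add: mconst_def mult_single pairing_single distrib_left pairing_add)
    from this[of "D * Poly_Mapping.single b 1"]
    have "pairing f (D * (mconst r * Poly_Mapping.single b 1)) = 0"
      using lookup_apply_operator[of b D f] * by (simp add: mult.left_commute)
    then show ?thesis by (simp add: mconst_def mult_single)
  qed
  show "\<forall>E. pairing f (D * E) = 0"
  proof
    fix E show "pairing f (D * E) = 0"
      by (induction E rule: mpoly_induct) (simp_all add: s distrib_left pairing_add)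
  qed
next
  assume *: "\<forall>E. pairing f (D * E) = 0"
  show "apply_operator D f = 0"
    by (intro poly_mapping_eqI)
      (use * lookup_apply_operator[of _ D f] in \<open>simp del: mult_eq_0_iff add: mult_eq_0_iff\<close>)
qed

lemma lookup_mvar_mult:
  "lookup (mvar i * p) a =
    (if lookup a i = 0 then 0 else lookup p (a - Poly_Mapping.single i 1))"
proof (induction p rule: mpoly_induct)
  case (single b r)
  have "Poly_Mapping.single i 1 + b = a \<longleftrightarrow> lookup a i \<noteq> 0 \<and> b = a - Poly_Mapping.single i 1"
  proof
    assume "lookup a i \<noteq> 0 \<and> b = a - Poly_Mapping.single i 1"
    then show "Poly_Mapping.single i 1 + b = a"
      by (intro poly_mapping_eqI) (auto simp: lookup_add lookup_single when_def lookup_minus)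
  qed (auto simp: lookup_add)
  then show ?case by (auto simp: mvar_def mult_single lookup_single when_def)
next
  case (add p q)
  then show ?case by (simp add: distrib_left lookup_add)
qed

text \<open>The multinomial theorem in the weights \<open>mfact\<close>: an operator of degree m
  applied to the m-th power of a linear form is m! times the value of the operator at the
  coefficient vector \<open>z\<close>. This is how volume polynomials turn into sums of
  evaluations.\<close>

lemma lookup_linear_form_power:
  assumes I: "finite I" and z: "\<And>i. i \<notin> I \<Longrightarrow> z i = 0"
  shows "mfact a * lookup ((\<Sum>i\<in>I. mconst (z i) * mvar i) ^ m) a =
    (if mdeg a = m then fact m * mon z a else 0)"
proof (induction m arbitrary: a)
  case 0
  have "a = 0" if "mdeg a = 0" for a :: "'a \<Rightarrow>\<^sub>0 nat"
    using that by (intro poly_mapping_eqI) (auto simp: mdeg_def not_in_keys_iff_lookup_eq_zero)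
  moreover have "mfact 0 = 1" by (simp add: mfact_def)
  ultimately show ?case by (auto simp: lookup_one when_def)
next
  case (Suc m)
  let ?L = "\<Sum>i\<in>I. mconst (z i) * mvar i"
  have step: "mfact a * lookup (mconst (z i) * (mvar i * ?L ^ m)) a =
      (if mdeg a = Suc m then real (lookup a i) * (fact m * mon z a) else 0)" for i
  proof (cases "lookup a i = 0")
    case True
    then show ?thesis by (simp add: lookup_mconst_mult lookup_mvar_mult)
  next
    case False
    define b where "b = a - Poly_Mapping.single i 1"
    have a: "a = b + Poly_Mapping.single i 1"
      using False unfolding b_def
      by (intro poly_mapping_eqI) (auto simp: lookup_add lookup_single when_def lookup_minus)
    have mf: "mfact a = real (lookup a i) * mfact b"
      using mfact_add_single[of b i] by (simp add: a lookup_add)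
    have "mfact a * lookup (mconst (z i) * (mvar i * ?L ^ m)) a =
        real (lookup a i) * z i * (mfact b * lookup (?L ^ m) b)"
      using False mf by (simp add: lookup_mconst_mult lookup_mvar_mult b_def)
    then show ?thesis
      unfolding Suc.IH using a by (auto simp: mdeg_add mon_add mon_single)
  qed
  have "mfact a * lookup (?L ^ Suc m) a =
      (\<Sum>i\<in>I. mfact a * lookup (mconst (z i) * (mvar i * ?L ^ m)) a)"
    by (simp add: sum_distrib_right lookup_sum sum_distrib_left mult.assoc)
  also have "\<dots> = (if mdeg a = Suc m then (\<Sum>i\<in>I. real (lookup a i)) * (fact m * mon z a) else 0)"
    unfolding step by (simp add: sum_distrib_right)
  \<comment> \<open>Each variable that is split off contributes its exponent in \<open>a\<close>;
    the exponents add up to the degree, which completes the factorial. If \<open>a\<close> has a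
    variable outside \<open>I\<close>, then \<open>mon z a\<close> is 0 because \<open>z\<close>
    vanishes there.\<close>
  also have "\<dots> = (if mdeg a = Suc m then fact (Suc m) * mon z a else 0)"
  proof (cases "keys a \<subseteq> I")
    case True
    then have "(\<Sum>i\<in>I. real (lookup a i)) = real (mdeg a)"
      using mdeg_superset[OF I True] by simp
    then show ?thesis by simp
  next
    case False
    then obtain i where "i \<in> keys a" "z i = 0" using z by blast
    then have "mon z a = 0"
      unfolding mon_def by (intro prod_zero) (auto simp: in_keys_iff intro!: bexI[of _ i])
    then show ?thesis by simp
  qed
  finally show ?case .
qed

text \<open>The basis condition of a multi-fan, as nonvanishing of the determinant that the volume
  polynomial divides by. It concerns a single cone, so that cones of different fans can be collected
  in one family.\<close>

definition nondegenerate :: "nat \<Rightarrow> ('a::linorder \<Rightarrow> real vec) \<Rightarrow> 'a set \<Rightarrow> bool" where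
  "nondegenerate n l I \<longleftrightarrow>
     finite I \<and> card I = n \<and> l ` I \<subseteq> carrier_vec n \<and> det (cone_matrix n l I) \<noteq> 0"

lemma cone_matrix_carrier: "finite I \<Longrightarrow> card I = n \<Longrightarrow> cone_matrix n l I \<in> carrier_mat n n"
  using mat_of_cols_carrier(1)[of n "map l (sorted_list_of_set I)"] by (simp add: cone_matrix_def)

lemma mat_of_cols_mult_vec:
  fixes l :: "'a \<Rightarrow> real vec"
  assumes "distinct xs" "r < n"
  shows "(mat_of_cols n (map l xs) *\<^sub>v vec (length xs) (\<lambda>j. z (xs ! j))) $ r =
    (\<Sum>i\<in>set xs. z i * l i $ r)"
proof -
  have "(mat_of_cols n (map l xs) *\<^sub>v vec (length xs) (\<lambda>j. z (xs ! j))) $ r =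
      (\<Sum>j = 0..<length xs. z (xs ! j) * l (xs ! j) $ r)"
    using assms(2) by (simp add: scalar_prod_def mat_of_cols_index mult.commute)
  also have "\<dots> = (\<Sum>i\<leftarrow>xs. z i * l i $ r)"
    by (simp add: sum_list_sum_nth)
  finally show ?thesis using assms(1) by (simp add: sum_list_distinct_conv_sum_set)
qed

subsection \<open>Bases and determinants\<close>

text \<open>Both sides say that the matrix has rank \<open>n\<close>. Distinctness stands on the
  left because \<open>set vs\<close> forgets a repeated column, which makes the determinant
  vanish.\<close>

lemma basis_iff_det:
  fixes vs :: "real vec list"
  assumes vs: "set vs \<subseteq> carrier_vec n" "length vs = n"
  shows "distinct vs \<and> vectorspace.basis class_ring (module_vec TYPE(real) n) (set vs) \<longleftrightarrow>
    det (mat_of_cols n vs) \<noteq> 0"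
proof -
  interpret vec_space "TYPE(real)" n .
  let ?A = "mat_of_cols n vs"
  have A: "?A \<in> carrier_mat n n" using vs by auto
  have cols: "cols ?A = vs" using vs by simp
  show ?thesis
  proof
    assume *: "distinct vs \<and> basis (set vs)"
    then have "lin_indpt (set (cols ?A))" by (simp add: cols basis_def)
    then have "rank ?A = n" using lin_indpt_full_rank[OF A] * cols by simp
    then show "det ?A \<noteq> 0" using det_rank_iff[OF A] by simp
  next
    assume det: "det ?A \<noteq> 0"
    then have r: "rank ?A = n" using det_rank_iff[OF A] by simp
    then have d: "distinct (cols ?A)" using non_distinct_low_rank[OF A] by auto
    then have li: "lin_indpt (set vs)" using full_rank_lin_indpt[OF A r] cols by simp
    have "basis (set vs)"
      by (rule dim_li_is_basis) (use vs li d cols in \<open>auto simp: distinct_card dim_is_n\<close>)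
    then show "distinct vs \<and> basis (set vs)" using d cols by simp
  qed
qed

lemma nondegenerate_iff_basis:
  assumes "finite I" "card I = n" "l ` I \<subseteq> carrier_vec n"
  shows "nondegenerate n l I \<longleftrightarrow>
    inj_on l I \<and> vectorspace.basis class_ring (module_vec TYPE(real) n) (l ` I)"
  using basis_iff_det[of "map l (sorted_list_of_set I)" n] assms
  by (auto simp: nondegenerate_def cone_matrix_def distinct_map)

lemma multi_fan_nondegenerate:
  assumes "multi_fan n M w l" "w I \<noteq> 0"
  shows "nondegenerate n l I"
proof -
  have "finite M" "I \<subseteq> M" "card I = n" "\<forall>i\<in>M. l i \<in> carrier_vec n"
    using assms by (auto simp: multi_fan_def simplicial_cycle_def)
  then have "finite I" "card I = n" "l ` I \<subseteq> carrier_vec n" using finite_subset by auto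
  then show ?thesis
    using nondegenerate_iff_basis[of I n l] assms by (auto simp: multi_fan_def)
qed

subsection \<open>Coordinates\<close>

text \<open>Coordinates named by vertices instead of positions, the position of \<open>i\<close>
  being the number of smaller elements of \<open>I\<close>. The value 0 outside the cone makes
  \<open>coord n l I v\<close> a point at which every operator can be evaluated.\<close>

definition coord :: "nat \<Rightarrow> ('a::linorder \<Rightarrow> real vec) \<Rightarrow> 'a set \<Rightarrow> real vec \<Rightarrow> 'a \<Rightarrow> real" where
  "coord n l I v i = (if i \<in> I then cone_coordinates n l I v $ card {j \<in> I. j < i} else 0)"

lemma card_less_sorted_nth:
  assumes "finite I" "j < card I"
  shows "card {i \<in> I. i < sorted_list_of_set I ! j} = j"
proof -
  let ?s = "sorted_list_of_set I"
  have s: "sorted_wrt (<) ?s" "length ?s = card I" "distinct ?s" "set ?s = I"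
    using assms(1) by (auto simp: strict_sorted_list_of_set)
  have "{i \<in> I. i < ?s ! j} = (!) ?s ` {..<j}"
  proof (intro equalityI subsetI)
    fix i assume i: "i \<in> {i \<in> I. i < ?s ! j}"
    then obtain p where p: "p < card I" "i = ?s ! p" using s by (metis (no_types) in_set_conv_nth mem_Collect_eq)
    have "p < j"
    proof (rule ccontr)
      assume "\<not> p < j"
      then have "?s ! j \<le> ?s ! p"
        using s(1,2) p(1) sorted_wrt_nth_less[OF s(1), of j p] by (cases "j = p") auto
      then show False using i p by auto
    qed
    then show "i \<in> (!) ?s ` {..<j}" using p by auto
  next
    fix i assume "i \<in> (!) ?s ` {..<j}"
    then obtain p where "p < j" "i = ?s ! p" by auto
    then show "i \<in> {i \<in> I. i < ?s ! j}"
      using sorted_wrt_nth_less[OF s(1), of p j] s assms nth_mem[of p ?s] by auto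
  qed
  moreover have "inj_on ((!) ?s) {..<j}"
    using s assms(2) by (auto simp: inj_on_def nth_eq_iff_index_eq)
  ultimately show ?thesis by (simp add: card_image)
qed

lemma coord_nth:
  assumes "finite I" "j < card I"
  shows "coord n l I v (sorted_list_of_set I ! j) = cone_coordinates n l I v $ j"
  using card_less_sorted_nth[OF assms] assms nth_mem[of j "sorted_list_of_set I"]
  by (simp add: coord_def)

lemma cone_coordinates:
  assumes I: "nondegenerate n l I" and v: "v \<in> carrier_vec n"
  shows "cone_coordinates n l I v \<in> carrier_vec n"
    and "cone_matrix n l I *\<^sub>v cone_coordinates n l I v = v"
    and "\<alpha> \<in> carrier_vec n \<Longrightarrow> cone_matrix n l I *\<^sub>v \<alpha> = v \<Longrightarrow> \<alpha> = cone_coordinates n l I v"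
proof -
  let ?A = "cone_matrix n l I"
  have A: "?A \<in> carrier_mat n n" "det ?A \<noteq> 0"
    using I cone_matrix_carrier[of I n l] by (auto simp: nondegenerate_def)
  from det_non_zero_imp_unit[OF A, of "()"] obtain B where
    B: "B \<in> carrier_mat n n" "B * ?A = 1\<^sub>m n" "?A * B = 1\<^sub>m n"
    by (auto simp: Units_def ring_mat_def)
  have uniq: "\<alpha> = B *\<^sub>v v" if "\<alpha> \<in> carrier_vec n" "?A *\<^sub>v \<alpha> = v" for \<alpha>
    using that assoc_mult_mat_vec[OF B(1) A(1) that(1)] B by simp
  have sol: "?A *\<^sub>v (B *\<^sub>v v) = v"
    using assoc_mult_mat_vec[OF A(1) B(1) v] B v by simp
  have car: "B *\<^sub>v v \<in> carrier_vec n" using B v by simp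
  have "cone_coordinates n l I v = B *\<^sub>v v"
    unfolding cone_coordinates_def by (rule the_equality) (simp add: car sol, rule uniq, blast+)
  then show "cone_coordinates n l I v \<in> carrier_vec n"
    "?A *\<^sub>v cone_coordinates n l I v = v"
    "\<alpha> \<in> carrier_vec n \<Longrightarrow> ?A *\<^sub>v \<alpha> = v \<Longrightarrow> \<alpha> = cone_coordinates n l I v"
    by (simp_all only: car sol uniq)
qed

lemma coord_sum:
  assumes I: "nondegenerate n l I" and v: "v \<in> carrier_vec n" and r: "r < n"
  shows "v $ r = (\<Sum>i\<in>I. coord n l I v i * l i $ r)"
proof -
  have fin: "finite I" "card I = n" using I by (auto simp: nondegenerate_def)
  have "cone_coordinates n l I v = vec n (\<lambda>j. coord n l I v (sorted_list_of_set I ! j))"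
    using cone_coordinates(1)[OF I v] fin by (intro eq_vecI) (auto simp: coord_nth)
  then show ?thesis
    using cone_coordinates(2)[OF I v] fin r
      mat_of_cols_mult_vec[of "sorted_list_of_set I" r n l "coord n l I v"]
    by (simp add: cone_matrix_def)
qed

lemma coord_unique:
  assumes I: "nondegenerate n l I" and v: "v \<in> carrier_vec n"
    and z: "\<And>i. i \<notin> I \<Longrightarrow> z i = 0" "\<And>r. r < n \<Longrightarrow> v $ r = (\<Sum>i\<in>I. z i * l i $ r)"
  shows "z = coord n l I v"
proof
  fix i
  have fin: "finite I" "card I = n" using I by (auto simp: nondegenerate_def)
  let ?s = "sorted_list_of_set I" and ?\<alpha> = "vec n (\<lambda>j. z (sorted_list_of_set I ! j))"
  have "cone_matrix n l I *\<^sub>v ?\<alpha> = v"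
  proof (rule eq_vecI)
    fix r assume "r < dim_vec v"
    then show "(cone_matrix n l I *\<^sub>v ?\<alpha>) $ r = v $ r"
      using mat_of_cols_mult_vec[of ?s r n l z] z(2)[of r] fin v by (simp add: cone_matrix_def)
  qed (use v in \<open>simp add: cone_matrix_def\<close>)
  then have a: "?\<alpha> = cone_coordinates n l I v"
    using cone_coordinates(3)[OF I v, of ?\<alpha>] by simp
  show "z i = coord n l I v i"
  proof (cases "i \<in> I")
    case True
    then obtain j where "j < n" "i = ?s ! j"
      using fin by (metis in_set_conv_nth length_sorted_list_of_set set_sorted_list_of_set)
    then show ?thesis using coord_nth[of I j n l v] fin by (simp flip: a)
  qed (simp add: z coord_def)
qed

lemma coord_outside [simp]: "i \<notin> I \<Longrightarrow> coord n l I v i = 0"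
  by (simp add: coord_def)

lemma coord_generator:
  assumes I: "nondegenerate n l I" and i: "i \<in> I"
  shows "coord n l I (l i) j = (if j = i then 1 else 0)"
proof -
  have "l i \<in> carrier_vec n" "finite I" using I i by (auto simp: nondegenerate_def)
  then have "(\<lambda>j. if j = i then 1 else 0) = coord n l I (l i)"
    using i by (intro coord_unique[OF I]) (auto simp: if_distrib[of "\<lambda>x. x * _"] sum.delta cong: if_cong)
  from fun_cong[OF this, of j] show ?thesis by simp
qed

text \<open>The coefficients are the coordinates of the unit vectors. An explicit coefficient vector
  is produced because genericity is decided by \<open>common_nonvanishing_vector\<close>, which
  works with such vectors.\<close>

lemma coord_functional:
  assumes I: "nondegenerate n l I"
  shows "\<exists>H. \<forall>v\<in>carrier_vec n. coord n l I v i = (\<Sum>r<n. H r * v $ r)"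
proof -
  let ?H = "\<lambda>r. coord n l I (unit_vec n r) i"
  have "coord n l I v i = (\<Sum>r<n. ?H r * v $ r)" if v: "v \<in> carrier_vec n" for v
  proof -
    have "(\<lambda>i. \<Sum>r<n. coord n l I (unit_vec n r) i * v $ r) = coord n l I v"
    proof (rule coord_unique[OF I v])
      fix s assume s: "s < n"
      have "(\<Sum>i\<in>I. (\<Sum>r<n. coord n l I (unit_vec n r) i * v $ r) * l i $ s) =
          (\<Sum>r<n. (\<Sum>i\<in>I. coord n l I (unit_vec n r) i * l i $ s) * v $ r)"
        unfolding sum_distrib_right
        by (subst sum.swap) (simp add: mult_ac)
      also have "\<dots> = (\<Sum>r<n. unit_vec n r $ s * v $ r)"
        using coord_sum[OF I unit_vec_carrier s] by simp
      also have "\<dots> = (\<Sum>r<n. if r = s then v $ r else 0)"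
        using s by (intro sum.cong) auto
      also have "\<dots> = v $ s" using s by simp
      finally show "v $ s = (\<Sum>i\<in>I. (\<Sum>r<n. coord n l I (unit_vec n r) i * v $ r) * l i $ s)" ..
    qed simp
    from fun_cong[OF this, of i] show ?thesis by (rule sym)
  qed
  then show ?thesis by (intro exI[of _ ?H] ballI)
qed

text \<open>Along the moment curve a nonzero functional is a nonzero polynomial.\<close>

lemma common_nonvanishing_vector:
  fixes F :: "(nat \<Rightarrow> real) set"
  assumes "finite F" "\<And>g. g \<in> F \<Longrightarrow> \<exists>v. (\<Sum>r<n. g r * v $ r) \<noteq> (0::real)"
  shows "\<exists>v\<in>carrier_vec n. \<forall>g\<in>F. (\<Sum>r<n. g r * v $ r) \<noteq> 0"
proof -
  define P where "P g = (\<Sum>r<n. monom (g r) r)" for g :: "nat \<Rightarrow> real"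
  have "P g \<noteq> 0" if g: "g \<in> F" for g
  proof
    assume "P g = 0"
    have "g r = 0" if r: "r < n" for r
    proof -
      have "coeff (P g) r = (\<Sum>s<n. if s = r then g s else 0)"
        unfolding P_def coeff_sum by (intro sum.cong) auto
      then show ?thesis using \<open>P g = 0\<close> r by simp
    qed
    then show False using assms(2)[OF g] by simp
  qed
  then have "finite (\<Union>g\<in>F. {t. poly (P g) t = 0})"
    using assms(1) poly_roots_finite by blast
  then obtain t where t: "t \<notin> (\<Union>g\<in>F. {t. poly (P g) t = 0})"
    using ex_new_if_finite[OF infinite_UNIV_char_0] by blast
  have "(\<Sum>r<n. g r * vec n (\<lambda>r. t ^ r) $ r) = poly (P g) t" for g
    by (simp add: P_def poly_sum poly_monom)
  then show ?thesis using t by (intro bexI[of _ "vec n (\<lambda>r. t ^ r)"]) auto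
qed

subsection \<open>Determinants with a distinguished first column\<close>

text \<open>The column \<open>a\<close> comes first whatever the order of the vertices, as in the
  oriented simplex (a, J). It may be any vector, so that a facet can be coned off with a vector that
  is no generator.\<close>

definition front_det :: "nat \<Rightarrow> ('a::linorder \<Rightarrow> real vec) \<Rightarrow> real vec \<Rightarrow> 'a set \<Rightarrow> real" where
  "front_det n l a J = det (mat_of_cols n (a # map l (sorted_list_of_set J)))"

lemma sorted_list_of_set_split:
  assumes "finite J" "i \<notin> J"
  shows "sorted_list_of_set (insert i J) =
      sorted_list_of_set {j \<in> J. j < i} @ i # sorted_list_of_set {j \<in> J. i < j}"
    and "sorted_list_of_set J =
      sorted_list_of_set {j \<in> J. j < i} @ sorted_list_of_set {j \<in> J. i < j}"
  by (rule sorted_distinct_set_unique; use assms in \<open>auto simp: sorted_append sorted_insort distinct_insort set_insort_key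
      not_less_iff_gr_or_eq\<close>)+

text \<open>Bringing the column of \<open>i\<close> to the front passes exactly the columns of the
  vertices below \<open>i\<close>. Incidence signs of the boundary and signs of determinants are
  thus the same, and cancel when a weight is divided by a determinant.\<close>

lemma det_cone_matrix_insert:
  assumes J: "finite J" "i \<notin> J" "Suc (card J) = n"
  shows "det (cone_matrix n l (insert i J)) = vsign i J * front_det n l (l i) J"
proof -
  let ?A = "cone_matrix n l (insert i J)" and ?xs = "sorted_list_of_set {j \<in> J. j < i}"
    and ?ys = "sorted_list_of_set {j \<in> J. i < j}" and ?k = "card {j \<in> J. j < i}"
  have A: "?A \<in> carrier_mat n n" using J by (intro cone_matrix_carrier) auto
  have lx: "length ?xs = ?k" by simp
  have card: "n = Suc (?k + length ?ys)"
    using J(3) arg_cong[OF sorted_list_of_set_split(2)[OF J(1,2)], of length] by simp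
  have "swap_col_to_front ?A ?k = mat_of_cols n (l i # map l (sorted_list_of_set J))"
  proof (subst swap_col_to_front_result[OF A])
    show k: "?k < n" using card by simp
    show "mat n n (\<lambda>(r, j). if j = 0 then ?A $$ (r, ?k) else if j \<le> ?k then ?A $$ (r, j - 1)
        else ?A $$ (r, j)) = mat_of_cols n (l i # map l (sorted_list_of_set J))"
    proof (rule eq_matI)
      fix r j
      assume "r < dim_row (mat_of_cols n (l i # map l (sorted_list_of_set J)))"
        "j < dim_col (mat_of_cols n (l i # map l (sorted_list_of_set J)))"
      then have rj: "r < n" "j < n" using J by auto
      have e: "?A $$ (r, p) = (map l (?xs @ i # ?ys) ! p) $ r" if "p < n" for p
        unfolding cone_matrix_def sorted_list_of_set_split(1)[OF J(1,2)]
        using that rj card by (subst mat_of_cols_index) auto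
      have "mat_of_cols n (l i # map l (sorted_list_of_set J)) $$ (r, j) =
          ((l i # map l (?xs @ ?ys)) ! j) $ r"
        unfolding sorted_list_of_set_split(2)[OF J(1,2)]
        using rj card by (subst mat_of_cols_index) auto
      also have "\<dots> = (if j = 0 then ?A $$ (r, ?k) else if j \<le> ?k then ?A $$ (r, j - 1)
        else ?A $$ (r, j))"
        using rj k lx by (auto simp: e nth_append nth_Cons' less_Suc_eq_le)
      finally show "mat n n (\<lambda>(r, j). if j = 0 then ?A $$ (r, ?k) else if j \<le> ?k then ?A $$ (r, j - 1)
        else ?A $$ (r, j)) $$ (r, j) = mat_of_cols n (l i # map l (sorted_list_of_set J)) $$ (r, j)"
        using rj by simp
    qed (use J in auto)
  qed
  then have "front_det n l (l i) J = (- 1) ^ ?k * det ?A"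
    using swap_col_to_front_det[OF A, of ?k] card by (simp add: front_det_def)
  then show ?thesis
    by (simp add: vsign_def flip: mult.assoc power_mult_distrib)
qed

text \<open>Cramer's rule for the first column.\<close>

lemma front_det_coord:
  assumes I: "nondegenerate n l (insert i J)" "i \<notin> J" and u: "u \<in> carrier_vec n"
  shows "front_det n l u J = coord n l (insert i J) u i * front_det n l (l i) J"
proof -
  have J: "finite J" "Suc (card J) = n" using I by (auto simp: nondegenerate_def)
  let ?xs = "i # sorted_list_of_set J" and ?z = "coord n l (insert i J) u"
  let ?A = "mat_of_cols n (map l ?xs)" and ?x = "vec n (\<lambda>j. coord n l (insert i J) u ((i # sorted_list_of_set J) ! j))"
  have A: "?A \<in> carrier_mat n n" using J mat_of_cols_carrier(1)[of n "map l ?xs"] by simp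
  have Ax: "?A *\<^sub>v ?x = u"
  proof (rule eq_vecI)
    fix r assume "r < dim_vec u"
    then have r: "r < n" using u by simp
    show "(?A *\<^sub>v ?x) $ r = u $ r"
      using mat_of_cols_mult_vec[of ?xs r n l ?z] coord_sum[OF I(1) u r] J I(2) r by simp
  qed (use u in simp)
  have n: "0 < n" using J by simp
  have "det (replace_col ?A (?A *\<^sub>v ?x) 0) = ?x $ 0 * det ?A"
    by (rule cramer_lemma_mat[OF A _ n]) simp
  moreover have "replace_col ?A u 0 = mat_of_cols n (u # map l (sorted_list_of_set J))"
    unfolding replace_col_def
    by (rule eq_matI) (use J in \<open>auto simp: mat_of_cols_index nth_Cons'\<close>)
  ultimately show ?thesis using n unfolding Ax by (simp add: front_det_def)
qed

subsection \<open>Divided differences\<close>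

text \<open>A polynomial of degree at most \<open>n\<close> equals its Lagrange interpolant at n + 1
  nodes, and the sum is the coefficient of degree \<open>n\<close> of that interpolant.\<close>

lemma divided_difference:
  fixes p :: "real poly"
  assumes "finite A" "card A = Suc n" "degree p \<le> n"
  shows "(\<Sum>s\<in>A. poly p s / (\<Prod>t\<in>A - {s}. s - t)) = coeff p n"
proof -
  define e where "e s = (\<Prod>t\<in>A - {s}. [:- t, 1:])" for s :: real
  define L where "L = (\<Sum>s\<in>A. Polynomial.smult (poly p s / (\<Prod>t\<in>A - {s}. s - t)) (e s))"
  have e: "degree (e s) = n" "coeff (e s) n = 1" if "s \<in> A" for s
  proof -
    have "degree (e s) = (\<Sum>t\<in>A - {s}. degree [:- t, 1:])"
      unfolding e_def by (rule degree_prod_sum_eq) auto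
    then show d: "degree (e s) = n" using that assms by simp
    have "lead_coeff (e s) = 1" unfolding e_def by (simp add: lead_coeff_prod)
    then show "coeff (e s) n = 1" using d by simp
  qed
  have "degree L \<le> n"
    unfolding L_def by (intro degree_sum_le) (auto simp: assms e degree_smult_le[THEN order_trans])
  moreover have "poly p s = poly L s" if s: "s \<in> A" for s
  proof -
    have "poly (e s') s = (if s' = s then (\<Prod>t\<in>A - {s}. s - t) else 0)" if "s' \<in> A" for s'
    proof (cases "s' = s")
      case False
      then have "poly (e s') s = 0"
        unfolding e_def poly_prod using s assms(1) by (intro prod_zero) (auto intro!: bexI[of _ s])
      with False show ?thesis by simp
    qed (simp add: e_def poly_prod)
    then have "poly L s = (\<Sum>s'\<in>A. if s' = s then poly p s else 0)"
      unfolding L_def poly_sum using assms(1) by (intro sum.cong) auto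
    then show ?thesis using s assms(1) by simp
  qed
  ultimately have "p = L"
    using assms by (intro poly_eqI_degree[of A]) auto
  then have "coeff p n = coeff L n" by simp
  also have "\<dots> = (\<Sum>s\<in>A. poly p s / (\<Prod>t\<in>A - {s}. s - t))"
    by (simp add: L_def coeff_sum e)
  finally show ?thesis ..
qed

text \<open>A divided difference of the polynomial in t that is the product of the factors z i - t u
  i, each raised to the exponent of \<open>i\<close> in \<open>a\<close>. By \<open>nz\<close> and
  \<open>dist\<close> the n + 1 nodes 0 and z i / u i are distinct. The node 0 gives the left-hand
  side, the leading coefficient the term in \<open>u\<close>, and the node z i / u i the term of the
  facet opposite to \<open>i\<close>.\<close>

lemma mon_over_prod_split:
  fixes z u :: "'a \<Rightarrow> real"
  assumes I: "finite I" "card I = n" and a: "mdeg a = n"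
    and out: "\<And>i. i \<notin> I \<Longrightarrow> z i = 0 \<and> u i = 0"
    and nz: "\<And>i. i \<in> I \<Longrightarrow> z i \<noteq> 0 \<and> u i \<noteq> 0"
    and dist: "\<And>i j. i \<in> I \<Longrightarrow> j \<in> I \<Longrightarrow> i \<noteq> j \<Longrightarrow> z i * u j \<noteq> z j * u i"
  shows "mon z a / (\<Prod>i\<in>I. z i) = mon u a / (\<Prod>i\<in>I. u i) +
    (\<Sum>i\<in>I. mon (\<lambda>j. z j - z i / u i * u j) a / (z i * (\<Prod>j\<in>I - {i}. z j - z i / u i * u j)))"
proof (cases "keys a \<subseteq> I")
  case False
  then obtain k where k: "k \<in> keys a" "k \<notin> I" by auto
  have "mon f a = 0" if "f k = 0" for f :: "'a \<Rightarrow> real"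
    unfolding mon_def using k that by (intro prod_zero) (auto simp: in_keys_iff intro!: bexI[of _ k])
  then show ?thesis using out[OF k(2)] by simp
next
  case True
  define s where "s i = z i / u i" for i
  define p where "p = (\<Prod>i\<in>I. [:z i, - u i:] ^ lookup a i)"
  have zs: "z i = u i * s i" if "i \<in> I" for i using nz[OF that] by (simp add: s_def)
  have sinj: "inj_on s I"
    using dist nz by (auto simp: inj_on_def s_def field_simps)
  have s0: "s i \<noteq> 0" if "i \<in> I" for i using nz[OF that] by (simp add: s_def)
  let ?A = "insert 0 (s ` I)"
  have "card ?A = Suc n" using I sinj s0 by (subst card_insert_disjoint) (auto simp: card_image)
  have deg: "degree p = n"
  proof -
    have "degree p = (\<Sum>i\<in>I. degree ([:z i, - u i:] ^ lookup a i))"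
      unfolding p_def by (rule degree_prod_sum_eq) (use nz in auto)
    also have "\<dots> = (\<Sum>i\<in>I. lookup a i)"
      using nz by (intro sum.cong) (auto simp: degree_power_eq)
    finally show ?thesis using mdeg_superset[OF I(1) True] a by simp
  qed
  have "lead_coeff p = (\<Prod>i\<in>I. (- u i) ^ lookup a i)"
    unfolding p_def lead_coeff_prod lead_coeff_power using nz by (intro prod.cong) auto
  also have "\<dots> = (\<Prod>i\<in>I. (- 1) ^ lookup a i * u i ^ lookup a i)"
    by (intro prod.cong refl) (rule power_minus)
  also have "\<dots> = (- 1) ^ n * mon u a"
    using mdeg_superset[OF I(1) True] a mon_superset[OF I(1) True, of u]
    by (simp add: prod.distrib power_sum)
  finally have lc: "coeff p n = (- 1) ^ n * mon u a" using deg by simp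
  have p: "poly p x = mon (\<lambda>j. z j - x * u j) a" for x
    unfolding p_def poly_prod by (simp add: mon_superset[OF I(1) True])
  have dd: "(\<Sum>s\<in>?A. poly p s / (\<Prod>t\<in>?A - {s}. s - t)) = (- 1) ^ n * mon u a"
    using divided_difference[of ?A n p] I \<open>card ?A = Suc n\<close> deg lc by simp
  have "(\<Sum>s\<in>?A. poly p s / (\<Prod>t\<in>?A - {s}. s - t)) =
      poly p 0 / (\<Prod>t\<in>?A - {0}. 0 - t) + (\<Sum>i\<in>I. poly p (s i) / (\<Prod>t\<in>?A - {s i}. s i - t))"
    using I s0 sinj by (subst sum.insert) (auto simp: sum.reindex)
  also have "(\<Prod>t\<in>?A - {0}. 0 - t) = (- 1) ^ n * (\<Prod>i\<in>I. s i)"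
  proof -
    have "?A - {0} = s ` I" using s0 by auto
    then show ?thesis using sinj I by (simp add: prod.reindex prod_uminus card_image)
  qed
  also have "(\<Sum>i\<in>I. poly p (s i) / (\<Prod>t\<in>?A - {s i}. s i - t)) =
      (\<Sum>i\<in>I. - ((- 1) ^ n * (poly p (s i) / (s i * (\<Prod>j\<in>I - {i}. s j - s i)))))"
  proof (intro sum.cong refl)
    fix i assume i: "i \<in> I"
    have "?A - {s i} = insert 0 (s ` (I - {i}))"
      using sinj s0 i by (auto simp: inj_on_def)
    moreover have "0 \<notin> s ` (I - {i})" using s0 by auto
    moreover have "inj_on s (I - {i})" using sinj by (rule inj_on_subset) auto
    ultimately have "(\<Prod>t\<in>?A - {s i}. s i - t) = s i * (\<Prod>j\<in>I - {i}. s i - s j)"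
      using I by (simp add: prod.reindex)
    also have "(\<Prod>j\<in>I - {i}. s i - s j) = (\<Prod>j\<in>I - {i}. - (s j - s i))" by simp
    also have "\<dots> = (- 1) ^ (n - 1) * (\<Prod>j\<in>I - {i}. s j - s i)"
      using I i by (simp only: prod_uminus card_Diff_singleton)
    finally have e: "(\<Prod>t\<in>?A - {s i}. s i - t) =
        (- 1) ^ (n - 1) * (s i * (\<Prod>j\<in>I - {i}. s j - s i))" by simp
    have "n > 0" using I i card_gt_0_iff by blast
    then have "(- 1) ^ n = - ((- 1) ^ (n - 1) :: real)" by (cases n) auto
    moreover have "(1::real) / (- 1) ^ (n - 1) = (- 1) ^ (n - 1)"
      by (cases "even (n - 1)") auto
    ultimately show "poly p (s i) / (\<Prod>t\<in>?A - {s i}. s i - t) =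
        - ((- 1) ^ n * (poly p (s i) / (s i * (\<Prod>j\<in>I - {i}. s j - s i))))"
      unfolding e by (cases "even (n - 1)") auto
  qed
  also have "poly p 0 / ((- 1) ^ n * (\<Prod>i\<in>I. s i)) +
      (\<Sum>i\<in>I. - ((- 1) ^ n * (poly p (s i) / (s i * (\<Prod>j\<in>I - {i}. s j - s i))))) =
      (- 1) ^ n * (poly p 0 / (\<Prod>i\<in>I. s i) -
        (\<Sum>i\<in>I. poly p (s i) / (s i * (\<Prod>j\<in>I - {i}. s j - s i))))"
    by (cases "even n") (auto simp: sum_negf)
  finally have key: "poly p 0 / (\<Prod>i\<in>I. s i) -
        (\<Sum>i\<in>I. poly p (s i) / (s i * (\<Prod>j\<in>I - {i}. s j - s i))) = mon u a"
    unfolding dd by simp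
  have 1: "mon z a / (\<Prod>i\<in>I. z i) = poly p 0 / (\<Prod>i\<in>I. s i) / (\<Prod>i\<in>I. u i)"
  proof -
    have "(\<Prod>i\<in>I. z i) = (\<Prod>i\<in>I. u i) * (\<Prod>i\<in>I. s i)"
      unfolding prod.distrib[symmetric] by (rule prod.cong[OF refl zs])
    then show ?thesis by (simp add: p mult.commute)
  qed
  have 2: "mon (\<lambda>j. z j - z i / u i * u j) a / (z i * (\<Prod>j\<in>I - {i}. z j - z i / u i * u j)) =
      poly p (s i) / (s i * (\<Prod>j\<in>I - {i}. s j - s i)) / (\<Prod>i\<in>I. u i)" if i: "i \<in> I" for i
  proof -
    have "(\<Prod>j\<in>I - {i}. z j - s i * u j) = (\<Prod>j\<in>I - {i}. u j * (s j - s i))"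
      by (intro prod.cong) (auto simp: zs algebra_simps)
    moreover have "(\<Prod>i\<in>I. u i) = u i * (\<Prod>j\<in>I - {i}. u j)"
      using I i by (simp add: prod.remove)
    ultimately have "z i * (\<Prod>j\<in>I - {i}. z j - s i * u j) =
        s i * (\<Prod>j\<in>I - {i}. s j - s i) * (\<Prod>i\<in>I. u i)"
      using zs[OF i] by (simp add: prod.distrib)
    then show ?thesis by (simp add: p flip: s_def)
  qed
  have "(\<Sum>i\<in>I. mon (\<lambda>j. z j - z i / u i * u j) a / (z i * (\<Prod>j\<in>I - {i}. z j - z i / u i * u j))) =
      (\<Sum>i\<in>I. poly p (s i) / (s i * (\<Prod>j\<in>I - {i}. s j - s i))) / (\<Prod>i\<in>I. u i)"
    unfolding sum_divide_distrib by (intro sum.cong 2 refl)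
  moreover have "poly p 0 / (\<Prod>i\<in>I. s i) = mon u a +
      (\<Sum>i\<in>I. poly p (s i) / (s i * (\<Prod>j\<in>I - {i}. s j - s i)))"
    using key by linarith
  ultimately show ?thesis unfolding 1 by (simp only: add_divide_distrib)
qed

subsection \<open>Independence of the generic vector\<close>

lemma vsign_cases: "vsign i J = 1 \<or> vsign i J = - 1"
  unfolding vsign_def by (cases "even (card {j \<in> J. j < i})") auto

text \<open>The coefficient of the \<open>n\<close>-th power of the linear form of the cone
  \<open>I\<close> in n! times the volume polynomial.\<close>

definition cone_weight ::
    "nat \<Rightarrow> ('a::linorder set \<Rightarrow> real) \<Rightarrow> ('a \<Rightarrow> real vec) \<Rightarrow> real vec \<Rightarrow> 'a set \<Rightarrow> real" where
  "cone_weight n w l v I = w I / (det (cone_matrix n l I) * (\<Prod>i\<in>I. coord n l I v i))"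

text \<open>On operators of degree \<open>n\<close> this is the number \<open>p V\<^sub>\<Delta>\<close>, which is why it does not depend on \<open>v\<close>.\<close>

definition moment ::
    "nat \<Rightarrow> 'a::linorder set \<Rightarrow> ('a set \<Rightarrow> real) \<Rightarrow> ('a \<Rightarrow> real vec) \<Rightarrow> real vec \<Rightarrow> 'a mpoly \<Rightarrow> real" where
  "moment n M w l v p = (\<Sum>I\<in>Pow M. cone_weight n w l v I * peval (coord n l I v) p)"

lemma moment_add: "moment n M w l v (p + q) = moment n M w l v p + moment n M w l v q"
  by (simp add: moment_def peval_add distrib_left sum.distrib)

lemma moment_mconst_mult: "moment n M w l v (mconst c * p) = c * moment n M w l v p"
  by (simp add: moment_def peval_mult peval_mconst sum_distrib_left mult_ac)

lemma moment_0 [simp]: "moment n M w l v 0 = 0"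
  by (simp add: moment_def)

lemma moment_single:
  "moment n M w l v (Poly_Mapping.single a r) =
     r * (\<Sum>I\<in>Pow M. cone_weight n w l v I * mon (coord n l I v) a)"
  by (simp add: moment_def peval_single sum_distrib_left mult_ac)

text \<open>Regrouping the pairs of a simplex and one of its vertices by the opposite facet collects
  the boundary coefficient of each facet. This works because \<open>\<Psi>\<close> sees only the
  facet and not the simplex it came from.\<close>

lemma sum_cycle_boundary:
  assumes "simplicial_cycle n M w"
  shows "(\<Sum>I\<in>Pow M. \<Sum>i\<in>I. vsign i (I - {i}) * w I * \<Psi> (I - {i})) = (0::real)"
proof -
  have M: "finite M" and bd: "\<And>J. J \<subseteq> M \<Longrightarrow> chain_boundary M w J = 0"
    using assms by (auto simp: simplicial_cycle_def)
  have "(\<Sum>I\<in>Pow M. \<Sum>i\<in>I. vsign i (I - {i}) * w I * \<Psi> (I - {i})) =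
      (\<Sum>(I, i)\<in>(SIGMA I:Pow M. I). vsign i (I - {i}) * w I * \<Psi> (I - {i}))"
    using M finite_subset[of _ M] by (subst sum.Sigma) auto
  also have "\<dots> = (\<Sum>(J, i)\<in>(SIGMA J:Pow M. M - J). vsign i J * w (insert i J) * \<Psi> J)"
    by (rule sum.reindex_bij_witness[of _ "\<lambda>(J, i). (insert i J, i)" "\<lambda>(I, i). (I - {i}, i)"])
      (auto simp: insert_absorb)
  also have "\<dots> = (\<Sum>J\<in>Pow M. \<Sum>i\<in>M - J. vsign i J * w (insert i J) * \<Psi> J)"
    using M by (subst sum.Sigma) auto
  also have "\<dots> = (\<Sum>J\<in>Pow M. chain_boundary M w J * \<Psi> J)"
    by (simp add: chain_boundary_def sum_distrib_right)
  also have "\<dots> = 0" using bd by simp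
  finally show ?thesis .
qed

text \<open>Coordinates of \<open>v\<close> in the cone over \<open>J\<close> with apex \<open>u\<close>, the apex coordinate left out.  The
  choice is determined as soon as \<open>J\<close> is a facet of a nondegenerate cone and \<open>u\<close> is generic.\<close>

definition apex_coord ::
    "nat \<Rightarrow> ('a \<Rightarrow> real vec) \<Rightarrow> real vec \<Rightarrow> real vec \<Rightarrow> 'a set \<Rightarrow> 'a \<Rightarrow> real" where
  "apex_coord n l u v J = (SOME \<beta>. (\<forall>j. j \<notin> J \<longrightarrow> \<beta> j = 0) \<and>
     (\<exists>s. \<forall>r<n. v $ r = s * u $ r + (\<Sum>j\<in>J. \<beta> j * l j $ r)))"

text \<open>Subtracting the multiple of \<open>u\<close> that cancels the coordinate at
  \<open>i\<close> leaves a vector in the span of the facet, and there is only one such multiple.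
  The formula mentions the simplex \<open>I\<close> but \<open>apex_coord\<close> only its facet, so
  all simplices of the cycle over a common facet yield the same values.\<close>

lemma apex_coord_eq:
  fixes l :: "'a::linorder \<Rightarrow> real vec"
  assumes I: "nondegenerate n l I" and i: "i \<in> I"
    and v: "v \<in> carrier_vec n" and u: "u \<in> carrier_vec n" "coord n l I u i \<noteq> 0"
  shows "apex_coord n l u v (I - {i}) =
    (\<lambda>j. coord n l I v j - coord n l I v i / coord n l I u i * coord n l I u j)"
proof -
  let ?z = "coord n l I v" and ?t = "coord n l I u" and ?J = "I - {i}"
  let ?s = "?z i / ?t i"
  have fin: "finite I" using I by (simp add: nondegenerate_def)
  have split: "(\<Sum>j\<in>I. f j) = f i + (\<Sum>j\<in>?J. f j)" for f :: "'a \<Rightarrow> real"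
    using sum.remove[OF fin i] by simp
  have ex: "v $ r = ?s * u $ r + (\<Sum>j\<in>?J. (?z j - ?s * ?t j) * l j $ r)" if r: "r < n" for r
  proof -
    have "?s * u $ r + (\<Sum>j\<in>I. (?z j - ?s * ?t j) * l j $ r) = (\<Sum>j\<in>I. ?z j * l j $ r)"
      unfolding coord_sum[OF I u(1) r] sum_distrib_left sum.distrib[symmetric]
      by (intro sum.cong) (auto simp: algebra_simps)
    then show ?thesis using u(2) by (simp add: split coord_sum[OF I v r])
  qed
  have uniq: "\<beta> = (\<lambda>j. ?z j - ?s * ?t j)"
    if \<beta>: "\<forall>j. j \<notin> ?J \<longrightarrow> \<beta> j = 0" and eq: "\<forall>r<n. v $ r = s * u $ r + (\<Sum>j\<in>?J. \<beta> j * l j $ r)"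
    for \<beta> s
  proof -
    have bi: "\<beta> i = 0" using \<beta> by simp
    have "(\<lambda>j. s * ?t j + \<beta> j) = ?z"
    proof (rule coord_unique[OF I v])
      show "s * ?t j + \<beta> j = 0" if "j \<notin> I" for j using \<beta> that by simp
      show "v $ r = (\<Sum>j\<in>I. (s * ?t j + \<beta> j) * l j $ r)" if r: "r < n" for r
      proof -
        have "(\<Sum>j\<in>I. (s * ?t j + \<beta> j) * l j $ r) = s * u $ r + (\<Sum>j\<in>I. \<beta> j * l j $ r)"
          unfolding coord_sum[OF I u(1) r] sum_distrib_left sum.distrib[symmetric]
          by (intro sum.cong) (auto simp: algebra_simps)
        then show ?thesis using eq r bi by (simp add: split)
      qed
    qed
    then have z: "?z j = s * ?t j + \<beta> j" for j by metis
    from z[of i] have "s = ?s" using bi u(2) by (simp add: field_simps)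
    then show ?thesis using z by (intro ext) simp
  qed
  show ?thesis
    unfolding apex_coord_def
  proof (rule some_equality)
    show "(\<forall>j. j \<notin> ?J \<longrightarrow> ?z j - ?s * ?t j = 0) \<and>
        (\<exists>s. \<forall>r<n. v $ r = s * u $ r + (\<Sum>j\<in>?J. (?z j - ?s * ?t j) * l j $ r))"
    proof (intro conjI exI[of _ ?s] allI impI)
      show "?z j - ?s * ?t j = 0" if "j \<notin> ?J" for j using that u(2) by (cases "j = i") auto
    qed (rule ex)
  qed (use uniq in blast)
qed

text \<open>By Cramer's rule the determinant of the cone times the coordinate of \<open>v\<close> at
  \<open>i\<close> is an incidence sign times \<open>front_det n l v (I - {i})\<close>. After this
  replacement \<open>I\<close> enters a facet term only through the sign and \<open>w I\<close>, the
  form that \<open>sum_cycle_boundary\<close> can sum.\<close>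

lemma cone_weight_mon_split:
  fixes l :: "'a::linorder \<Rightarrow> real vec"
  assumes I: "nondegenerate n l I" and a: "mdeg a = n"
    and v: "v \<in> carrier_vec n" and u: "u \<in> carrier_vec n"
    and nz: "\<And>i. i \<in> I \<Longrightarrow> coord n l I v i \<noteq> 0 \<and> coord n l I u i \<noteq> 0"
    and dist: "\<And>i j. i \<in> I \<Longrightarrow> j \<in> I \<Longrightarrow> i \<noteq> j \<Longrightarrow>
      coord n l I v i * coord n l I u j \<noteq> coord n l I v j * coord n l I u i"
  shows "cone_weight n w l v I * mon (coord n l I v) a =
    cone_weight n w l u I * mon (coord n l I u) a +
    (\<Sum>i\<in>I. vsign i (I - {i}) * w I * (mon (apex_coord n l u v (I - {i})) a /
      (front_det n l v (I - {i}) * (\<Prod>j\<in>I - {i}. apex_coord n l u v (I - {i}) j))))"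
proof -
  let ?z = "coord n l I v" and ?t = "coord n l I u" and ?d = "det (cone_matrix n l I)"
  let ?\<beta> = "\<lambda>i j. ?z j - ?z i / ?t i * ?t j"
  have fin: "finite I" "card I = n" using I by (auto simp: nondegenerate_def)
  have "mon ?z a / (\<Prod>i\<in>I. ?z i) = mon ?t a / (\<Prod>i\<in>I. ?t i) +
    (\<Sum>i\<in>I. mon (?\<beta> i) a / (?z i * (\<Prod>j\<in>I - {i}. ?\<beta> i j)))"
    by (rule mon_over_prod_split[OF fin a]) (use nz dist in auto)
  then have "w I / ?d * (mon ?z a / (\<Prod>i\<in>I. ?z i)) = w I / ?d * (mon ?t a / (\<Prod>i\<in>I. ?t i)) +
    (\<Sum>i\<in>I. w I / ?d * (mon (?\<beta> i) a / (?z i * (\<Prod>j\<in>I - {i}. ?\<beta> i j))))"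
    by (simp only: distrib_left sum_distrib_left)
  moreover have "w I / ?d * (mon (?\<beta> i) a / (?z i * (\<Prod>j\<in>I - {i}. ?\<beta> i j))) =
      vsign i (I - {i}) * w I * (mon (apex_coord n l u v (I - {i})) a /
      (front_det n l v (I - {i}) * (\<Prod>j\<in>I - {i}. apex_coord n l u v (I - {i}) j)))"
    if i: "i \<in> I" for i
  proof -
    have ins: "insert i (I - {i}) = I" using i by auto
    have "Suc (card (I - {i})) = n" using fin i by (metis card_Suc_Diff1)
    then have d: "?d = vsign i (I - {i}) * front_det n l (l i) (I - {i})"
      using det_cone_matrix_insert[of "I - {i}" i n l] fin ins by simp
    have f: "front_det n l v (I - {i}) = ?z i * front_det n l (l i) (I - {i})"
      using front_det_coord[of n l i "I - {i}" v] I v ins by simp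
    show ?thesis using vsign_cases[of i "I - {i}"]
      unfolding apex_coord_eq[OF I i v u conjunct2[OF nz[OF i]]] f d
      by (auto simp: mult_ac)
  qed
  ultimately show ?thesis
    unfolding cone_weight_def by (simp add: divide_divide_eq_left mult_ac)
qed

lemma moment_generic_pair:
  assumes fan: "multi_fan n M w l" and a: "mdeg a = n"
    and v: "v \<in> carrier_vec n" and u: "u \<in> carrier_vec n"
    and nz: "\<And>I i. w I \<noteq> 0 \<Longrightarrow> i \<in> I \<Longrightarrow> coord n l I v i \<noteq> 0 \<and> coord n l I u i \<noteq> 0"
    and dist: "\<And>I i j. w I \<noteq> 0 \<Longrightarrow> i \<in> I \<Longrightarrow> j \<in> I \<Longrightarrow> i \<noteq> j \<Longrightarrow>
      coord n l I v i * coord n l I u j \<noteq> coord n l I v j * coord n l I u i"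
  shows "(\<Sum>I\<in>Pow M. cone_weight n w l v I * mon (coord n l I v) a) =
    (\<Sum>I\<in>Pow M. cone_weight n w l u I * mon (coord n l I u) a)"
proof -
  let ?\<Psi> = "\<lambda>J. mon (apex_coord n l u v J) a /
      (front_det n l v J * (\<Prod>j\<in>J. apex_coord n l u v J j))"
  have "cone_weight n w l v I * mon (coord n l I v) a =
    cone_weight n w l u I * mon (coord n l I u) a +
    (\<Sum>i\<in>I. vsign i (I - {i}) * w I * ?\<Psi> (I - {i}))" for I
  proof (cases "w I = 0")
    case True
    then show ?thesis by (simp add: cone_weight_def)
  next
    case False
    show ?thesis
      by (rule cone_weight_mon_split[OF multi_fan_nondegenerate[OF fan False] a v u])
        (use nz dist False in auto)
  qed
  moreover have "(\<Sum>I\<in>Pow M. \<Sum>i\<in>I. vsign i (I - {i}) * w I * ?\<Psi> (I - {i})) = 0"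
    by (rule sum_cycle_boundary[of n]) (use fan in \<open>simp add: multi_fan_def\<close>)
  ultimately show ?thesis by (simp add: sum.distrib)
qed

lemma prod_cone_coordinates:
  assumes "finite I" "card I = n"
  shows "(\<Prod>j<n. cone_coordinates n l I v $ j) = (\<Prod>i\<in>I. coord n l I v i)"
proof -
  have "bij_betw ((!) (sorted_list_of_set I)) {..<n} I"
    by (rule bij_betw_nth) (use assms in auto)
  from prod.reindex_bij_betw[OF this, of "coord n l I v"] show ?thesis
    using coord_nth[of I _ n l v] assms by simp
qed

lemma generic_vector_iff:
  assumes "multi_fan n M w l"
  shows "generic_vector n w l v \<longleftrightarrow>
    v \<in> carrier_vec n \<and> (\<forall>I. w I \<noteq> 0 \<longrightarrow> (\<forall>i\<in>I. coord n l I v i \<noteq> 0))"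
proof -
  have "(\<forall>j<n. cone_coordinates n l I v $ j \<noteq> 0) \<longleftrightarrow> (\<forall>i\<in>I. coord n l I v i \<noteq> 0)"
    if "w I \<noteq> 0" for I
  proof -
    have fin: "finite I" "card I = n"
      using multi_fan_nondegenerate[OF assms that] by (auto simp: nondegenerate_def)
    show ?thesis
    proof
      assume *: "\<forall>j<n. cone_coordinates n l I v $ j \<noteq> 0"
      show "\<forall>i\<in>I. coord n l I v i \<noteq> 0"
      proof
        fix i assume "i \<in> I"
        then obtain j where "j < n" "i = sorted_list_of_set I ! j"
          using fin by (metis in_set_conv_nth length_sorted_list_of_set set_sorted_list_of_set)
        then show "coord n l I v i \<noteq> 0" using * coord_nth[of I j n l v] fin by simp
      qed
    next
      assume *: "\<forall>i\<in>I. coord n l I v i \<noteq> 0"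
      have "sorted_list_of_set I ! j \<in> I" if "j < n" for j
        using nth_mem[of j "sorted_list_of_set I"] fin that by simp
      then show "\<forall>j<n. cone_coordinates n l I v $ j \<noteq> 0"
        using * coord_nth[of I _ n l v] fin by metis
    qed
  qed
  then show ?thesis unfolding generic_vector_def by blast
qed

text \<open>Each cone carries its own characteristic function, because one vector has to be generic
  for several fans at once. The functional reading off the coordinate at \<open>i\<close> is
  nonzero, as it takes the value 1 at \<open>l i\<close>.\<close>

lemma exists_generic:
  assumes "finite F" "\<And>l I. (l, I) \<in> F \<Longrightarrow> nondegenerate n l I"
  shows "\<exists>v\<in>carrier_vec n. \<forall>(l, I)\<in>F. \<forall>i\<in>I. coord n l I v i \<noteq> 0"
proof -
  have "\<forall>p. \<exists>H. \<forall>v\<in>carrier_vec n. (fst (fst p), snd (fst p)) \<in> F \<longrightarrow>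
      coord n (fst (fst p)) (snd (fst p)) v (snd p) = (\<Sum>r<n. H r * v $ r)" (is "\<forall>p. ?P p")
  proof
    fix p show "?P p"
    proof (cases "(fst (fst p), snd (fst p)) \<in> F")
      case True
      from coord_functional[OF assms(2)[OF True], of "snd p"] show ?thesis by auto
    qed simp
  qed
  from choice[OF this] obtain H where H0: "\<forall>p. \<forall>v\<in>carrier_vec n. (fst (fst p), snd (fst p)) \<in> F \<longrightarrow>
      coord n (fst (fst p)) (snd (fst p)) v (snd p) = (\<Sum>r<n. H p r * v $ r)" ..
  have H: "coord n l I v i = (\<Sum>r<n. H ((l, I), i) r * v $ r)"
    if "(l, I) \<in> F" "v \<in> carrier_vec n" for l I i v
    using spec[OF H0, of "((l, I), i)"] that by simp
  let ?X = "SIGMA q:F. snd q"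
  have "finite ?X"
    using assms by (intro finite_SigmaI) (auto simp: nondegenerate_def)
  then have "finite (H ` ?X)" by simp
  moreover have "\<exists>v. (\<Sum>r<n. g r * v $ r) \<noteq> 0" if g: "g \<in> H ` ?X" for g
  proof -
    obtain x where x: "x \<in> ?X" "g = H x" using g by blast
    obtain q i where xq: "x = (q, i)" by (cases x)
    obtain l I where "q = (l, I)" by (cases q)
    with xq have p: "(l, I) \<in> F" "i \<in> I" "g = H ((l, I), i)" using x by auto
    note nd = assms(2)[OF p(1)]
    then have "l i \<in> carrier_vec n" using p(2) by (auto simp: nondegenerate_def)
    then have "(\<Sum>r<n. g r * l i $ r) = 1"
      using H[OF p(1), of "l i" i] coord_generator[OF nd p(2), of i] p(3) by simp
    then show ?thesis by (intro exI[of _ "l i"]) simp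
  qed
  ultimately obtain v where v: "v \<in> carrier_vec n" "\<forall>g\<in>H ` ?X. (\<Sum>r<n. g r * v $ r) \<noteq> 0"
    using common_nonvanishing_vector[of "H ` ?X" n] by blast
  then show ?thesis using H by (intro bexI[of _ v]) (force simp: image_iff)+
qed

text \<open>The additional condition separates the ratios of the coordinates of \<open>v\<close> and
  \<open>u\<close>, which are the nodes of a divided difference. The difference of the two products
  is linear in \<open>u\<close>, and at \<open>l j\<close> it equals \<open>coord n l I v i\<close>,
  hence it is a nonzero functional.\<close>

lemma exists_separating:
  fixes l :: "'a::linorder \<Rightarrow> real vec"
  assumes "finite F" "\<And>I. I \<in> F \<Longrightarrow> nondegenerate n l I"
    and V: "finite V" "\<And>v I i. v \<in> V \<Longrightarrow> I \<in> F \<Longrightarrow> i \<in> I \<Longrightarrow> coord n l I v i \<noteq> 0"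
  shows "\<exists>u\<in>carrier_vec n. \<forall>I\<in>F. \<forall>i\<in>I. coord n l I u i \<noteq> 0 \<and>
    (\<forall>v\<in>V. \<forall>j\<in>I. i \<noteq> j \<longrightarrow> coord n l I v i * coord n l I u j \<noteq> coord n l I v j * coord n l I u i)"
proof -
  have "\<forall>p. \<exists>H. \<forall>v\<in>carrier_vec n. fst p \<in> F \<longrightarrow>
      coord n l (fst p) v (snd p) = (\<Sum>r<n. H r * v $ r)" (is "\<forall>p. ?P p")
  proof
    fix p show "?P p"
    proof (cases "fst p \<in> F")
      case True
      from coord_functional[OF assms(2)[OF True], of "snd p"] show ?thesis by auto
    qed simp
  qed
  from choice[OF this] obtain H where H0: "\<forall>p. \<forall>v\<in>carrier_vec n. fst p \<in> F \<longrightarrow>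
      coord n l (fst p) v (snd p) = (\<Sum>r<n. H p r * v $ r)" ..
  have H: "coord n l I v i = (\<Sum>r<n. H (I, i) r * v $ r)"
    if "I \<in> F" "v \<in> carrier_vec n" for I i v
    using spec[OF H0, of "(I, i)"] that by simp
  define G where "G = (\<lambda>(I, v, i, j) r. coord n l I v i * H (I, j) r - coord n l I v j * H (I, i) r)"
  let ?X = "SIGMA I:F. I" and ?Y = "SIGMA I:F. V \<times> {(i, j). i \<in> I \<and> j \<in> I \<and> i \<noteq> j}"
  have finI: "finite I" if "I \<in> F" for I using assms(2)[OF that] by (simp add: nondegenerate_def)
  have "finite ?X" using assms(1) finI by (intro finite_SigmaI) auto
  moreover have "finite ?Y"
  proof (intro finite_SigmaI assms(1) finite_cartesian_product V(1))
    show "finite {(i, j). i \<in> I \<and> j \<in> I \<and> i \<noteq> j}" if "I \<in> F" for I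
      by (rule finite_subset[of _ "I \<times> I"]) (use finI[OF that] in auto)
  qed
  ultimately have "finite (H ` ?X \<union> G ` ?Y)" by simp
  moreover have gen: "l i \<in> carrier_vec n" "(\<Sum>r<n. H (I, j) r * l i $ r) = (if j = i then 1 else 0)"
    if "I \<in> F" "i \<in> I" for I i j
  proof -
    show "l i \<in> carrier_vec n" using assms(2)[OF that(1)] that(2) by (auto simp: nondegenerate_def)
    then show "(\<Sum>r<n. H (I, j) r * l i $ r) = (if j = i then 1 else 0)"
      using H[OF that(1), of "l i" j] coord_generator[OF assms(2)[OF that(1)] that(2), of j] by simp
  qed
  have Gsum: "(\<Sum>r<n. G (I, v, i, j) r * u $ r) =
      coord n l I v i * (\<Sum>r<n. H (I, j) r * u $ r) - coord n l I v j * (\<Sum>r<n. H (I, i) r * u $ r)"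
    for I v i j u
    unfolding G_def sum_distrib_left by (simp add: left_diff_distrib sum_subtractf mult.assoc)
  have "\<exists>u. (\<Sum>r<n. g r * u $ r) \<noteq> 0" if "g \<in> H ` ?X \<union> G ` ?Y" for g
    using that
  proof
    assume "g \<in> H ` ?X"
    then obtain I i where "I \<in> F" "i \<in> I" "g = H (I, i)" by auto
    then show ?thesis using gen(2)[of I i i] by (intro exI[of _ "l i"]) simp
  next
    assume "g \<in> G ` ?Y"
    then obtain I v i j where p: "I \<in> F" "v \<in> V" "i \<in> I" "j \<in> I" "i \<noteq> j" "g = G (I, v, i, j)" by auto
    then show ?thesis
      using Gsum[of I v i j "l j"] gen(2)[of I j j] gen(2)[of I j i] V(2)[of v I i]
      by (intro exI[of _ "l j"]) simp
  qed
  ultimately obtain u where u: "u \<in> carrier_vec n"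
      "\<forall>g\<in>H ` ?X \<union> G ` ?Y. (\<Sum>r<n. g r * u $ r) \<noteq> 0"
    using common_nonvanishing_vector[of "H ` ?X \<union> G ` ?Y" n] by blast
  show ?thesis
  proof (intro bexI[OF _ u(1)] ballI conjI impI)
    fix I i assume I: "I \<in> F" "i \<in> I"
    then have "H (I, i) \<in> H ` ?X \<union> G ` ?Y" by auto
    then have "(\<Sum>r<n. H (I, i) r * u $ r) \<noteq> 0" using u(2) by blast
    then show "coord n l I u i \<noteq> 0" using H[OF I(1) u(1), of i] by simp
    fix v j assume j: "v \<in> V" "j \<in> I" "i \<noteq> j"
    then have "G (I, v, i, j) \<in> H ` ?X \<union> G ` ?Y" using I by auto
    then have "(\<Sum>r<n. G (I, v, i, j) r * u $ r) \<noteq> 0" using u(2) by blast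
    then show "coord n l I v i * coord n l I u j \<noteq> coord n l I v j * coord n l I u i"
      unfolding Gsum H[OF I(1) u(1), symmetric] by simp
  qed
qed

lemma finite_cycle_support: "simplicial_cycle n M w \<Longrightarrow> finite {I. w I \<noteq> 0}"
  by (rule finite_subset[of _ "Pow M"]) (auto simp: simplicial_cycle_def)

text \<open>Two given generic vectors may have coordinates in equal ratio at two vertices of a cone,
  so each of them is compared with a third vector in general position to both.\<close>

lemma moment_monomial_independent:
  assumes fan: "multi_fan n M w l" and a: "mdeg a = n"
    and "generic_vector n w l v" "generic_vector n w l v'"
  shows "(\<Sum>I\<in>Pow M. cone_weight n w l v I * mon (coord n l I v) a) =
    (\<Sum>I\<in>Pow M. cone_weight n w l v' I * mon (coord n l I v') a)"
proof -
  note g = assms(3,4)[unfolded generic_vector_iff[OF fan]]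
  have "finite {I. w I \<noteq> 0}" using fan finite_cycle_support by (auto simp: multi_fan_def)
  have "\<exists>u\<in>carrier_vec n. \<forall>I\<in>{I. w I \<noteq> 0}. \<forall>i\<in>I. coord n l I u i \<noteq> 0 \<and>
    (\<forall>x\<in>{v, v'}. \<forall>j\<in>I. i \<noteq> j \<longrightarrow> coord n l I x i * coord n l I u j \<noteq> coord n l I x j * coord n l I u i)"
    by (rule exists_separating[OF \<open>finite {I. w I \<noteq> 0}\<close>])
      (use multi_fan_nondegenerate[OF fan] g in auto)
  then obtain u where u: "u \<in> carrier_vec n"
    and sep: "\<forall>I\<in>{I. w I \<noteq> 0}. \<forall>i\<in>I. coord n l I u i \<noteq> 0 \<and>
    (\<forall>x\<in>{v, v'}. \<forall>j\<in>I. i \<noteq> j \<longrightarrow> coord n l I x i * coord n l I u j \<noteq> coord n l I x j * coord n l I u i)" ..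
  have "(\<Sum>I\<in>Pow M. cone_weight n w l x I * mon (coord n l I x) a) =
    (\<Sum>I\<in>Pow M. cone_weight n w l u I * mon (coord n l I u) a)" if x: "x \<in> {v, v'}" for x
  proof (rule moment_generic_pair[OF fan a _ u])
    show "x \<in> carrier_vec n" using x g by auto
    show "coord n l I x i \<noteq> 0 \<and> coord n l I u i \<noteq> 0" if "w I \<noteq> 0" "i \<in> I" for I i
      using that x g sep by auto
    show "coord n l I x i * coord n l I u j \<noteq> coord n l I x j * coord n l I u i"
      if "w I \<noteq> 0" "i \<in> I" "j \<in> I" "i \<noteq> j" for I i j
      using that x sep by blast
  qed
  then show ?thesis by simp
qed

lemma generic_vector_some:
  assumes fan: "multi_fan n M w l"
  shows "generic_vector n w l (SOME v. generic_vector n w l v)"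
proof -
  have "finite ((\<lambda>I. (l, I)) ` {I. w I \<noteq> 0})"
    using fan finite_cycle_support by (auto simp: multi_fan_def)
  from exists_generic[OF this, of n] multi_fan_nondegenerate[OF fan]
  have "\<exists>v. generic_vector n w l v" unfolding generic_vector_iff[OF fan] by fastforce
  then show ?thesis by (rule someI_ex)
qed

text \<open>The definition picks \<open>v\<close> by a choice that varies with the fan; independence
  replaces it by any prescribed generic \<open>v\<close>. The factor n! from the power of the linear
  form cancels the prefactor.\<close>

lemma lookup_volume_polynomial:
  assumes fan: "multi_fan n M w l" and v: "generic_vector n w l v"
  shows "mfact a * lookup (volume_polynomial n w l) a =
    (if mdeg a = n then \<Sum>I\<in>Pow M. cone_weight n w l v I * mon (coord n l I v) a else 0)"
proof -
  define x where "x = (SOME v. generic_vector n w l v)"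
  have x: "generic_vector n w l x" unfolding x_def by (rule generic_vector_some[OF fan])
  have M: "finite M" "{I. w I \<noteq> 0} \<subseteq> Pow M"
    using fan by (auto simp: multi_fan_def simplicial_cycle_def)
  let ?L = "\<lambda>I. (\<Sum>i\<in>I. mconst (coord n l I x i) * mvar i)"
  have summand: "mconst (w I / (det (cone_matrix n l I) * (\<Prod>j<n. cone_coordinates n l I x $ j))) *
      (\<Sum>j<n. mconst (cone_coordinates n l I x $ j) * mvar (sorted_list_of_set I ! j)) ^ n =
      mconst (cone_weight n w l x I) * ?L I ^ n" if "w I \<noteq> 0" for I
  proof -
    have fin: "finite I" "card I = n"
      using multi_fan_nondegenerate[OF fan that] by (auto simp: nondegenerate_def)
    have "bij_betw ((!) (sorted_list_of_set I)) {..<n} I"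
      by (rule bij_betw_nth) (use fin in auto)
    from sum.reindex_bij_betw[OF this, of "\<lambda>i. mconst (coord n l I x i) * mvar i"]
    show ?thesis
      using coord_nth[of I _ n l x] fin prod_cone_coordinates[OF fin, of l x]
      by (simp add: cone_weight_def)
  qed
  have "volume_polynomial n w l =
      mconst (1 / fact n) * (\<Sum>I | w I \<noteq> 0. mconst (cone_weight n w l x I) * ?L I ^ n)"
    unfolding volume_polynomial_def Let_def x_def[symmetric]
    by (rule arg_cong[where f = "(*) (mconst (1 / fact n))"], rule sum.cong[OF refl], rule summand) simp
  then have "mfact a * lookup (volume_polynomial n w l) a =
      1 / fact n * (\<Sum>I | w I \<noteq> 0. cone_weight n w l x I * (mfact a * lookup (?L I ^ n) a))"
    by (simp add: lookup_mconst_mult lookup_sum sum_distrib_left mult_ac)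
  also have "(\<Sum>I | w I \<noteq> 0. cone_weight n w l x I * (mfact a * lookup (?L I ^ n) a)) =
      (\<Sum>I | w I \<noteq> 0. cone_weight n w l x I * (if mdeg a = n then fact n * mon (coord n l I x) a else 0))"
  proof (intro sum.cong refl)
    fix I assume "I \<in> {I. w I \<noteq> 0}"
    then have "finite I"
      using multi_fan_nondegenerate[OF fan] by (auto simp: nondegenerate_def)
    then show "cone_weight n w l x I * (mfact a * lookup (?L I ^ n) a) =
        cone_weight n w l x I * (if mdeg a = n then fact n * mon (coord n l I x) a else 0)"
      by (subst lookup_linear_form_power) auto
  qed
  also have "1 / fact n * \<dots> =
      (if mdeg a = n then \<Sum>I | w I \<noteq> 0. cone_weight n w l x I * mon (coord n l I x) a else 0)"
    by (auto simp: sum_distrib_left)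
  also have "(\<Sum>I | w I \<noteq> 0. cone_weight n w l x I * mon (coord n l I x) a) =
      (\<Sum>I\<in>Pow M. cone_weight n w l x I * mon (coord n l I x) a)"
    using M by (intro sum.mono_neutral_left) (auto simp: cone_weight_def)
  finally show ?thesis using moment_monomial_independent[OF fan _ x v, of a] by simp
qed

lemma pairing_volume_polynomial:
  assumes fan: "multi_fan n M w l" and v: "generic_vector n w l v"
  shows "pairing (volume_polynomial n w l) p = moment n M w l v (hpart n p)"
proof (induction p rule: mpoly_induct)
  case (single a r)
  show ?case
    by (simp add: pairing_single lookup_volume_polynomial[OF fan v] hpart_single moment_single)
next
  case (add p q)
  then show ?case by (simp add: pairing_add hpart_add moment_add)
qed

lemma annihilator_iff:
  "D \<in> annihilator n M w l \<longleftrightarrow>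
     D \<in> operators M \<and> (\<forall>E. pairing (volume_polynomial n w l) (D * E) = 0)"
  by (simp add: annihilator_def carrier_operator_ring apply_operator_eq_0_iff)

text \<open>The volume polynomial is homogeneous of degree \<open>n\<close>, so only test operators
  of the complementary degree count, and monomials with a vertex outside \<open>M\<close> evaluate
  to 0 at all the coordinate vectors. For d > n there is no complementary degree and every operator
  annihilates.\<close>

lemma hom_annihilator_iff:
  assumes fan: "multi_fan n M w l" and v: "generic_vector n w l v" and D: "D \<in> hom_operators M d"
  shows "D \<in> annihilator n M w l \<longleftrightarrow>
    (\<forall>m E. d + m = n \<longrightarrow> E \<in> hom_operators M m \<longrightarrow> moment n M w l v (D * E) = 0)"
proof
  assume D': "D \<in> annihilator n M w l"
  show "\<forall>m E. d + m = n \<longrightarrow> E \<in> hom_operators M m \<longrightarrow> moment n M w l v (D * E) = 0"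
  proof (intro allI impI)
    fix m E assume "d + m = n" "E \<in> hom_operators M m"
    then have "D * E \<in> hom_operators M n" using hom_operators_mult[OF D] by auto
    then show "moment n M w l v (D * E) = 0"
      using D' pairing_volume_polynomial[OF fan v, of "D * E"]
      by (simp add: annihilator_iff hpart_hom)
  qed
next
  assume *: "\<forall>m E. d + m = n \<longrightarrow> E \<in> hom_operators M m \<longrightarrow> moment n M w l v (D * E) = 0"
  have "moment n M w l v (hpart n (D * E)) = 0" for E
  proof (induction E rule: mpoly_induct)
    case (single a r)
    show ?case
    proof (cases "d + mdeg a = n")
      case True
      have e: "hpart n (D * Poly_Mapping.single a r) = D * Poly_Mapping.single a r"
        using hpart_mult_single[of a d D r] hpart_hom[OF D, of d] True by (simp add: add.commute)
      show ?thesis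
      proof (cases "keys a \<subseteq> M")
        case keys: True
        then show ?thesis
          using * True hom_operators_single[OF keys refl, of r] by (simp add: e)
      next
        case False
        then obtain i where i: "i \<in> keys a" "i \<notin> M" by auto
        have "mon (coord n l I v) a = 0" if "I \<in> Pow M" for I
          unfolding mon_def using i that
          by (intro prod_zero) (auto simp: in_keys_iff coord_def intro!: bexI[of _ i])
        then show ?thesis
          unfolding e moment_def
          by (intro sum.neutral) (auto simp: peval_mult peval_single)
      qed
    next
      case False
      have "hpart n (D * Poly_Mapping.single a r) = 0"
      \<comment> \<open>The complementary degree n - mdeg a is a genuine difference only in the
        first case; in the second, every monomial of the product has degree above
        \<open>n\<close>.\<close>
      proof (cases "mdeg a \<le> n")
        case True
        then show ?thesis
          using hpart_mult_single[of a "n - mdeg a" D r] hpart_hom[OF D, of "n - mdeg a"] False by auto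
      next
        case big: False
        show ?thesis
        proof (intro poly_mapping_eqI)
          fix b
          have "lookup (D * Poly_Mapping.single a r) b = 0" if "mdeg b = n"
          proof (rule ccontr)
            assume "lookup (D * Poly_Mapping.single a r) b \<noteq> 0"
            then have "b \<in> keys (D * Poly_Mapping.single a r)" by (simp add: in_keys_iff)
            then obtain b' where "b = b' + a"
              using keys_mult[of D "Poly_Mapping.single a r"] by (auto split: if_splits)
            then show False using big that by (simp add: mdeg_add)
          qed
          then show "lookup (hpart n (D * Poly_Mapping.single a r)) b = lookup 0 b"
            by (simp add: lookup_hpart)
        qed
      qed
      then show ?thesis by simp
    qed
  next
    case (add p q)
    then show ?case by (simp add: distrib_left hpart_add moment_add)
  qed
  then show "D \<in> annihilator n M w l"
    using hom_operatorsD[OF D] by (simp add: annihilator_iff pairing_volume_polynomial[OF fan v])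
qed

subsection \<open>The multi-fan algebra as a quotient\<close>

lemma operator_ring_sel [simp]:
  "carrier (operator_ring M) = operators M" "mult (operator_ring M) = (*)"
  "add (operator_ring M) = (+)" "one (operator_ring M) = 1" "zero (operator_ring M) = 0"
  by (simp_all add: operator_ring_def operators_def)

lemma cring_operator_ring: "cring (operator_ring M)"
proof (rule cringI)
  show "abelian_group (operator_ring M)"
    by (rule abelian_groupI)
      (auto simp: operators_add add_ac intro: operators_uminus bexI[of _ "- _"])
  show "Group.comm_monoid (operator_ring M)"
    by (rule comm_monoidI) (auto simp: operators_mult mult_ac)
qed (simp add: distrib_right)

lemma ideal_annihilator: "ideal (annihilator n M w l) (operator_ring M)"
proof -
  let ?R = "operator_ring M" and ?I = "annihilator n M w l"
  let ?f = "volume_polynomial n w l"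
  interpret cring ?R by (rule cring_operator_ring)
  have 0: "0 \<in> ?I" by (simp add: annihilator_iff pairing_def)
  have add: "p + q \<in> ?I" if "p \<in> ?I" "q \<in> ?I" for p q
    using that by (simp add: annihilator_iff operators_add distrib_right pairing_add)
  have mult: "q * p \<in> ?I" "p * q \<in> ?I" if "p \<in> ?I" "q \<in> operators M" for p q
  proof -
    have "pairing ?f (p * (q * E)) = 0" for E using that by (simp add: annihilator_iff)
    then show "q * p \<in> ?I" "p * q \<in> ?I"
      using that by (simp_all add: annihilator_iff operators_mult mult_ac)
  qed
  have neg: "\<ominus>\<^bsub>?R\<^esub> p = - p" if "p \<in> operators M" for p
    using minus_equality[of "- p" p] that operators_uminus[OF that] by simp
  show ?thesis
  proof (rule idealI)
    show "subgroup ?I (add_monoid ?R)"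
    proof (rule add.subgroupI)
      show "?I \<subseteq> carrier ?R" by (auto simp: annihilator_iff)
      show "\<ominus>\<^bsub>?R\<^esub> p \<in> ?I" if "p \<in> ?I" for p
        using that mult(1)[OF that, of "- 1"] operators_uminus[of 1 M]
        by (simp add: neg annihilator_iff)
    qed (use 0 add in auto)
  qed (use mult in \<open>auto simp: ring_axioms\<close>)
qed

lemma operator_class_eq_iff:
  assumes "D \<in> operators M" "E \<in> operators M"
  shows "operator_class n M w l D = operator_class n M w l E \<longleftrightarrow> D - E \<in> annihilator n M w l"
proof -
  let ?I = "annihilator n M w l"
  interpret ideal ?I "operator_ring M" by (rule ideal_annihilator)
  have cls: "operator_class n M w l F = {p + F | p. p \<in> ?I}" for F
    by (auto simp: operator_class_def a_r_coset_def')
  have 0: "0 \<in> ?I" using additive_subgroup.zero_closed[OF is_additive_subgroup] by simp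
  have add: "p + q \<in> ?I" if "p \<in> ?I" "q \<in> ?I" for p q
    using additive_subgroup.a_closed[OF is_additive_subgroup that] by simp
  have neg: "- p \<in> ?I" if "p \<in> ?I" for p
    using I_l_closed[OF that, of "- 1"] operators_uminus[of 1 M] by simp
  show ?thesis
  proof
    assume "operator_class n M w l D = operator_class n M w l E"
    moreover have "D \<in> operator_class n M w l D" unfolding cls using 0 by force
    ultimately obtain p where "p \<in> ?I" "D = p + E" unfolding cls by auto
    then show "D - E \<in> ?I" by simp
  next
    assume DE: "D - E \<in> ?I"
    show "operator_class n M w l D = operator_class n M w l E"
    proof (intro equalityI subsetI)
      fix q assume "q \<in> operator_class n M w l D"
      then obtain p where "p \<in> ?I" "q = (p + (D - E)) + E" unfolding cls by auto
      then show "q \<in> operator_class n M w l E" unfolding cls using add DE by blast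
    next
      fix q assume "q \<in> operator_class n M w l E"
      then obtain p where "p \<in> ?I" "q = (p + - (D - E)) + D" unfolding cls by auto
      then show "q \<in> operator_class n M w l D" unfolding cls using add[OF _ neg[OF DE]] by blast
    qed
  qed
qed

lemma multi_fan_algebra_ops:
  assumes "D \<in> operators M" "E \<in> operators M"
  shows "operator_class n M w l D \<otimes>\<^bsub>multi_fan_algebra n M w l\<^esub> operator_class n M w l E =
      operator_class n M w l (D * E)"
    and "operator_class n M w l D \<oplus>\<^bsub>multi_fan_algebra n M w l\<^esub> operator_class n M w l E =
      operator_class n M w l (D + E)"
    and "\<zero>\<^bsub>multi_fan_algebra n M w l\<^esub> = operator_class n M w l 0"
proof -
  interpret ideal "annihilator n M w l" "operator_ring M" by (rule ideal_annihilator)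
  show "operator_class n M w l D \<otimes>\<^bsub>multi_fan_algebra n M w l\<^esub> operator_class n M w l E =
      operator_class n M w l (D * E)"
    using rcoset_mult_add[of D E] assms
    by (simp add: multi_fan_algebra_def FactRing_def operator_class_def)
  show "operator_class n M w l D \<oplus>\<^bsub>multi_fan_algebra n M w l\<^esub> operator_class n M w l E =
      operator_class n M w l (D + E)"
    using a_rcos_sum[of D E] assms
    by (simp add: multi_fan_algebra_def FactRing_def operator_class_def)
  show "\<zero>\<^bsub>multi_fan_algebra n M w l\<^esub> = operator_class n M w l 0"
    by (auto simp: multi_fan_algebra_def FactRing_def operator_class_def a_r_coset_def')
qed

lemma carrier_multi_fan_algebra:
  "carrier (multi_fan_algebra n M w l) = operator_class n M w l ` operators M"
  by (auto simp: multi_fan_algebra_def FactRing_def A_RCOSETS_def' operator_class_def)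

lemma editable_annihilator:
  assumes ed: "editable n M w l x y" and D: "D \<in> operators M" "D * mvar x \<in> annihilator n M w l"
  shows "\<exists>E\<in>operators M. D - E * mvar y \<in> annihilator n M w l"
proof -
  let ?A = "multi_fan_algebra n M w l" and ?c = "operator_class n M w l"
  have xy: "x \<in> M" "y \<in> M" using ed by (auto simp: editable_def suspension_shaped_def)
  have im: "(\<lambda>a. a \<otimes>\<^bsub>?A\<^esub> ?c (mvar y)) ` carrier ?A =
      {a \<in> carrier ?A. a \<otimes>\<^bsub>?A\<^esub> ?c (mvar x) = \<zero>\<^bsub>?A\<^esub>}"
    using ed by (simp add: editable_def Let_def)
  have "?c D \<otimes>\<^bsub>?A\<^esub> ?c (mvar x) = ?c (D * mvar x)"
    using multi_fan_algebra_ops(1)[OF D(1), of "mvar x"] xy by simp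
  also have "\<dots> = \<zero>\<^bsub>?A\<^esub>"
    using operator_class_eq_iff[of "D * mvar x" M 0 n w l] D xy multi_fan_algebra_ops(3)[OF D(1) D(1)]
    by (simp add: operators_mult)
  finally have "?c D \<in> {a \<in> carrier ?A. a \<otimes>\<^bsub>?A\<^esub> ?c (mvar x) = \<zero>\<^bsub>?A\<^esub>}"
    using D by (simp add: carrier_multi_fan_algebra)
  then have "?c D \<in> (\<lambda>a. a \<otimes>\<^bsub>?A\<^esub> ?c (mvar y)) ` carrier ?A"
    unfolding im .
  then obtain E where E: "E \<in> operators M" "?c D = ?c E \<otimes>\<^bsub>?A\<^esub> ?c (mvar y)"
    unfolding carrier_multi_fan_algebra by auto
  then have "?c D = ?c (E * mvar y)" using multi_fan_algebra_ops(1)[OF E(1), of "mvar y"] xy by simp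
  then have "D - E * mvar y \<in> annihilator n M w l"
    using operator_class_eq_iff[OF D(1), of "E * mvar y"] E xy by (simp add: operators_mult)
  then show ?thesis using E by blast
qed

lemma algebra_component_vectorspace:
  "vectorspace class_ring (algebra_component n M w l d)"
  "poly_linear (hom_operators M d) (algebra_component n M w l d) (operator_class n M w l)"
  "carrier (algebra_component n M w l d) = operator_class n M w l ` hom_operators M d"
  "zero (algebra_component n M w l d) = operator_class n M w l 0"
proof -
  let ?W = "algebra_component n M w l d" and ?c = "operator_class n M w l"
  show car: "carrier ?W = ?c ` hom_operators M d"
    by (simp add: algebra_component_def Let_def hom_operators_eq)
  have add: "?c p \<oplus>\<^bsub>?W\<^esub> ?c q = ?c (p + q)" if "p \<in> hom_operators M d" "q \<in> hom_operators M d" for p q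
    using multi_fan_algebra_ops(2)[OF hom_operatorsD[OF that(1)] hom_operatorsD[OF that(2)]]
    by (simp add: algebra_component_def Let_def)
  have smult: "r \<odot>\<^bsub>?W\<^esub> ?c p = ?c (mconst r * p)" if "p \<in> hom_operators M d" for r p
    using multi_fan_algebra_ops(1)[OF _ hom_operatorsD[OF that], of "mconst r"]
    by (simp add: algebra_component_def Let_def)
  show zero: "zero ?W = ?c 0"
    using multi_fan_algebra_ops(3)[of 0 M 0 n w l] by (simp add: algebra_component_def Let_def)
  show "vectorspace class_ring ?W"
    by (rule vectorspace_image[OF poly_subspace_hom_operators car zero add smult])
  show "poly_linear (hom_operators M d) ?W ?c"
    by (simp add: poly_linear_def car add smult)
qed

text \<open>The surjection \<open>\<phi>\<close> presents the component as a quotient of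
  \<open>U\<close>, which may consist of operators in other variables. Algebras over different
  vertex sets thereby become comparable inside one space.\<close>

lemma component_dim_rank_nullity:
  fixes \<phi> :: "'b mpoly \<Rightarrow> 'a::linorder mpoly"
  assumes U: "poly_subspace U" "poly_fin_dim U"
    and \<phi>: "\<phi> ` U = hom_operators M d" "\<And>p q. \<phi> (p + q) = \<phi> p + \<phi> q"
      "\<And>c p. \<phi> (mconst c * p) = mconst c * \<phi> p"
  shows "component_dim n M w l d + poly_dim {p \<in> U. \<phi> p \<in> annihilator n M w l} = poly_dim U"
proof -
  let ?W = "algebra_component n M w l d" and ?c = "operator_class n M w l"
  note W = algebra_component_vectorspace[where n = n and M = M and w = w and l = l and d = d]
  have mem: "\<phi> p \<in> hom_operators M d" if "p \<in> U" for p using that \<phi>(1) by blast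
  have lin: "poly_linear U ?W (\<lambda>p. ?c (\<phi> p))"
    using W(2) mem by (simp add: poly_linear_def image_subset_iff \<phi>(2,3))
  have "(\<lambda>p. ?c (\<phi> p)) ` U = carrier ?W"
    unfolding W(3) \<phi>(1)[symmetric] by (simp add: image_image)
  moreover have "{p \<in> U. ?c (\<phi> p) = \<zero>\<^bsub>?W\<^esub>} = {p \<in> U. \<phi> p \<in> annihilator n M w l}"
  proof -
    have "\<phi> p \<in> operators M" if "p \<in> U" for p using that \<phi>(1) hom_operatorsD by blast
    then show ?thesis unfolding W(4) using operator_class_eq_iff[of _ M 0 n w l] by auto
  qed
  ultimately show ?thesis
    using poly_rank_nullity[OF U W(1) lin] by (simp add: component_dim_def)
qed

subsection \<open>Linear substitutions\<close>

lemma mon_mvar: "mon mvar a = Poly_Mapping.single a (1::real)"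
proof -
  have pow: "mvar i ^ m = Poly_Mapping.single (Poly_Mapping.single i m) (1::real)" for i :: 'a and m
    by (induction m) (simp_all add: mvar_def mult_single single_add[symmetric])
  have "(\<Prod>i\<in>A. Poly_Mapping.single (f i) (1::real)) = Poly_Mapping.single (\<Sum>i\<in>A. f i) 1"
    if "finite A" for A and f :: "'a \<Rightarrow> ('a \<Rightarrow>\<^sub>0 nat)"
    using that by induction (simp_all add: mult_single)
  then show ?thesis by (simp add: mon_def pow monomial_expand)
qed

lemma psubst_mon: "psubst \<phi> (mon \<psi> a) = mon (\<lambda>i. psubst \<phi> (\<psi> i)) a"
proof -
  have "psubst \<phi> (prod f A) = (\<Prod>x\<in>A. psubst \<phi> (f x))" for f and A :: "'c set"
    by (induction A rule: infinite_finite_induct) (simp_all add: psubst.insertion_mult)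
  moreover have "psubst \<phi> (p ^ m) = psubst \<phi> p ^ m" for p m
    by (induction m) (simp_all add: psubst.insertion_mult)
  ultimately show ?thesis by (simp add: mon_def)
qed

lemma psubst_psubst: "psubst \<phi> (psubst \<psi> p) = psubst (\<lambda>i. psubst \<phi> (\<psi> i)) p"
  by (induction p rule: mpoly_induct)
    (simp_all add: psubst.insertion_single psubst.insertion_mult
      psubst.insertion_mconst psubst_mon psubst.insertion_add)

lemma mon_cong: "(\<And>i. i \<in> keys a \<Longrightarrow> f i = g i) \<Longrightarrow> mon f a = mon g a"
  by (simp add: mon_def)

lemma psubst_id:
  assumes "p \<in> operators M" "\<And>i. i \<in> M \<Longrightarrow> \<phi> i = mvar i"
  shows "psubst \<phi> p = p"
proof -
  have "psubst \<phi> p = (\<Sum>a\<in>keys p. Poly_Mapping.single a (lookup p a))"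
    unfolding insertion_def
  proof (intro sum.cong refl)
    fix a assume "a \<in> keys p"
    then have "mon \<phi> a = mon mvar a" using assms by (intro mon_cong) (auto simp: operators_def)
    then show "mconst (lookup p a) * mon \<phi> a = Poly_Mapping.single a (lookup p a)"
      by (simp add: mon_mvar mconst_def mult_single)
  qed
  then show ?thesis using mpoly_expand[of p] by simp
qed

lemma psubst_hom_operators:
  assumes \<phi>: "\<And>i. i \<in> M \<Longrightarrow> \<phi> i \<in> hom_operators M' 1" and p: "p \<in> hom_operators M d"
  shows "psubst \<phi> p \<in> hom_operators M' d"
proof -
  have pow: "\<phi> i ^ m \<in> hom_operators M' m" if "i \<in> M" for i m
    using hom_operators_mult[OF \<phi>[OF that], of _ ] by (induction m) auto
  have "(\<Prod>i\<in>A. \<phi> i ^ f i) \<in> hom_operators M' (\<Sum>i\<in>A. f i)" if "finite A" "A \<subseteq> M" for A f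
    using that by induction (auto intro: hom_operators_mult pow)
  then have "mon \<phi> a \<in> hom_operators M' (mdeg a)" if "keys a \<subseteq> M" for a
    unfolding mon_def mdeg_def using that by simp
  then have "mon \<phi> a \<in> hom_operators M' d" if "a \<in> keys p" for a
    using that p by (auto simp: hom_operators_def operators_def)
  then show ?thesis
    unfolding insertion_def by (intro hom_operators_sum hom_operators_mconst_mult)
qed

lemma psubst_hom_operators_onto:
  assumes \<phi>: "\<And>i. i \<in> M \<Longrightarrow> \<phi> i \<in> hom_operators M' 1"
    and onto: "\<And>j. j \<in> M' \<Longrightarrow> \<exists>i\<in>M. \<phi> i = mvar j"
  shows "psubst \<phi> ` hom_operators M d = hom_operators M' d"
proof
  show "psubst \<phi> ` hom_operators M d \<subseteq> hom_operators M' d"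
    using psubst_hom_operators[of M \<phi> M'] \<phi> by blast
  show "hom_operators M' d \<subseteq> psubst \<phi> ` hom_operators M d"
  proof
    fix p assume p: "p \<in> hom_operators M' d"
    \<comment> \<open>Choosing a variable over each variable of \<open>M'\<close> gives a right
      inverse of \<open>psubst \<phi>\<close> that preserves degrees.\<close>
    obtain s where s: "\<And>j. j \<in> M' \<Longrightarrow> s j \<in> M \<and> \<phi> (s j) = mvar j" using onto by metis
    have "psubst (\<lambda>j. mvar (s j)) p \<in> hom_operators M d"
      by (rule psubst_hom_operators[OF _ p]) (use s in auto)
    moreover have "psubst \<phi> (psubst (\<lambda>j. mvar (s j)) p) = p"
      unfolding psubst_psubst
      by (rule psubst_id[OF hom_operatorsD[OF p]]) (simp add: psubst.insertion_mvar s)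
    ultimately show "p \<in> psubst \<phi> ` hom_operators M d" by (metis imageI)
  qed
qed

subsection \<open>Annihilators of functionals\<close>

text \<open>If \<open>\<Theta> p = p f\<close> for a homogeneous polynomial \<open>f\<close> of degree \<open>n\<close> and all operators \<open>p\<close> of degree
  \<open>n\<close>, then \<open>annih M n \<Theta> d\<close> is the degree \<open>d\<close> part of the annihilator of \<open>f\<close>.\<close>

definition functional :: "('a mpoly \<Rightarrow> real) \<Rightarrow> bool" where
  "functional \<Theta> \<longleftrightarrow> (\<forall>p q. \<Theta> (p + q) = \<Theta> p + \<Theta> q) \<and> (\<forall>c p. \<Theta> (mconst c * p) = c * \<Theta> p)"

definition annih :: "'a set \<Rightarrow> nat \<Rightarrow> ('a mpoly \<Rightarrow> real) \<Rightarrow> nat \<Rightarrow> 'a mpoly set" where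
  "annih M n \<Theta> d =
     {D \<in> hom_operators M d. \<forall>m E. d + m = n \<longrightarrow> E \<in> hom_operators M m \<longrightarrow> \<Theta> (D * E) = 0}"

lemma functional_0: "functional \<Theta> \<Longrightarrow> \<Theta> 0 = 0"
  by (metis functional_def mconst_simps(4) mult_zero_left)

lemma poly_subspace_annih: "functional \<Theta> \<Longrightarrow> poly_subspace (annih M n \<Theta> d)"
  using functional_0[of \<Theta>]
  by (auto simp: poly_subspace_def annih_def functional_def hom_operators_add
      hom_operators_mconst_mult distrib_right mult.assoc)

lemma annih_subset: "annih M n \<Theta> d \<subseteq> hom_operators M d"
  by (auto simp: annih_def)

text \<open>The operators whose product with a variable has degree \<open>d\<close>; for \<open>d = 0\<close> only zero.\<close>

definition pred_operators :: "'a set \<Rightarrow> nat \<Rightarrow> 'a mpoly set" where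
  "pred_operators M d = (case d of 0 \<Rightarrow> {0} | Suc e \<Rightarrow> hom_operators M e)"

lemma pred_operators:
  assumes "finite M"
  shows "poly_subspace (pred_operators M d)" "poly_fin_dim (pred_operators M d)"
    and "i \<in> M \<Longrightarrow> p \<in> pred_operators M d \<Longrightarrow> mvar i * p \<in> hom_operators M d"
proof -
  have 0: "poly_subspace {0 :: 'a mpoly}" by (simp add: poly_subspace_def)
  have "poly_fin_dim {0 :: 'a mpoly}"
    by (rule poly_fin_dim_subset[OF poly_subspace_hom_operators 0 _ poly_fin_dim_hom_operators[OF assms]])
      simp
  then show "poly_subspace (pred_operators M d)" "poly_fin_dim (pred_operators M d)"
    using 0 poly_subspace_hom_operators poly_fin_dim_hom_operators[OF assms]
    by (auto simp: pred_operators_def split: nat.split)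
  show "mvar i * p \<in> hom_operators M d" if "i \<in> M" "p \<in> pred_operators M d"
    using that hom_operators_mult[of "mvar i" M 1 p]
    by (auto simp: pred_operators_def split: nat.splits)
qed

lemma annih_dim_sum:
  fixes M :: "'a set"
  assumes M: "finite M" and i: "i \<in> M" and \<Theta>: "functional \<Theta>"
  shows "poly_dim {a + mvar i * b | a b. a \<in> annih M n \<Theta> d \<and> b \<in> pred_operators M d} +
      poly_dim {b \<in> pred_operators M d. mvar i * b \<in> annih M n \<Theta> d} =
    poly_dim (annih M n \<Theta> d) + poly_dim (pred_operators M d)"
proof -
  let ?V = "hom_operators M d"
  \<comment> \<open>The annihilator is presented as the kernel of the map sending \<open>D\<close>
    to the functional \<open>\<Theta> (D * E)\<close> of \<open>E\<close>. Setting this functional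
    to 0 outside the complementary degree makes its values functions on all polynomials, with
    pointwise operations.\<close>
  define q where "q D E = (if \<exists>m. d + m = n \<and> E \<in> hom_operators M m then \<Theta> (D * E) else 0)"
    for D E
  define W :: "(real, 'a mpoly \<Rightarrow> real) module" where
    "W = \<lparr>carrier = q ` ?V, mult = (\<lambda>f g. f), one = (\<lambda>_. 0), zero = (\<lambda>_. 0),
      add = (\<lambda>f g E. f E + g E), smult = (\<lambda>c f E. c * f E)\<rparr>"
  have q: "q 0 = (\<lambda>_. 0)" "(\<lambda>E. q p E + q p' E) = q (p + p')" "(\<lambda>E. c * q p E) = q (mconst c * p)"
    for p p' c
    using \<Theta> functional_0[OF \<Theta>]
    by (auto simp: q_def functional_def distrib_right mult.assoc fun_eq_iff)
  have W: "vectorspace class_ring W"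
    by (rule vectorspace_image[OF poly_subspace_hom_operators, of _ q M d]) (simp_all add: W_def q)
  have lin: "poly_linear ?V W q"
    by (simp add: poly_linear_def W_def q)
  have "{p \<in> ?V. q p = \<zero>\<^bsub>W\<^esub>} = annih M n \<Theta> d"
    by (auto simp: annih_def q_def W_def fun_eq_iff)
  then show ?thesis
    using poly_dim_kernel_sum[OF poly_subspace_hom_operators poly_fin_dim_hom_operators[OF M] W lin
        pred_operators(1,2)[OF M], where m = "\<lambda>p. mvar i * p"] pred_operators(3)[OF M i]
    by (simp add: distrib_left mult.left_commute)
qed

text \<open>An operator on \<open>M\<close> annihilates the pulled back functional exactly when its
  image under the substitution annihilates the volume polynomial: surjectivity in each degree
  provides preimages for all test operators on \<open>M'\<close>.\<close>

lemma component_dim_annih: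
  assumes fan: "multi_fan n M' w l" and v: "generic_vector n w l v" and M: "finite M"
    and \<phi>: "\<And>i. i \<in> M \<Longrightarrow> \<phi> i \<in> hom_operators M' 1" "\<And>j. j \<in> M' \<Longrightarrow> \<exists>i\<in>M. \<phi> i = mvar j"
  shows "component_dim n M' w l d +
    poly_dim (annih M n (\<lambda>p. moment n M' w l v (psubst \<phi> p)) d) = poly_dim (hom_operators M d)"
proof -
  note onto = psubst_hom_operators_onto[of M \<phi> M', OF \<phi>]
  have "{p \<in> hom_operators M d. psubst \<phi> p \<in> annihilator n M' w l} =
      annih M n (\<lambda>p. moment n M' w l v (psubst \<phi> p)) d"
  proof (intro equalityI subsetI CollectI conjI)
    fix p assume p: "p \<in> {p \<in> hom_operators M d. psubst \<phi> p \<in> annihilator n M' w l}"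
    then have "psubst \<phi> p \<in> hom_operators M' d" using onto by blast
    from hom_annihilator_iff[OF fan v this] p onto
    show "p \<in> annih M n (\<lambda>p. moment n M' w l v (psubst \<phi> p)) d"
      by (auto simp: annih_def psubst.insertion_mult)
  next
    fix p assume p: "p \<in> annih M n (\<lambda>p. moment n M' w l v (psubst \<phi> p)) d"
    then show ph: "p \<in> hom_operators M d" by (simp add: annih_def)
    then have "psubst \<phi> p \<in> hom_operators M' d" using onto by blast
    moreover have "moment n M' w l v (psubst \<phi> p * E) = 0"
      if E: "d + m = n" "E \<in> hom_operators M' m" for m E
    proof -
      obtain E' where "E' \<in> hom_operators M m" "E = psubst \<phi> E'" using onto[of m] E(2) by blast
      then show ?thesis using p E(1) by (auto simp: annih_def psubst.insertion_mult)
    qed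
    ultimately show "psubst \<phi> p \<in> annihilator n M' w l"
      using hom_annihilator_iff[OF fan v] by blast
  qed
  then show ?thesis
    using component_dim_rank_nullity[OF poly_subspace_hom_operators poly_fin_dim_hom_operators[OF M, of d],
        where \<phi> = "psubst \<phi>" and M = M' and d = d and n = n and w = w and l = l] onto[of d]
    by (simp add: psubst.insertion_add psubst.insertion_mult psubst.insertion_mconst)
qed

lemma functional_moment_psubst: "functional (\<lambda>p. moment n M w l v (psubst \<phi> p))"
  by (simp add: functional_def psubst.insertion_add psubst.insertion_mult psubst.insertion_mconst
      moment_add moment_mconst_mult)

lemma functional_moment: "functional (moment n M w l v)"
  by (simp add: functional_def moment_add moment_mconst_mult)

text \<open>The annihilator is a homogeneous ideal, so the witness of editability can be taken
  homogeneous.\<close>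

lemma editable_annih:
  assumes ed: "editable n M w l x y" and fan: "multi_fan n M w l" and v: "generic_vector n w l v"
    and D: "D \<in> hom_operators M d" "mvar x * D \<in> annihilator n M w l"
  shows "\<exists>E\<in>pred_operators M d. D - mvar y * E \<in> annih M n (moment n M w l v) d"
proof -
  have xy: "x \<in> M" "y \<in> M" using ed by (auto simp: editable_def suspension_shaped_def)
  obtain E where E: "E \<in> operators M" "D - E * mvar y \<in> annihilator n M w l"
    using editable_annihilator[OF ed hom_operatorsD[OF D(1)]] D(2) by (auto simp: mult.commute)
  define E' where "E' = (case d of 0 \<Rightarrow> 0 | Suc e \<Rightarrow> hpart e E)"
  have E': "E' \<in> pred_operators M d"
    using hpart_in_hom_operators[OF E(1)]
    by (auto simp: E'_def pred_operators_def split: nat.split)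
  have "hpart d (E * mvar y) = mvar y * E'"
  \<comment> \<open>In degree 0 the value 0 of \<open>E'\<close> is right because a multiple of a
    variable has no constant term.\<close>
  proof (cases d)
    case 0
    have "lookup (E * mvar y) a = 0" if "mdeg a = 0" for a
    proof -
      have "lookup a y = 0"
        using that by (cases "y \<in> keys a") (auto simp: mdeg_def not_in_keys_iff_lookup_eq_zero)
      then show ?thesis using lookup_mvar_mult[of y E a] by (simp add: mult.commute)
    qed
    then show ?thesis by (intro poly_mapping_eqI) (simp add: lookup_hpart 0 E'_def)
  next
    case (Suc e)
    then show ?thesis
      using hpart_mult_single[of "Poly_Mapping.single y 1" e E 1]
      by (simp add: E'_def mvar_def mult.commute)
  qed
  then have hp: "hpart d (D - E * mvar y) = D - mvar y * E'"
    using hpart_hom[OF D(1), of d] by (simp add: hpart_diff)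
  have mem: "D - mvar y * E' \<in> hom_operators M d"
    unfolding hp[symmetric] using E xy hom_operatorsD[OF D(1)]
    by (intro hpart_in_hom_operators) (simp add: annihilator_iff)
  have "moment n M w l v ((D - mvar y * E') * F) = 0"
    if "d + m = n" "F \<in> hom_operators M m" for m F
  proof -
    have "hpart n ((D - E * mvar y) * F) = hpart d (D - E * mvar y) * F"
    proof -
      have step: "hpart n (p * Poly_Mapping.single a r) = hpart d p * Poly_Mapping.single a r"
        if a: "mdeg a = m" for p :: "'a mpoly" and a r
        using hpart_mult_single[of a d p r] a \<open>d + m = n\<close> by (simp add: add.commute)
      have "hpart n (p * (\<Sum>a\<in>A. Poly_Mapping.single a (f a))) =
          hpart d p * (\<Sum>a\<in>A. Poly_Mapping.single a (f a))"
        if A: "finite A" "\<forall>a\<in>A. mdeg a = m" for p :: "'a mpoly" and A and f :: "_ \<Rightarrow> real"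
        using A
      proof (induction A rule: finite_induct)
        case empty
        then show ?case by (simp add: hpart_def)
      next
        case (insert a A)
        then show ?case by (simp add: distrib_left hpart_add step)
      qed
      from this[of "keys F" "D - E * mvar y" "lookup F"] show ?thesis
        using mpoly_expand[of F] that(2) by (simp add: hom_operators_def)
    qed
    then show ?thesis
      using E(2) pairing_volume_polynomial[OF fan v, of "(D - E * mvar y) * F"] hp
      by (simp add: annihilator_iff)
  qed
  then show ?thesis using E' mem by (auto simp: annih_def)
qed

subsection \<open>The dimension count\<close>

lemma poly_subspace_sum_mult:
  assumes "poly_subspace N" "poly_subspace U"
  shows "poly_subspace {a + c * b | a b. a \<in> N \<and> b \<in> U}"
  unfolding poly_subspace_def
proof (intro conjI ballI allI)
  let ?S = "{a + c * b | a b. a \<in> N \<and> b \<in> U}"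
  show "0 \<in> ?S" using assms by (force simp: poly_subspace_def)
  show "p + r \<in> ?S" if pr: "p \<in> ?S" "r \<in> ?S" for p r
  proof -
    obtain a b a' b' where "p = a + c * b" "r = a' + c * b'" "a \<in> N" "b \<in> U" "a' \<in> N" "b' \<in> U"
      using pr by auto
    then have "p + r = (a + a') + c * (b + b')" "a + a' \<in> N" "b + b' \<in> U"
      using assms by (auto simp: poly_subspace_def algebra_simps)
    then show ?thesis by blast
  qed
  show "mconst t * p \<in> ?S" if p: "p \<in> ?S" for t p
  proof -
    obtain a b where "p = a + c * b" "a \<in> N" "b \<in> U" using p by auto
    then have "mconst t * p = mconst t * a + c * (mconst t * b)" "mconst t * a \<in> N" "mconst t * b \<in> U"
      using assms by (auto simp: poly_subspace_def algebra_simps)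
    then show ?thesis by blast
  qed
qed

lemma poly_subspace_mult_vimage:
  assumes "poly_subspace V" "poly_subspace N"
  shows "poly_subspace {p \<in> V. c * p \<in> N}"
  using assms unfolding poly_subspace_def
  by (auto simp: distrib_left mult.left_commute[of c "mconst t" for t])

text \<open>The three functionals are the pairings with \<open>V\<^sub>\<Delta>\<^sub>'\<close>, \<open>V\<^sub>\<Delta>\<^sub>'\<^sub>'\<close> and \<open>V\<^sub>T\<close>, and
  \<open>colon\<close> below is the annihilator of \<open>\<partial>\<^sub>x V\<^sub>\<Delta>\<^sub>'\<close>, that is, of \<open>\<partial>\<^sub>x V\<^sub>T\<close>.\<close>

locale edited_pair =
  fixes M :: "'a::linorder set" and n :: nat and x y :: 'a
    and \<Theta>x \<Theta>y \<Theta>T :: "'a mpoly \<Rightarrow> real"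
  assumes M: "finite M" "x \<in> M" "y \<in> M"
    and fl: "functional \<Theta>x" "functional \<Theta>y" "functional \<Theta>T"
    and ghost: "\<And>p. \<Theta>x (mvar y * p) = 0" "\<And>p. \<Theta>y (mvar x * p) = 0"
    and diff: "\<And>p. p \<in> hom_operators M n \<Longrightarrow> \<Theta>T p = 0 \<longleftrightarrow> \<Theta>x p = \<Theta>y p"
begin

text \<open>For this symmetry \<open>diff\<close> is stated as an equivalence: the equation of
  \<open>\<Theta>T\<close> with a difference would change its sign when \<open>x\<close> and
  \<open>y\<close> are exchanged.\<close>

lemma swapped: "edited_pair M n y x \<Theta>y \<Theta>x \<Theta>T"
  using M fl ghost diff by unfold_locales auto

definition colon :: "nat \<Rightarrow> 'a mpoly set" where
  "colon d = {D \<in> hom_operators M d. mvar x * D \<in> annih M n \<Theta>x (Suc d)}"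

text \<open>\<open>\<Theta>y\<close> vanishes on multiples of \<open>mvar x\<close>, so there
  \<open>\<Theta>T\<close> is zero exactly where \<open>\<Theta>x\<close> is.\<close>

lemma mult_annih_iff:
  assumes "D \<in> pred_operators M d"
  shows "mvar x * D \<in> annih M n \<Theta>T d \<longleftrightarrow> mvar x * D \<in> annih M n \<Theta>x d"
proof -
  have xD: "mvar x * D \<in> hom_operators M d" by (rule pred_operators(3)[OF M(1,2) assms])
  have "\<Theta>T (mvar x * D * E) = 0 \<longleftrightarrow> \<Theta>x (mvar x * D * E) = 0"
    if "d + m = n" "E \<in> hom_operators M m" for m E
  proof -
    have "mvar x * D * E \<in> hom_operators M n" using hom_operators_mult[OF xD that(2)] that(1) by simp
    then show ?thesis using diff ghost(2)[of "D * E"] by (simp add: mult.assoc)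
  qed
  then show ?thesis using xD by (auto simp: annih_def)
qed

lemma annih_subset_colon: "annih M n \<Theta>x d \<subseteq> colon d"
proof
  fix D assume D: "D \<in> annih M n \<Theta>x d"
  then have h: "D \<in> hom_operators M d" by (simp add: annih_def)
  have "\<Theta>x (mvar x * D * E) = 0" if "Suc d + m = n" "E \<in> hom_operators M m" for m E
  proof -
    have "mvar x * E \<in> hom_operators M (Suc m)"
      using hom_operators_mult[of "mvar x" M "Suc 0" E m] M that by simp
    moreover have "d + Suc m = n" using that by simp
    ultimately have "\<Theta>x (D * (mvar x * E)) = 0" using D unfolding annih_def by blast
    then show ?thesis by (simp only: mult_ac)
  qed
  then show "D \<in> colon d"
    using h hom_operators_mult[of "mvar x" M "Suc 0" D d] M by (auto simp: colon_def annih_def)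
qed

text \<open>The annihilator of \<open>V\<^sub>T\<close> is an ideal and agrees on multiples of
  \<open>\<partial>\<^sub>x\<close> with that of \<open>V\<^sub>\<Delta>\<^sub>'\<close>, while
  multiples of \<open>\<partial>\<^sub>y\<close> kill \<open>V\<^sub>\<Delta>\<^sub>'\<close>
  outright. Editability supplies the opposite inclusion.\<close>

lemma sum_subset_colon: "{a + mvar y * b | a b. a \<in> annih M n \<Theta>T d \<and> b \<in> pred_operators M d} \<subseteq> colon d"
proof
  fix D assume "D \<in> {a + mvar y * b | a b. a \<in> annih M n \<Theta>T d \<and> b \<in> pred_operators M d}"
  then obtain a b where ab: "D = a + mvar y * b" "a \<in> annih M n \<Theta>T d" "b \<in> pred_operators M d" by auto
  then have h: "a \<in> hom_operators M d" "mvar y * b \<in> hom_operators M d"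
    using pred_operators(3)[OF M(1,3)] by (auto simp: annih_def)
  then have D: "D \<in> hom_operators M d" using ab hom_operators_add by auto
  have xa: "mvar x * a \<in> annih M n \<Theta>T (Suc d)"
  proof -
    have "\<Theta>T (mvar x * a * E) = 0" if "Suc d + m = n" "E \<in> hom_operators M m" for m E
    proof -
      have "mvar x * E \<in> hom_operators M (Suc m)"
        using hom_operators_mult[of "mvar x" M "Suc 0" E m] M that by simp
      moreover have "d + Suc m = n" using that by simp
      ultimately have "\<Theta>T (a * (mvar x * E)) = 0" using ab(2) unfolding annih_def by blast
      then show ?thesis by (simp only: mult_ac)
    qed
    then show ?thesis
      using h hom_operators_mult[of "mvar x" M "Suc 0" a d] M by (auto simp: annih_def)
  qed
  then have xa': "mvar x * a \<in> annih M n \<Theta>x (Suc d)"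
    using mult_annih_iff[of a "Suc d"] h by (simp add: pred_operators_def)
  moreover have "mvar x * (mvar y * b) \<in> annih M n \<Theta>x (Suc d)"
    using h(2) hom_operators_mult[of "mvar x" M "Suc 0" "mvar y * b" d] M
      ghost(1)[of "mvar x * (b * E)" for E]
    by (auto simp: annih_def mult_ac)
  ultimately have "mvar x * a + mvar x * (mvar y * b) \<in> annih M n \<Theta>x (Suc d)"
    using poly_subspace_annih[OF fl(1)] by (simp add: poly_subspace_def)
  then show "D \<in> colon d" using D by (simp add: colon_def ab distrib_left)
qed

lemma sum_subset_swapped_sum:
  assumes colon: "colon d \<subseteq> {a + mvar y * b | a b. a \<in> annih M n \<Theta>T d \<and> b \<in> pred_operators M d}"
  shows "{a + mvar x * b | a b. a \<in> annih M n \<Theta>x d \<and> b \<in> pred_operators M d} \<subseteq>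
    {a + mvar y * b | a b. a \<in> annih M n \<Theta>y d \<and> b \<in> pred_operators M d}"
proof
  fix D assume "D \<in> {a + mvar x * b | a b. a \<in> annih M n \<Theta>x d \<and> b \<in> pred_operators M d}"
  then obtain a b where ab: "D = a + mvar x * b" "a \<in> annih M n \<Theta>x d" "b \<in> pred_operators M d" by auto
  then have "a \<in> colon d" using annih_subset_colon by blast
  then obtain e c where ec: "a = e + mvar y * c" "e \<in> annih M n \<Theta>T d" "c \<in> pred_operators M d"
    using colon by blast
  have "\<Theta>y (e * E) = 0" if E: "d + m = n" "E \<in> hom_operators M m" for m E
  proof -
    have "e * E \<in> hom_operators M n"
      using ec(2) E hom_operators_mult[of e M d E m] by (auto simp: annih_def)
    moreover have "\<Theta>T (e * E) = 0" using ec(2) E by (auto simp: annih_def)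
    ultimately have "\<Theta>y (e * E) = \<Theta>x (e * E)" using diff by simp
    moreover have "\<Theta>x (a * E) = \<Theta>x (e * E) + \<Theta>x (mvar y * (c * E))"
      using fl(1) by (simp add: ec functional_def distrib_right mult.assoc)
    moreover have "\<Theta>x (a * E) = 0" using ab(2) E by (auto simp: annih_def)
    ultimately show ?thesis using ghost(1) by simp
  qed
  then have e: "e \<in> annih M n \<Theta>y d" using ec(2) by (auto simp: annih_def)
  \<comment> \<open>The multiple of \<open>\<partial>\<^sub>x\<close> kills
    \<open>V\<^sub>\<Delta>\<^sub>'\<^sub>'\<close> and is absorbed into the annihilator summand, so
    that only the multiple of \<open>\<partial>\<^sub>y\<close> inside \<open>a\<close> is left
    over.\<close>
  have xb: "mvar x * b \<in> annih M n \<Theta>y d"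
    using pred_operators(3)[OF M(1,2) ab(3)] ghost(2) by (auto simp: annih_def mult.assoc)
  have "e + mvar x * b \<in> annih M n \<Theta>y d"
    using e xb poly_subspace_annih[OF fl(2)] by (simp add: poly_subspace_def)
  moreover have "D = (e + mvar x * b) + mvar y * c" using ab ec by simp
  ultimately show "D \<in> {a + mvar y * b | a b. a \<in> annih M n \<Theta>y d \<and> b \<in> pred_operators M d}"
    using ec(3) by blast
qed

lemma poly_subspace_colon: "poly_subspace (colon d)"
  unfolding colon_def
  by (rule poly_subspace_mult_vimage[OF poly_subspace_hom_operators poly_subspace_annih[OF fl(1)]])

lemma poly_fin_dim_colon: "poly_fin_dim (colon d)"
  by (rule poly_fin_dim_subset[OF poly_subspace_hom_operators poly_subspace_colon _
        poly_fin_dim_hom_operators[OF M(1)]]) (auto simp: colon_def)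

lemma pred_colon:
  "{b \<in> pred_operators M d. mvar x * b \<in> annih M n \<Theta>x d} =
    (case d of 0 \<Rightarrow> {0} | Suc e \<Rightarrow> colon e)"
proof -
  have "0 \<in> annih M n \<Theta>x 0"
    using poly_subspace_annih[OF fl(1)] by (simp add: poly_subspace_def)
  then show ?thesis by (auto simp: pred_operators_def colon_def split: nat.split)
qed

end

text \<open>By \<open>annih_dim_sum\<close> the dimension of N + (\<open>\<partial>\<^sub>x\<close>)
  in degree d is that of N plus that of the operators of degree d - 1, minus that of the colon ideal
  of \<open>\<partial>\<^sub>x\<close> in degree d - 1. For N the annihilator of
  \<open>V\<^sub>T\<close> the colon ideals of \<open>\<partial>\<^sub>x\<close> and
  \<open>\<partial>\<^sub>y\<close> have equal dimensions, hence so do N +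
  (\<open>\<partial>\<^sub>x\<close>) and N + (\<open>\<partial>\<^sub>y\<close>). The latter is the
  colon ideal of \<open>\<partial>\<^sub>x\<close>; so the former has the dimension of the colon
  ideal of \<open>\<partial>\<^sub>y\<close>, in which it is contained, and equals it. The same
  formula for the annihilators of the two fans concludes.\<close>

lemma (in edited_pair) annih_dim_eq:
  assumes colon_dim: "\<And>d. poly_dim (colon d) = poly_dim (edited_pair.colon M n y \<Theta>y d)"
    and editable: "\<And>d. colon d \<subseteq> {a + mvar y * b | a b. a \<in> annih M n \<Theta>T d \<and> b \<in> pred_operators M d}"
  shows "poly_dim (annih M n \<Theta>x d) = poly_dim (annih M n \<Theta>y d)"
proof -
  interpret yx: edited_pair M n y x \<Theta>y \<Theta>x \<Theta>T by (rule swapped)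
  let ?U = "pred_operators M d"
  let ?Sx = "\<lambda>\<Theta>. {a + mvar x * b | a b. a \<in> annih M n \<Theta> d \<and> b \<in> ?U}"
  let ?Sy = "\<lambda>\<Theta>. {a + mvar y * b | a b. a \<in> annih M n \<Theta> d \<and> b \<in> ?U}"
  let ?kx = "poly_dim {b \<in> ?U. mvar x * b \<in> annih M n \<Theta>x d}"
  let ?ky = "poly_dim {b \<in> ?U. mvar y * b \<in> annih M n \<Theta>y d}"
  have k: "?kx = ?ky"
    unfolding pred_colon yx.pred_colon using colon_dim by (simp split: nat.split)
  have "{b \<in> ?U. mvar x * b \<in> annih M n \<Theta>T d} = {b \<in> ?U. mvar x * b \<in> annih M n \<Theta>x d}"
    "{b \<in> ?U. mvar y * b \<in> annih M n \<Theta>T d} = {b \<in> ?U. mvar y * b \<in> annih M n \<Theta>y d}"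
    using mult_annih_iff yx.mult_annih_iff by blast+
  then have "poly_dim (?Sx \<Theta>T) = poly_dim (?Sy \<Theta>T)"
    using annih_dim_sum[OF M(1,2) fl(3), of n d] annih_dim_sum[OF M(1,3) fl(3), of n d] k by simp
  moreover have "?Sy \<Theta>T = colon d"
    using editable sum_subset_colon by blast
  ultimately have "poly_dim (?Sx \<Theta>T) = poly_dim (yx.colon d)"
    using colon_dim by simp
  then have "?Sx \<Theta>T = yx.colon d"
    using poly_subspace_sum_mult[OF poly_subspace_annih[OF fl(3)] pred_operators(1)[OF M(1)]]
    by (intro poly_subspace_eqI[OF yx.poly_subspace_colon _ yx.sum_subset_colon yx.poly_fin_dim_colon])
  then have "?Sy \<Theta>y \<subseteq> ?Sx \<Theta>x"
    by (intro yx.sum_subset_swapped_sum) simp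
  with sum_subset_swapped_sum[OF editable] have "?Sx \<Theta>x = ?Sy \<Theta>y" by (rule equalityI)
  then show ?thesis
    using annih_dim_sum[OF M(1,2) fl(1), of n d] annih_dim_sum[OF M(1,3) fl(2), of n d] k by simp
qed

subsection \<open>Renaming a vertex\<close>

lemma simplicial_cycle_mono:
  assumes w: "simplicial_cycle n M w" and "M \<subseteq> M'" "finite M'"
  shows "simplicial_cycle n M' w"
proof -
  have fin: "finite M" and supp: "\<And>I. w I \<noteq> 0 \<Longrightarrow> I \<subseteq> M \<and> card I = n"
    and bd: "\<And>J. J \<subseteq> M \<Longrightarrow> chain_boundary M w J = 0"
    using w by (auto simp: simplicial_cycle_def)
  have "chain_boundary M' w J = 0" for J
  proof (cases "J \<subseteq> M")
    case True
    have "chain_boundary M' w J = chain_boundary M w J"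
      unfolding chain_boundary_def
      using assms(2,3) supp by (intro sum.mono_neutral_right) auto
    then show ?thesis using bd True by simp
  next
    case False
    then have "w (insert i J) = 0" for i using supp by auto
    then show ?thesis by (simp add: chain_boundary_def)
  qed
  moreover have "I \<subseteq> M' \<and> card I = n" if "w I \<noteq> 0" for I using supp[OF that] assms(2) by blast
  ultimately show ?thesis using assms(3) by (simp add: simplicial_cycle_def)
qed

lemma vsign_square [simp]: "vsign i J * vsign i J = 1" "vsign i J * (vsign i J * r) = r"
  using vsign_cases[of i J] by auto

text \<open>At a face without \<open>x\<close> the boundary coefficient is that of \<open>w\<close>,
  with the term of \<open>x\<close> in place of the term of \<open>k\<close>. At a face containing
  \<open>x\<close> it is, up to sign, a boundary coefficient of the link of \<open>k\<close>, which
  is a cycle.\<close>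

lemma simplicial_cycle_rename_vertex:
  assumes w: "simplicial_cycle n S w" and k: "k \<in> S" and x: "x \<notin> S - {k}"
  shows "simplicial_cycle n (insert x (S - {k})) (rename_vertex k x w)"
proof -
  let ?M = "insert x (S - {k})" and ?R = "rename_vertex k x w"
  have fin: "finite S" and supp: "\<And>I. w I \<noteq> 0 \<Longrightarrow> I \<subseteq> S \<and> card I = n"
    and bd: "\<And>J. J \<subseteq> S \<Longrightarrow> chain_boundary S w J = 0"
    using w by (auto simp: simplicial_cycle_def)
  have link: "\<And>J. vertex_link k w J \<noteq> 0 \<Longrightarrow> J \<subseteq> S - {k} \<and> card (insert k J) = n"
    using supp by (auto simp: vertex_link_def split: if_splits)
  have lbd: "\<And>J. J \<subseteq> S - {k} \<Longrightarrow> chain_boundary (S - {k}) (vertex_link k w) J = 0"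
    using simplicial_cycle_vertex_link[OF w k] by (simp add: simplicial_cycle_def)
  have "I \<subseteq> ?M \<and> card I = n" if "?R I \<noteq> 0" for I
  proof (cases "x \<in> I")
    case True
    then have "vertex_link k w (I - {x}) \<noteq> 0" using that by (auto simp: rename_vertex_def)
    note l = link[OF this]
    then have "finite (I - {x})" using fin finite_subset by blast
    moreover have "k \<notin> I - {x}" using l by auto
    moreover have "Suc (card (I - {x})) = card I"
      using \<open>finite (I - {x})\<close> True by (intro card_Suc_Diff1) auto
    ultimately have "card I = n" using l by simp
    then show ?thesis using l True by auto
  next
    case False
    then show ?thesis using that supp by (fastforce simp: rename_vertex_def split: if_splits)
  qed
  moreover have "chain_boundary ?M ?R J = 0" if J: "J \<subseteq> ?M" for J
  proof (cases "x \<in> J")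
    case False
    then have JS: "J \<subseteq> S - {k}" using J by auto
    have "?M - J = insert x (S - {k} - J)" using False x by auto
    then have "chain_boundary ?M ?R J =
        vsign x J * ?R (insert x J) + (\<Sum>i\<in>S - {k} - J. vsign i J * ?R (insert i J))"
      unfolding chain_boundary_def using fin x by simp
    also have "vsign x J * ?R (insert x J) = vsign k J * w (insert k J)"
      using False JS by (auto simp: rename_vertex_def vertex_link_def)
    also have "(\<Sum>i\<in>S - {k} - J. vsign i J * ?R (insert i J)) =
        (\<Sum>i\<in>S - {k} - J. vsign i J * w (insert i J))"
      using False JS x by (intro sum.cong refl) (auto simp: rename_vertex_def)
    also have "vsign k J * w (insert k J) + \<dots> = chain_boundary S w J"
    proof -
      have "S - J = insert k (S - {k} - J)" using k JS by auto
      then show ?thesis unfolding chain_boundary_def using fin by simp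
    qed
    finally show ?thesis using bd JS by auto
  next
    case True
    define K where "K = J - {x}"
    have J': "J = insert x K" "x \<notin> K" "K \<subseteq> S - {k}" using True J by (auto simp: K_def)
    have fK: "finite K" using J'(3) fin finite_subset by blast
    have "?M - J = S - {k} - K" using J' x by auto
    then have "chain_boundary ?M ?R J =
        (\<Sum>i\<in>S - {k} - K. - vsign x K * (vsign i K * vertex_link k w (insert i K)))"
      unfolding chain_boundary_def
    proof (intro sum.cong)
      fix i assume i: "i \<in> S - {k} - K"
      then have ix: "i \<noteq> x" "i \<notin> K" using x by auto
      have e: "insert i J - {x} = insert i K" using J' ix by auto
      \<comment> \<open>Deleting \<open>i\<close> and \<open>x\<close> in the two possible orders
        gives opposite signs, since exactly one of them lies below the other.\<close>
      have "vsign i J * vsign x (insert i K) = - vsign x K * vsign i K"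
        unfolding J'(1) using ix J'(2) by (auto simp: vsign_insert[OF fK])
      then show "vsign i J * ?R (insert i J) = - vsign x K * (vsign i K * vertex_link k w (insert i K))"
        using True e by (simp add: rename_vertex_def flip: mult.assoc)
    qed
    also have "\<dots> = - vsign x K * chain_boundary (S - {k}) (vertex_link k w) K"
      by (simp add: chain_boundary_def sum_distrib_left)
    finally show ?thesis using lbd[OF J'(3)] by simp
  qed
  ultimately show ?thesis using fin by (auto simp: simplicial_cycle_def)
qed

lemma multi_fanI:
  assumes "simplicial_cycle n M w" "\<And>i. i \<in> M \<Longrightarrow> l i \<in> carrier_vec n"
    "\<And>I. w I \<noteq> 0 \<Longrightarrow> nondegenerate n l I"
  shows "multi_fan n M w l"
  using assms nondegenerate_iff_basis[of _ n l]
  unfolding multi_fan_def by (metis nondegenerate_def)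

lemma cone_matrix_cong: "finite I \<Longrightarrow> (\<And>i. i \<in> I \<Longrightarrow> l i = l' i) \<Longrightarrow> cone_matrix n l I = cone_matrix n l' I"
  unfolding cone_matrix_def by (intro arg_cong[where f = "mat_of_cols n"]) simp

lemma front_det_cong:
  "finite J \<Longrightarrow> (\<And>i. i \<in> J \<Longrightarrow> l i = l' i) \<Longrightarrow> front_det n l a J = front_det n l' a J"
  unfolding front_det_def by (intro arg_cong[where f = "\<lambda>xs. det (mat_of_cols n (a # xs))"]) simp

lemma coord_cong: "finite I \<Longrightarrow> (\<And>i. i \<in> I \<Longrightarrow> l i = l' i) \<Longrightarrow> coord n l I v = coord n l' I v"
  unfolding coord_def cone_coordinates_def using cone_matrix_cong[of I l l' n] by (intro ext) simp

lemma peval_cong: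
  assumes "p \<in> operators M" "\<And>i. i \<in> M \<Longrightarrow> z i = z' i"
  shows "peval z p = peval z' p"
proof -
  have "mon z a = mon z' a" if "a \<in> keys p" for a
    using that assms by (intro mon_cong) (auto simp: operators_def)
  then show ?thesis by (simp add: insertion_def)
qed

text \<open>\<open>x\<close> may be \<open>k\<close> itself, and \<open>k\<close> may also be reused
  as the other new point of \<open>M\<close>. Hence \<open>l\<close> and \<open>l'\<close> are
  compared only away from \<open>k\<close>, and the value of \<open>l'\<close> at \<open>k\<close>
  is found at \<open>x\<close>.\<close>

locale renamed_fan =
  fixes n :: nat and S M :: "'a::linorder set" and w :: "'a set \<Rightarrow> real"
    and k x :: 'a and l l' :: "'a \<Rightarrow> real vec"
  assumes fan: "multi_fan n S w l'" and k: "k \<in> S" and x: "x \<notin> S - {k}"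
    and M: "finite M" "insert x (S - {k}) \<subseteq> M"
    and l: "\<And>i. i \<in> S - {k} \<Longrightarrow> l i = l' i" "l x = l' k"
begin

lemma cycle: "simplicial_cycle n S w"
  using fan by (simp add: multi_fan_def)

definition rename :: "'a set \<Rightarrow> 'a set" where
  "rename I = (if k \<in> I then insert x (I - {k}) else I)"

text \<open>The sign built into the renamed weight is the one by which the determinant changes, so
  their quotient is preserved, and the coordinates of a vector move along with the vertices.\<close>

lemma rename_cone:
  assumes I: "w I \<noteq> 0"
  shows "nondegenerate n l (rename I)"
    and "rename_vertex k x w (rename I) / det (cone_matrix n l (rename I)) =
      w I / det (cone_matrix n l' I)"
    and "v \<in> carrier_vec n \<Longrightarrow> coord n l (rename I) v =
      (\<lambda>i. if i = x then coord n l' I v k else if i \<in> S - {k} then coord n l' I v i else 0)"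
proof -
  have nd: "nondegenerate n l' I" by (rule multi_fan_nondegenerate[OF fan I])
  then have fin: "finite I" "card I = n" "l' ` I \<subseteq> carrier_vec n" "det (cone_matrix n l' I) \<noteq> 0"
    by (auto simp: nondegenerate_def)
  have IS: "I \<subseteq> S" using cycle I by (auto simp: simplicial_cycle_def)
  have *: "nondegenerate n l (rename I) \<and>
    rename_vertex k x w (rename I) / det (cone_matrix n l (rename I)) = w I / det (cone_matrix n l' I) \<and>
    (v \<in> carrier_vec n \<longrightarrow> coord n l (rename I) v =
      (\<lambda>i. if i = x then coord n l' I v k else if i \<in> S - {k} then coord n l' I v i else 0))" for v
  proof (cases "k \<in> I")
    case False
    then have eq: "l i = l' i" if "i \<in> I" for i using l IS that by auto
    have xI: "x \<notin> I" using x IS False by auto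
    have c: "cone_matrix n l I = cone_matrix n l' I" using cone_matrix_cong[OF fin(1) eq] .
    moreover have cv: "coord n l I v = coord n l' I v" by (rule coord_cong[OF fin(1) eq])
    have "coord n l I v = (\<lambda>i. if i = x then coord n l' I v k
        else if i \<in> S - {k} then coord n l' I v i else 0)"
      by (rule trans[OF cv]) (use False xI IS in \<open>auto simp: coord_def fun_eq_iff\<close>)
    moreover have "l ` I = l' ` I" using eq by auto
    ultimately show ?thesis
      using False xI nd by (simp add: rename_def rename_vertex_def nondegenerate_def)
  next
    case True
    define J where "J = I - {k}"
    have J: "I = insert k J" "k \<notin> J" "finite J" "J \<subseteq> S - {k}" "x \<notin> J" "Suc (card J) = n"
      using True fin IS x card_Suc_Diff1[OF fin(1) True] by (auto simp: J_def simp del: card_Diff_insert)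
    have r: "rename I = insert x J" using True by (simp add: rename_def J_def)
    have eq: "l i = l' i" if "i \<in> J" for i using l J that by auto
    have fd: "front_det n l (l x) J = front_det n l' (l' k) J"
      unfolding l(2) by (rule front_det_cong[OF J(3) eq])
    have d: "det (cone_matrix n l (rename I)) = vsign x J * front_det n l' (l' k) J"
      unfolding r using det_cone_matrix_insert[OF J(3,5,6), of l] fd by simp
    have d': "det (cone_matrix n l' I) = vsign k J * front_det n l' (l' k) J"
      unfolding J(1) using det_cone_matrix_insert[OF J(3,2,6), of l'] .
    have vs: "vsign i J \<noteq> 0" for i by (simp add: vsign_def)
    have "l ` rename I = l' ` insert k J" unfolding r using eq l(2) by auto
    then have "l ` rename I = l' ` I" by (simp flip: J(1))
    then have nd': "nondegenerate n l (rename I)"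
      using fin d d' vs J(3,5,6) unfolding nondegenerate_def by (simp add: r)
    have "rename_vertex k x w (rename I) = vsign x J * (vsign k J * w I)"
      using J unfolding r by (simp add: rename_vertex_def vertex_link_def)
    then have q: "rename_vertex k x w (rename I) / det (cone_matrix n l (rename I)) =
        w I / det (cone_matrix n l' I)"
      unfolding d d' using vsign_cases[of x J] vsign_cases[of k J] by auto
    let ?z = "\<lambda>i. if i = x then coord n l' I v k else if i \<in> S - {k} then coord n l' I v i else 0"
    have "?z = coord n l (rename I) v" if v: "v \<in> carrier_vec n"
    proof (rule coord_unique[OF nd' v])
      show "?z i = 0" if "i \<notin> rename I" for i using that J(1) unfolding r by auto
      fix s assume s: "s < n"
      have "(\<Sum>i\<in>rename I. ?z i * l i $ s) = coord n l' I v k * l' k $ s + (\<Sum>i\<in>J. ?z i * l i $ s)"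
        unfolding r using J(3,5) l(2) by simp
      also have "(\<Sum>i\<in>J. ?z i * l i $ s) = (\<Sum>i\<in>J. coord n l' I v i * l' i $ s)"
        using J eq by (intro sum.cong) auto
      also have "coord n l' I v k * l' k $ s + \<dots> = v $ s"
        using coord_sum[OF nd v s] J by (simp add: J(1))
      finally show "v $ s = (\<Sum>i\<in>rename I. ?z i * l i $ s)" ..
    qed
    then show ?thesis using nd' q by auto
  qed
  then show "nondegenerate n l (rename I)"
    "rename_vertex k x w (rename I) / det (cone_matrix n l (rename I)) = w I / det (cone_matrix n l' I)"
    "v \<in> carrier_vec n \<Longrightarrow> coord n l (rename I) v =
      (\<lambda>i. if i = x then coord n l' I v k else if i \<in> S - {k} then coord n l' I v i else 0)"
    by blast+
qed

lemma rename_vertex_nonzero: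
  assumes "rename_vertex k x w I \<noteq> 0"
  shows "\<exists>I'\<in>Pow S. w I' \<noteq> 0 \<and> rename I' = I"
proof -
  have supp: "\<And>I. w I \<noteq> 0 \<Longrightarrow> I \<subseteq> S" using cycle by (auto simp: simplicial_cycle_def)
  show ?thesis
  proof (cases "x \<in> I")
    case True
    then have "w (insert k (I - {x})) \<noteq> 0" "k \<notin> I - {x}"
      using assms by (auto simp: rename_vertex_def vertex_link_def split: if_splits)
    moreover from this have "rename (insert k (I - {x})) = I" using True by (auto simp: rename_def)
    ultimately show ?thesis using supp by (intro bexI[of _ "insert k (I - {x})"]) auto
  next
    case False
    then have "w I \<noteq> 0" "k \<notin> I" using assms by (auto simp: rename_vertex_def split: if_splits)
    then show ?thesis using supp by (intro bexI[of _ I]) (auto simp: rename_def)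
  qed
qed

lemma multi_fan_rename:
  assumes "\<And>i. i \<in> M \<Longrightarrow> l i \<in> carrier_vec n"
  shows "multi_fan n M (rename_vertex k x w) l"
proof (rule multi_fanI)
  show "simplicial_cycle n M (rename_vertex k x w)"
    by (rule simplicial_cycle_mono[OF simplicial_cycle_rename_vertex[OF cycle k x] M(2,1)])
  show "nondegenerate n l I" if "rename_vertex k x w I \<noteq> 0" for I
    using rename_vertex_nonzero[OF that] rename_cone(1) by blast
qed (rule assms)

text \<open>Renaming is injective on simplices and preserves cone weights. The substitution accounts
  for the moved coordinate, and sends the remaining variables of \<open>M\<close> to 0 because their
  coordinates vanish on every cone of the renamed fan.\<close>

lemma moment_rename:
  assumes v: "v \<in> carrier_vec n" and p: "p \<in> operators M"
    and \<phi>: "\<phi> x = mvar k" "\<And>i. i \<in> S - {k} \<Longrightarrow> \<phi> i = mvar i"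
      "\<And>i. i \<in> M - insert x (S - {k}) \<Longrightarrow> \<phi> i = 0"
  shows "moment n M (rename_vertex k x w) l v p = moment n S w l' v (psubst \<phi> p)"
proof -
  let ?R = "rename_vertex k x w"
  have S: "finite S" using cycle by (simp add: simplicial_cycle_def)
  have inj: "inj_on rename (Pow S)"
    by (rule inj_on_inverseI[of _ "\<lambda>J. if x \<in> J then insert k (J - {x}) else J"])
      (use x in \<open>auto simp: rename_def\<close>)
  have im: "rename ` Pow S \<subseteq> Pow M" using M(2) by (auto simp: rename_def split: if_splits)
  have "moment n M ?R l v p =
      (\<Sum>I\<in>rename ` Pow S. cone_weight n ?R l v I * peval (coord n l I v) p)"
    unfolding moment_def
  proof (rule sum.mono_neutral_right)
    show "\<forall>I\<in>Pow M - rename ` Pow S. cone_weight n ?R l v I * peval (coord n l I v) p = 0"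
      using rename_vertex_nonzero by (fastforce simp: cone_weight_def)
  qed (use M im in auto)
  also have "\<dots> = (\<Sum>I\<in>Pow S. cone_weight n ?R l v (rename I) * peval (coord n l (rename I) v) p)"
    using inj by (simp add: sum.reindex)
  also have "\<dots> = (\<Sum>I\<in>Pow S. cone_weight n w l' v I * peval (coord n l' I v) (psubst \<phi> p))"
  proof (intro sum.cong refl)
    fix I assume IS: "I \<in> Pow S"
    show "cone_weight n ?R l v (rename I) * peval (coord n l (rename I) v) p =
        cone_weight n w l' v I * peval (coord n l' I v) (psubst \<phi> p)"
    proof (cases "w I = 0")
      case True
      have "?R (rename I) = 0"
      proof (rule ccontr)
        assume "?R (rename I) \<noteq> 0"
        then obtain I' where "I' \<in> Pow S" "w I' \<noteq> 0" "rename I' = rename I"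
          using rename_vertex_nonzero by blast
        then show False using inj_onD[OF inj] IS True by blast
      qed
      then show ?thesis using True by (simp add: cone_weight_def)
    next
      case False
      note rc = rename_cone[OF False]
      have fin: "finite I" using IS S finite_subset by auto
      have "(\<Prod>i\<in>rename I. coord n l (rename I) v i) = (\<Prod>i\<in>I. coord n l' I v i)"
      proof (cases "k \<in> I")
        case True
        have "x \<notin> I - {k}" using IS x by auto
        then have "(\<Prod>i\<in>rename I. coord n l (rename I) v i) =
            coord n l' I v k * (\<Prod>i\<in>I - {k}. coord n l (rename I) v i)"
          using True fin rc(3)[OF v] by (simp add: rename_def)
        also have "(\<Prod>i\<in>I - {k}. coord n l (rename I) v i) = (\<Prod>i\<in>I - {k}. coord n l' I v i)"
          using IS x by (intro prod.cong) (auto simp: rc(3)[OF v])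
        also have "coord n l' I v k * \<dots> = (\<Prod>i\<in>I. coord n l' I v i)"
          using fin True by (simp add: prod.remove)
        finally show ?thesis .
      next
        case False
        then have ri: "rename I = I" and "x \<notin> I" using IS x by (auto simp: rename_def)
        have "coord n l I v i = coord n l' I v i" if "i \<in> I" for i
          using IS False \<open>x \<notin> I\<close> that fun_cong[OF rc(3)[OF v, unfolded ri], of i] by auto
        then show ?thesis unfolding ri by simp
      qed
      then have "cone_weight n ?R l v (rename I) = cone_weight n w l' v I"
        unfolding cone_weight_def using rc(2) by (metis divide_divide_eq_left)
      moreover have "peval (coord n l (rename I) v) p = peval (coord n l' I v) (psubst \<phi> p)"
        unfolding peval_psubst
      proof (rule peval_cong[OF p])
        fix i assume "i \<in> M"
        then show "coord n l (rename I) v i = peval (coord n l' I v) (\<phi> i)"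
          unfolding rc(3)[OF v] using \<phi> by (auto simp: peval_mvar)
      qed
      ultimately show ?thesis by simp
    qed
  qed
  finally show ?thesis by (simp add: moment_def)
qed

end

lemma multi_fan_diff:
  assumes "multi_fan n M w l" "multi_fan n M w' l"
  shows "multi_fan n M (\<lambda>I. w' I - w I) l"
proof (rule multi_fanI)
  have c: "simplicial_cycle n M w" "simplicial_cycle n M w'" using assms by (auto simp: multi_fan_def)
  have "chain_boundary M (\<lambda>I. w' I - w I) J = chain_boundary M w' J - chain_boundary M w J" for J
    by (simp add: chain_boundary_def right_diff_distrib sum_subtractf)
  then show "simplicial_cycle n M (\<lambda>I. w' I - w I)"
    using c unfolding simplicial_cycle_def by (metis diff_zero diff_self)
  show "nondegenerate n l I" if "w' I - w I \<noteq> 0" for I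
  proof -
    have "w I \<noteq> 0 \<or> w' I \<noteq> 0" using that by auto
    then show ?thesis using multi_fan_nondegenerate assms by blast
  qed
qed (use assms in \<open>auto simp: multi_fan_def\<close>)

lemma moment_diff:
  "moment n M (\<lambda>I. w' I - w I) l v p = moment n M w' l v p - moment n M w l v p"
  by (simp add: moment_def cone_weight_def diff_divide_distrib left_diff_distrib sum_subtractf)

subsection \<open>The link of a vertex\<close>

lemma coord_linear:
  assumes I0: "nondegenerate n l I0" and v: "v \<in> carrier_vec n"
    and l: "\<And>i. i \<in> I \<Longrightarrow> l i \<in> carrier_vec n"
    and z: "\<And>r. r < n \<Longrightarrow> v $ r = (\<Sum>i\<in>I. z i * l i $ r)"
  shows "coord n l I0 v j = (\<Sum>i\<in>I. z i * coord n l I0 (l i) j)"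
proof -
  obtain H where H: "\<forall>v\<in>carrier_vec n. coord n l I0 v j = (\<Sum>r<n. H r * v $ r)"
    using coord_functional[OF I0, of j] by auto
  have "coord n l I0 v j = (\<Sum>r<n. \<Sum>i\<in>I. H r * (z i * l i $ r))"
    using H v z by (simp add: sum_distrib_left)
  also have "\<dots> = (\<Sum>i\<in>I. \<Sum>r<n. H r * (z i * l i $ r))" by (rule sum.swap)
  also have "\<dots> = (\<Sum>i\<in>I. z i * (\<Sum>r<n. H r * l i $ r))"
    by (simp add: sum_distrib_left mult_ac)
  also have "\<dots> = (\<Sum>i\<in>I. z i * coord n l I0 (l i) j)"
    using H l by (intro sum.cong) auto
  finally show ?thesis .
qed

text \<open>The projection along \<open>l k\<close>, in the basis given by the remaining generators of the cone \<open>I0\<close>.\<close>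

definition link_fun ::
    "nat \<Rightarrow> ('a::linorder \<Rightarrow> real vec) \<Rightarrow> 'a set \<Rightarrow> 'a \<Rightarrow> real vec \<Rightarrow> real vec" where
  "link_fun n l I0 k a =
     vec (n - 1) (\<lambda>r. coord n l I0 a (sorted_list_of_set (I0 - {k}) ! r))"

text \<open>In the basis formed by \<open>l k\<close> and the other generators of \<open>I0\<close>,
  the column \<open>l k\<close> becomes the first unit vector. The determinant is then that of the
  lower right block, the matrix of the projected generators of \<open>J\<close>; the base change
  contributes a factor independent of \<open>J\<close>.\<close>

lemma front_det_link:
  fixes l :: "'a::linorder \<Rightarrow> real vec"
  assumes I0: "nondegenerate n l I0" "k \<in> I0" and J: "finite J" "Suc (card J) = n"
    and l: "l ` J \<subseteq> carrier_vec n"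
  shows "front_det n l (l k) J =
    front_det n l (l k) (I0 - {k}) * det (cone_matrix (n - 1) (\<lambda>i. link_fun n l I0 k (l i)) J)"
proof -
  let ?t = "sorted_list_of_set (I0 - {k})" and ?s = "sorted_list_of_set J"
  let ?xs = "k # ?t" and ?as = "l k # map l (sorted_list_of_set J)"
  let ?A = "mat_of_cols n (map l ?xs)" and ?B = "mat_of_cols n ?as"
  let ?D = "cone_matrix (n - 1) (\<lambda>i. link_fun n l I0 k (l i)) J"
  define C where "C = mat n n (\<lambda>(r, c). coord n l I0 (?as ! c) (?xs ! r))"
  have fin: "finite I0" "card I0 = n" "l ` I0 \<subseteq> carrier_vec n" using I0 by (auto simp: nondegenerate_def)
  have c0: "Suc (card (I0 - {k})) = n" using card_Suc_Diff1[OF fin(1) I0(2)] fin(2) by simp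
  have len: "length ?xs = n" "length ?as = n" using c0 J by auto
  have set_xs: "set ?xs = I0" "distinct ?xs" using fin I0(2) by auto
  have car: "?as ! c \<in> carrier_vec n" if "c < n" for c
    using that len(2) l fin(3) I0(2) J(1) nth_mem[of c ?as] by auto
  have A: "?A \<in> carrier_mat n n" using mat_of_cols_carrier(1)[of n "map l ?xs"] len(1) by simp
  have C: "C \<in> carrier_mat n n" by (simp add: C_def)
  have "?A * C = ?B"
  proof (rule eq_matI)
    fix r c assume "r < dim_row ?B" "c < dim_col ?B"
    then have rc: "r < n" "c < n" using len(2) by auto
    have "col C c = vec (length ?xs) (\<lambda>j. coord n l I0 (?as ! c) (?xs ! j))"
      using rc len(1) by (intro eq_vecI) (auto simp: C_def)
    then have "(?A * C) $$ (r, c) = (?A *\<^sub>v vec (length ?xs) (\<lambda>j. coord n l I0 (?as ! c) (?xs ! j))) $ r"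
      using index_mult_mat(1)[of r ?A c C] index_mult_mat_vec[of r ?A "col C c"] carrier_matD[OF A] carrier_matD[OF C] rc
      by (simp only:)
    also have "\<dots> = (\<Sum>i\<in>I0. coord n l I0 (?as ! c) i * l i $ r)"
      using mat_of_cols_mult_vec[OF set_xs(2) rc(1), of l "coord n l I0 (?as ! c)"]
      unfolding set_xs(1) .
    also have "\<dots> = (?as ! c) $ r" using coord_sum[OF I0(1) car[OF rc(2)] rc(1)] ..
    also have "\<dots> = ?B $$ (r, c)" using rc len(2) by (subst mat_of_cols_index) auto
    finally show "(?A * C) $$ (r, c) = ?B $$ (r, c)" .
  qed (use A C len in \<open>auto simp: C_def\<close>)
  then have "det ?B = det ?A * det C" using det_mult[OF A C] by simp
  moreover have "det C = det ?D"
  proof -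
    let ?r = "mat 1 (n - 1) (\<lambda>(_, c). coord n l I0 (l (?s ! c)) k)"
    have D: "?D \<in> carrier_mat (n - 1) (n - 1)" using J by (intro cone_matrix_carrier) auto
    have "C = four_block_mat (1\<^sub>m 1) ?r (0\<^sub>m (n - 1) 1) ?D"
    proof (rule eq_matI)
      fix r c
      assume "r < dim_row (four_block_mat (1\<^sub>m 1) ?r (0\<^sub>m (n - 1) 1) ?D)"
        "c < dim_col (four_block_mat (1\<^sub>m 1) ?r (0\<^sub>m (n - 1) 1) ?D)"
      then have rc: "r < n" "c < n" using D J by auto
      have "?t ! (r - 1) \<in> I0 - {k}" if "r \<noteq> 0"
        using that rc c0 fin nth_mem[of "r - 1" ?t] by auto
      then have k': "?t ! (r - 1) \<noteq> k" if "r \<noteq> 0" using that by auto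
      have Drc: "?D $$ (r - 1, c - 1) = coord n l I0 (l (?s ! (c - 1))) (?t ! (r - 1))"
        if "r \<noteq> 0" "c \<noteq> 0"
        using that rc J unfolding cone_matrix_def
        by (subst mat_of_cols_index) (auto simp: link_fun_def)
      show "C $$ (r, c) = four_block_mat (1\<^sub>m 1) ?r (0\<^sub>m (n - 1) 1) ?D $$ (r, c)"
        using rc D J Drc k' coord_generator[OF I0(1,2)]
        by (subst index_mat_four_block) (auto simp: C_def nth_Cons')
    qed (use D J in \<open>auto simp: C_def\<close>)
    then show ?thesis
      using det_four_block_mat_lower_left_zero_col[of "1\<^sub>m 1" ?r "n - 1" "0\<^sub>m (n - 1) 1" ?D] D
      by simp
  qed
  ultimately show ?thesis by (simp add: front_det_def)
qed

lemma peval_hom_0: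
  assumes "p \<in> hom_operators M 0"
  shows "peval z p = peval z' p"
proof -
  have "mon z a = mon z' a" if "a \<in> keys p" for a
  proof -
    have "mdeg a = 0" using assms that by (auto simp: hom_operators_def)
    then have "\<forall>i\<in>keys a. lookup a i = 0" by (simp add: mdeg_def)
    then have "keys a = {}" by (meson equals0I in_keys_iff)
    then show ?thesis by (simp add: mon_def)
  qed
  then show ?thesis by (simp add: insertion_def)
qed

section \<open>Derivative at the renamed vertex and the multi-fan over the link\<close>

context renamed_fan
begin

text \<open>Undoes the renaming on variables. If \<open>k\<close> has been reused as the other new
  point, then \<open>mvar k\<close> goes to 0 as a ghost variable while \<open>mvar x\<close> goes
  to \<open>mvar k\<close>.\<close>

definition star_subst :: "'a \<Rightarrow> 'a mpoly" where
  "star_subst i = (if i = x then mvar k else if i \<in> S - {k} then mvar i else 0)"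

text \<open>The moment of the renamed fan, computed on the original vertex set; it gives access both
  to the algebra of the original fan and to the difference \<open>T\<close> on
  \<open>M\<close>.\<close>

definition star_functional :: "real vec \<Rightarrow> 'a mpoly \<Rightarrow> real" where
  "star_functional v p = moment n S w l' v (psubst star_subst p)"

lemma functional_star: "functional (star_functional v)"
  unfolding star_functional_def by (rule functional_moment_psubst)

text \<open>Evaluating \<open>mvar x\<close> inserts the coordinate at \<open>k\<close>, which is 0
  for cones without \<open>k\<close>. Only the star of \<open>k\<close> contributes.\<close>

lemma star_functional_mvar:
  "star_functional v (mvar x * p) =
    (\<Sum>J\<in>Pow (S - {k}). cone_weight n w l' v (insert k J) * coord n l' (insert k J) v k *
      peval (coord n l' (insert k J) v) (psubst star_subst p))"
proof -
  let ?f = "\<lambda>I. cone_weight n w l' v I * (coord n l' I v k * peval (coord n l' I v) (psubst star_subst p))"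
  have S: "finite S" using cycle by (simp add: simplicial_cycle_def)
  have "star_functional v (mvar x * p) = (\<Sum>I\<in>Pow S. ?f I)"
    by (simp add: star_functional_def moment_def psubst.insertion_mult psubst.insertion_mvar
        star_subst_def peval_mult peval_mvar)
  also have "\<dots> = (\<Sum>I\<in>insert k ` Pow (S - {k}). ?f I)"
  proof (rule sum.mono_neutral_right)
    show "\<forall>I\<in>Pow S - insert k ` Pow (S - {k}). ?f I = 0"
    proof
      fix I assume I: "I \<in> Pow S - insert k ` Pow (S - {k})"
      have "k \<notin> I"
      proof
        assume "k \<in> I"
        then have "I = insert k (I - {k})" "I - {k} \<in> Pow (S - {k})" using I by auto
        then show False using I by blast
      qed
      then show "?f I = 0" by simp
    qed
  qed (use S k in auto)
  also have "\<dots> = (\<Sum>J\<in>Pow (S - {k}). ?f (insert k J))"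
    by (subst sum.reindex) (auto simp: inj_on_def)
  finally show ?thesis by (simp add: mult.assoc)
qed

text \<open>Projection along \<open>l' k\<close> drops one generator of the cone over
  \<open>insert k J\<close> and turns the others into a basis, in which the projected
  \<open>v\<close> keeps its coordinates. \<open>I0\<close> fixes a basis of the quotient space, and
  its determinant becomes the common nonzero factor between determinants of cones and of their
  links.\<close>

lemma link_fan:
  assumes I0: "w I0 \<noteq> 0" "k \<in> I0"
  defines "m \<equiv> \<lambda>i. link_fun n l' I0 k (l' i)"
  shows "multi_fan (n - 1) (S - {k}) (vertex_link k w) m"
    and "v \<in> carrier_vec n \<Longrightarrow> vertex_link k w J \<noteq> 0 \<Longrightarrow>
      coord (n - 1) m J (link_fun n l' I0 k v) = (\<lambda>i. if i \<in> J then coord n l' (insert k J) v i else 0)"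
    and "vertex_link k w J \<noteq> 0 \<Longrightarrow>
      front_det n l' (l' k) J = front_det n l' (l' k) (I0 - {k}) * det (cone_matrix (n - 1) m J)"
    and "vertex_link k w J \<noteq> 0 \<Longrightarrow> k \<notin> J \<and> finite J \<and> Suc (card J) = n \<and> J \<subseteq> S - {k} \<and>
      nondegenerate n l' (insert k J)"
    and "front_det n l' (l' k) (I0 - {k}) \<noteq> 0"
proof -
  have nd0: "nondegenerate n l' I0" by (rule multi_fan_nondegenerate[OF fan I0(1)])
  have carS: "\<And>i. i \<in> S \<Longrightarrow> l' i \<in> carrier_vec n" using fan by (simp add: multi_fan_def)
  have link: "k \<notin> J \<and> finite J \<and> Suc (card J) = n \<and> J \<subseteq> S - {k} \<and> nondegenerate n l' (insert k J)"
    if "vertex_link k w J \<noteq> 0" for J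
  proof -
    have J: "k \<notin> J" "w (insert k J) \<noteq> 0" using that by (auto simp: vertex_link_def split: if_splits)
    note nd = multi_fan_nondegenerate[OF fan J(2)]
    moreover have "insert k J \<subseteq> S" using cycle J(2) by (auto simp: simplicial_cycle_def)
    ultimately show ?thesis using J(1) by (auto simp: nondegenerate_def)
  qed
  have fd: "front_det n l' (l' k) J = front_det n l' (l' k) (I0 - {k}) * det (cone_matrix (n - 1) m J)"
    if "vertex_link k w J \<noteq> 0" for J
    unfolding m_def
    by (rule front_det_link[OF nd0 I0(2)]) (use link[OF that] carS in auto)
  have fdn: "front_det n l' (l' k) J \<noteq> 0" if "vertex_link k w J \<noteq> 0" for J
  proof -
    note lk = link[OF that]
    have "det (cone_matrix n l' (insert k J)) = vsign k J * front_det n l' (l' k) J"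
      using det_cone_matrix_insert[of J k n l'] lk by blast
    then show ?thesis using lk by (auto simp: nondegenerate_def)
  qed
  have "vertex_link k w (I0 - {k}) \<noteq> 0"
    using I0 by (simp add: vertex_link_def insert_absorb vsign_def)
  then show fd0: "front_det n l' (l' k) (I0 - {k}) \<noteq> 0" by (rule fdn)
  have nd: "nondegenerate (n - 1) m J" if "vertex_link k w J \<noteq> 0" for J
    using link[OF that] fd[OF that] fdn[OF that]
    by (auto simp: nondegenerate_def m_def link_fun_def)
  show "multi_fan (n - 1) (S - {k}) (vertex_link k w) m"
    by (rule multi_fanI[OF simplicial_cycle_vertex_link[OF cycle k] _ nd])
      (auto simp: m_def link_fun_def)
  show "coord (n - 1) m J (link_fun n l' I0 k v) = (\<lambda>i. if i \<in> J then coord n l' (insert k J) v i else 0)"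
    if v: "v \<in> carrier_vec n" and J: "vertex_link k w J \<noteq> 0"
  proof -
    note lk = link[OF J]
    let ?z = "\<lambda>i. if i \<in> J then coord n l' (insert k J) v i else 0"
    let ?t = "sorted_list_of_set (I0 - {k})"
    have fin0: "finite I0" "card I0 = n" using nd0 by (auto simp: nondegenerate_def)
    have len0: "length ?t = n - 1" using fin0 I0(2) by simp
    have "?z = coord (n - 1) m J (link_fun n l' I0 k v)"
    proof (rule coord_unique[OF nd[OF J]])
      fix r assume r: "r < n - 1"
      have "?t ! r \<in> I0 - {k}" using nth_mem[of r ?t] len0 r fin0 by simp
      then have ne: "?t ! r \<noteq> k" by auto
      have "link_fun n l' I0 k v $ r = coord n l' I0 v (?t ! r)"
        using r by (simp add: link_fun_def)
      also have "\<dots> = (\<Sum>i\<in>insert k J. coord n l' (insert k J) v i * coord n l' I0 (l' i) (?t ! r))"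
      proof (rule coord_linear[OF nd0 v])
        show "l' i \<in> carrier_vec n" if "i \<in> insert k J" for i using that lk carS k by auto
        show "v $ s = (\<Sum>i\<in>insert k J. coord n l' (insert k J) v i * l' i $ s)" if "s < n" for s
          using coord_sum[OF _ v that] lk by blast
      qed
      also have "\<dots> = (\<Sum>i\<in>J. coord n l' (insert k J) v i * coord n l' I0 (l' i) (?t ! r))"
        using lk ne coord_generator[OF nd0 I0(2)] by simp
      also have "\<dots> = (\<Sum>i\<in>J. ?z i * m i $ r)"
        using r by (intro sum.cong) (auto simp: m_def link_fun_def)
      finally show "link_fun n l' I0 k v $ r = (\<Sum>i\<in>J. ?z i * m i $ r)" .
    qed (auto simp: link_fun_def)
    then show ?thesis by (rule sym)
  qed
  show "vertex_link k w J \<noteq> 0 \<Longrightarrow>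
      front_det n l' (l' k) J = front_det n l' (l' k) (I0 - {k}) * det (cone_matrix (n - 1) m J)"
    by (rule fd)
  show "vertex_link k w J \<noteq> 0 \<Longrightarrow> k \<notin> J \<and> finite J \<and> Suc (card J) = n \<and> J \<subseteq> S - {k} \<and>
      nondegenerate n l' (insert k J)" by (rule link)
qed

text \<open>\<open>f\<close> comes from a linear functional taking the value 1 at \<open>l' k\<close> and 0 at \<open>v\<close>.  In dimension one
  there is none, but there only operators of degree zero matter.\<close>

lemma height_function:
  assumes v: "generic_vector n w l' v" and I0: "w I0 \<noteq> 0" "k \<in> I0" and n: "2 \<le> n"
  shows "\<exists>f. \<forall>I. w I \<noteq> 0 \<longrightarrow> k \<in> I \<longrightarrow>
    coord n l' I v k = - (\<Sum>i\<in>I - {k}. f i * coord n l' I v i)"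
proof -
  have nd0: "nondegenerate n l' I0" by (rule multi_fan_nondegenerate[OF fan I0(1)])
  have g: "v \<in> carrier_vec n" "\<And>I i. w I \<noteq> 0 \<Longrightarrow> i \<in> I \<Longrightarrow> coord n l' I v i \<noteq> 0"
    using v generic_vector_iff[OF fan] by auto
  have "card (I0 - {k}) = n - 1" using nd0 I0(2) by (simp add: nondegenerate_def)
  then have "I0 - {k} \<noteq> {}" using n by (intro notI) simp
  then obtain j where j: "j \<in> I0" "j \<noteq> k" by auto
  \<comment> \<open>The coordinate at \<open>k\<close> is corrected by that at another vertex
    \<open>j\<close> of \<open>I0\<close>, which exists since \<open>n\<close> is at least 2.
    Genericity of \<open>v\<close> allows the division, and \<open>l' k\<close> has coordinate 0 at
    \<open>j\<close>, so the correction does not disturb the value 1.\<close>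
  define h where "h a = coord n l' I0 a k - coord n l' I0 v k / coord n l' I0 v j * coord n l' I0 a j" for a
  have hv: "h v = 0" using g(2)[OF I0(1) j(1)] by (simp add: h_def)
  have hk: "h (l' k) = 1" using coord_generator[OF nd0 I0(2)] j by (simp add: h_def)
  have "coord n l' I v k = - (\<Sum>i\<in>I - {k}. h (l' i) * coord n l' I v i)" if I: "w I \<noteq> 0" "k \<in> I" for I
  proof -
    note nd = multi_fan_nondegenerate[OF fan I(1)]
    then have fin: "finite I" "\<And>i. i \<in> I \<Longrightarrow> l' i \<in> carrier_vec n" by (auto simp: nondegenerate_def)
    have lin: "coord n l' I0 v q = (\<Sum>i\<in>I. coord n l' I v i * coord n l' I0 (l' i) q)" for q
      by (rule coord_linear[OF nd0 g(1) fin(2)]) (use coord_sum[OF nd g(1)] in auto)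
    let ?c = "coord n l' I0 v k / coord n l' I0 v j"
    have "h v = coord n l' I0 v k - ?c * coord n l' I0 v j" by (simp add: h_def)
    also have "\<dots> = (\<Sum>i\<in>I. coord n l' I v i * coord n l' I0 (l' i) k) -
        ?c * (\<Sum>i\<in>I. coord n l' I v i * coord n l' I0 (l' i) j)"
      by (simp only: lin[symmetric])
    also have "\<dots> = (\<Sum>i\<in>I. coord n l' I v i * h (l' i))"
      unfolding h_def sum_distrib_left right_diff_distrib sum_subtractf by (simp add: mult.left_commute)
    also have "\<dots> = coord n l' I v k * h (l' k) + (\<Sum>i\<in>I - {k}. coord n l' I v i * h (l' i))"
      by (rule sum.remove[OF fin(1) I(2)])
    finally show ?thesis using hv hk by (simp add: mult.commute)
  qed
  then show ?thesis by (intro exI[of _ "\<lambda>i. h (l' i)"]) blast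
qed

text \<open>\<open>\<delta>\<close> is the factor of \<open>front_det_link\<close>: it compares the
  weight of a link simplex with that of the cone over it, once \<open>mvar x\<close> has cancelled
  the coordinate at \<open>k\<close> in the denominator. \<open>\<phi>\<close> replaces the variable
  \<open>x\<close> by a linear form in the link variables whose value on each cone of the star is
  that coordinate; the other variables outside the link go to 0.\<close>

lemma link_functional:
  assumes v: "generic_vector n w l' v" and I0: "w I0 \<noteq> 0" "k \<in> I0"
  defines "m \<equiv> \<lambda>i. link_fun n l' I0 k (l' i)"
  shows "\<exists>\<delta> \<phi>. \<delta> \<noteq> 0 \<and> (\<forall>i\<in>M. \<phi> i \<in> hom_operators (S - {k}) 1) \<and>
    (\<forall>j\<in>S - {k}. \<phi> j = mvar j) \<and>
    (\<forall>p\<in>hom_operators M (n - 1).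
      moment (n - 1) (S - {k}) (vertex_link k w) m (link_fun n l' I0 k v) (psubst \<phi> p) =
        \<delta> * star_functional v (mvar x * p))"
proof -
  let ?v = "link_fun n l' I0 k v" and ?\<delta> = "front_det n l' (l' k) (I0 - {k})"
  have S: "finite S" using cycle by (simp add: simplicial_cycle_def)
  have n: "1 \<le> n" using multi_fan_nondegenerate[OF fan I0(1)] I0(2)
    by (auto simp: nondegenerate_def Suc_le_eq card_gt_0_iff)
  have vc: "v \<in> carrier_vec n" using v generic_vector_iff[OF fan] by simp
  note lf = link_fan[OF I0, folded m_def]
  obtain f where f: "2 \<le> n \<Longrightarrow> \<forall>I. w I \<noteq> 0 \<longrightarrow> k \<in> I \<longrightarrow>
    coord n l' I v k = - (\<Sum>i\<in>I - {k}. f i * coord n l' I v i)"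
    using height_function[OF v I0] by blast
  define \<phi> where "\<phi> i = (if i = x then - (\<Sum>j\<in>S - {k}. mconst (f j) * mvar j)
    else if i \<in> S - {k} then mvar i else (0 :: 'a mpoly))" for i
  have "\<phi> i \<in> hom_operators (S - {k}) 1" for i
  proof -
    have "(\<Sum>j\<in>S - {k}. mconst (f j) * mvar j) \<in> hom_operators (S - {k}) 1"
      by (intro hom_operators_sum hom_operators_mconst_mult) simp
    then show ?thesis by (simp add: \<phi>_def hom_operators_uminus)
  qed
  moreover have "\<phi> j = mvar j" if "j \<in> S - {k}" for j using that x by (auto simp: \<phi>_def)
  moreover have "moment (n - 1) (S - {k}) (vertex_link k w) m ?v (psubst \<phi> p) =
      ?\<delta> * star_functional v (mvar x * p)" if p: "p \<in> hom_operators M (n - 1)" for p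
    unfolding moment_def star_functional_mvar sum_distrib_left
  proof (intro sum.cong refl)
    fix J assume J: "J \<in> Pow (S - {k})"
    let ?I = "insert k J"
    show "cone_weight (n - 1) (vertex_link k w) m ?v J * peval (coord (n - 1) m J ?v) (psubst \<phi> p) =
      ?\<delta> * (cone_weight n w l' v ?I * coord n l' ?I v k * peval (coord n l' ?I v) (psubst star_subst p))"
    proof (cases "vertex_link k w J = 0")
      case True
      moreover have "k \<notin> J" using J by auto
      ultimately have "w ?I = 0" by (simp add: vertex_link_def vsign_def)
      then show ?thesis using True by (simp add: cone_weight_def)
    next
      case False
      note lk = lf(4)[OF False]
      have wI: "w ?I \<noteq> 0" using False by (auto simp: vertex_link_def split: if_splits)
      have kz: "coord n l' ?I v k \<noteq> 0"
        using v wI unfolding generic_vector_iff[OF fan] by blast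
      note cz = lf(2)[OF vc False]
      have det: "det (cone_matrix n l' ?I) = vsign k J * (?\<delta> * det (cone_matrix (n - 1) m J))"
        using det_cone_matrix_insert[of J k n l'] lk lf(3)[OF False] by simp
      have "(\<Prod>i\<in>J. coord (n - 1) m J ?v i) = (\<Prod>i\<in>J. coord n l' ?I v i)"
        unfolding cz by simp
      moreover have "(\<Prod>i\<in>?I. coord n l' ?I v i) = coord n l' ?I v k * (\<Prod>i\<in>J. coord n l' ?I v i)"
        using lk by simp
      moreover have "vertex_link k w J = vsign k J * w ?I" using lk by (simp add: vertex_link_def)
      moreover note vsign_cases[of k J]
      ultimately have wt: "cone_weight (n - 1) (vertex_link k w) m ?v J =
          ?\<delta> * (cone_weight n w l' v ?I * coord n l' ?I v k)"
        unfolding cone_weight_def det using kz lf(5) by auto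
      have "peval (coord (n - 1) m J ?v) (psubst \<phi> p) = peval (coord n l' ?I v) (psubst star_subst p)"
      \<comment> \<open>For n = 1 the condition on \<open>f\<close> is empty, but then
        \<open>p\<close> is a constant and evaluates alike everywhere.\<close>
      proof (cases "n = 1")
        case True
        then have "p \<in> hom_operators M 0" using p by simp
        then show ?thesis unfolding peval_psubst by (rule peval_hom_0)
      next
        case False
        then have "2 \<le> n" using n by simp
        from f[OF this] wI have height: "coord n l' ?I v k = - (\<Sum>i\<in>J. f i * coord n l' ?I v i)"
          using lk by auto
        have "peval (coord (n - 1) m J ?v) (\<phi> i) = peval (coord n l' ?I v) (star_subst i)" for i
        proof (cases "i = x")
          case True
          have "peval z (- (\<Sum>j\<in>S - {k}. mconst (f j) * mvar j)) = - (\<Sum>j\<in>S - {k}. f j * z j)" for z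
            by (simp add: real_algebra_hom.insertion_uminus[OF real_algebra_hom_id]
                real_algebra_hom.insertion_sum[OF real_algebra_hom_id] peval_mult peval_mconst peval_mvar)
          then have "peval (coord (n - 1) m J ?v) (\<phi> i) =
              - (\<Sum>j\<in>S - {k}. f j * (if j \<in> J then coord n l' ?I v j else 0))"
            using True unfolding cz by (simp add: \<phi>_def)
          also have "(\<Sum>j\<in>S - {k}. f j * (if j \<in> J then coord n l' ?I v j else 0)) =
              (\<Sum>j\<in>J. f j * (if j \<in> J then coord n l' ?I v j else 0))"
            using lk S by (intro sum.mono_neutral_right) auto
          also have "\<dots> = (\<Sum>j\<in>J. f j * coord n l' ?I v j)" by simp
          finally show ?thesis using True height by (simp add: star_subst_def peval_mvar)
        next
          case False
          then show ?thesis using lk unfolding cz by (auto simp: \<phi>_def star_subst_def peval_mvar)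
        qed
        then show ?thesis unfolding peval_psubst by simp
      qed
      then show ?thesis unfolding wt by simp
    qed
  qed
  ultimately show ?thesis using lf(5) by (intro exI[of _ ?\<delta>] exI[of _ \<phi>] conjI ballI)
qed

lemma star_colon:
  assumes n: "1 \<le> n"
  shows "{D \<in> hom_operators M d. mvar x * D \<in> annih M n (star_functional v) (Suc d)} =
    annih M (n - 1) (\<lambda>p. star_functional v (mvar x * p)) d"
proof -
  have "mvar x * D \<in> hom_operators M (Suc d)" if "D \<in> hom_operators M d" for D
    using hom_operators_mult[of "mvar x" M "Suc 0" D d] that M by simp
  moreover have "Suc d + m = n \<longleftrightarrow> d + m = n - 1" for m using n by auto
  ultimately show ?thesis by (auto simp: annih_def mult.assoc)
qed

text \<open>Through \<open>\<phi>\<close> the link algebra is a quotient of the operators on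
  \<open>M\<close>, and the nonzero factor \<open>\<delta>\<close> does not affect which operators
  annihilate. So the dimension of the colon space depends on the fan only through the multi-fan over
  the link.\<close>

lemma component_dim_link:
  assumes v: "generic_vector n w l' v" and I0: "w I0 \<noteq> 0" "k \<in> I0" and n: "1 \<le> n"
  defines "m \<equiv> \<lambda>i. link_fun n l' I0 k (l' i)"
  shows "component_dim (n - 1) (S - {k}) (vertex_link k w) m d +
      poly_dim {D \<in> hom_operators M d. mvar x * D \<in> annih M n (star_functional v) (Suc d)} =
    poly_dim (hom_operators M d)"
proof -
  let ?v = "link_fun n l' I0 k v"
  note lf = link_fan[OF I0, folded m_def]
  have g: "v \<in> carrier_vec n" "\<And>I i. w I \<noteq> 0 \<Longrightarrow> i \<in> I \<Longrightarrow> coord n l' I v i \<noteq> 0"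
    using v generic_vector_iff[OF fan] by auto
  have gl: "generic_vector (n - 1) (vertex_link k w) m ?v"
    unfolding generic_vector_iff[OF lf(1)]
  proof (intro conjI allI impI ballI)
    fix J i assume J: "vertex_link k w J \<noteq> 0" "i \<in> J"
    then have "w (insert k J) \<noteq> 0" by (auto simp: vertex_link_def split: if_splits)
    then show "coord (n - 1) m J ?v i \<noteq> 0" using lf(2)[OF g(1) J(1)] g(2) J(2) by auto
  qed (simp add: link_fun_def)
  obtain \<delta> \<phi> where \<phi>: "\<delta> \<noteq> 0"
    "\<forall>i\<in>M. \<phi> i \<in> hom_operators (S - {k}) 1" "\<forall>j\<in>S - {k}. \<phi> j = mvar j"
    "\<forall>p\<in>hom_operators M (n - 1).
      moment (n - 1) (S - {k}) (vertex_link k w) m ?v (psubst \<phi> p) =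
        \<delta> * star_functional v (mvar x * p)"
    using link_functional[OF v I0, folded m_def] by (elim exE conjE)
  have onto: "\<exists>i\<in>M. \<phi> i = mvar j" if "j \<in> S - {k}" for j using \<phi>(3) M(2) that by blast
  have "annih M (n - 1) (\<lambda>p. moment (n - 1) (S - {k}) (vertex_link k w) m ?v (psubst \<phi> p)) d =
      annih M (n - 1) (\<lambda>p. star_functional v (mvar x * p)) d"
  proof -
    have "moment (n - 1) (S - {k}) (vertex_link k w) m ?v (psubst \<phi> (D * E)) = 0 \<longleftrightarrow>
        star_functional v (mvar x * (D * E)) = 0"
      if "D \<in> hom_operators M d" "d + e = n - 1" "E \<in> hom_operators M e" for D E e
    proof -
      have "D * E \<in> hom_operators M (n - 1)"
        using hom_operators_mult[OF that(1,3)] that(2) by simp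
      from bspec[OF \<phi>(4) this] show ?thesis using \<phi>(1) by simp
    qed
    then show ?thesis unfolding annih_def by blast
  qed
  then show ?thesis
    using component_dim_annih[OF lf(1) gl M(1) bspec[OF \<phi>(2)] onto, of d] star_colon[OF n] by simp
qed

text \<open>If \<open>k\<close> lies in no simplex there is no cone from which to build the
  projection, but then the derivative at \<open>x\<close> kills the polynomial.\<close>

lemma star_colon_ghost:
  assumes "\<And>I. k \<in> I \<Longrightarrow> w I = 0"
  shows "{D \<in> hom_operators M d. mvar x * D \<in> annih M n (star_functional v) (Suc d)} =
    hom_operators M d"
proof -
  have "mvar x * D \<in> hom_operators M (Suc d)" if "D \<in> hom_operators M d" for D
    using hom_operators_mult[of "mvar x" M "Suc 0" D d] that M by simp
  moreover have "star_functional v (mvar x * p) = 0" for p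
    unfolding star_functional_mvar using assms by (simp add: cone_weight_def)
  ultimately show ?thesis by (auto simp: annih_def mult.assoc)
qed

text \<open>Ghost variables enlarge the space of operators and the annihilator by equal amounts, so
  passing from \<open>S\<close> to \<open>M\<close> leaves the codimension unchanged.\<close>

lemma component_dim_star:
  assumes v: "generic_vector n w l' v"
  shows "component_dim n S w l' d + poly_dim (annih M n (star_functional v) d) =
    poly_dim (hom_operators M d)"
  unfolding star_functional_def
proof (rule component_dim_annih[OF fan v M(1)])
  show "star_subst i \<in> hom_operators S 1" for i using k by (auto simp: star_subst_def)
  show "\<exists>i\<in>M. star_subst i = mvar j" if "j \<in> S" for j
  proof (cases "j = k")
    case True
    then show ?thesis using M by (intro bexI[of _ x]) (auto simp: star_subst_def)
  next
    case False
    then show ?thesis using M that x by (intro bexI[of _ j]) (auto simp: star_subst_def)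
  qed
qed

lemma star_functional_ghost:
  "y \<notin> insert x (S - {k}) \<Longrightarrow> star_functional v (mvar y * p) = 0"
  by (auto simp: star_functional_def psubst.insertion_mult psubst.insertion_mvar star_subst_def)

lemma moment_rename_star:
  assumes "v \<in> carrier_vec n" "p \<in> operators M"
  shows "moment n M (rename_vertex k x w) l v p = star_functional v p"
  unfolding star_functional_def
  by (rule moment_rename[OF assms]) (use x in \<open>auto simp: star_subst_def\<close>)

end

theorem theorem2:
  fixes n :: nat and S M :: "'a::linorder set" and w T :: "'a set \<Rightarrow> real"
    and k x y :: 'a and l' l'' l :: "'a \<Rightarrow> real vec"
  assumes n: "1 \<le> n"
    and k: "k \<in> S"
    and fan': "multi_fan n S w l'"
    and fan'': "multi_fan n S w l''"
    and agree: "\<forall>i\<in>S - {k}. l' i = l'' i"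
    and xy: "x \<notin> S - {k}" "y \<notin> S - {k}" "x \<noteq> y"
    and M: "M = (S - {k}) \<union> {x, y}"
    and l: "\<forall>i\<in>S - {k}. l i = l' i" "l x = l' k" "l y = l'' k"
    and T: "T = (\<lambda>I. rename_vertex k y w I - rename_vertex k x w I)"
    and link_rigid: "rigid (n - 1) (S - {k}) (vertex_link k w)"
    and T_editable: "editable n M T l x y"
  shows "Hilb n S w l' = Hilb n S w l''"
proof -
  have S: "finite S" using fan' by (simp add: multi_fan_def simplicial_cycle_def)
  have Mf: "finite M" "x \<in> M" "y \<in> M" using S M by auto
  interpret X: renamed_fan n S M w k x l l'
    by unfold_locales (use fan' k xy S M l in auto)
  interpret Y: renamed_fan n S M w k y l l''
    by unfold_locales (use fan'' k xy S M l agree in auto)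
  have car: "l i \<in> carrier_vec n" if "i \<in> M" for i
    using that M l fan' fan'' k by (auto simp: multi_fan_def)
  have fanT: "multi_fan n M T l"
    unfolding T by (rule multi_fan_diff[OF X.multi_fan_rename Y.multi_fan_rename]) (auto intro: car)
  \<comment> \<open>One \<open>v\<close> has to be generic for both fans and for \<open>T\<close>,
    so that the moment of \<open>T\<close> is literally the difference of the other two.\<close>
  let ?F = "Pair l' ` {I. w I \<noteq> 0} \<union> Pair l'' ` {I. w I \<noteq> 0} \<union> Pair l ` {I. T I \<noteq> 0}"
  have "finite ?F"
    using finite_cycle_support fan' fanT by (auto simp: multi_fan_def)
  then obtain v where vc: "v \<in> carrier_vec n" and v0: "\<forall>(l, I)\<in>?F. \<forall>i\<in>I. coord n l I v i \<noteq> 0"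
    using exists_generic[of ?F n] multi_fan_nondegenerate fan' fan'' fanT by blast
  have v: "generic_vector n w l' v" "generic_vector n w l'' v" "generic_vector n T l v"
    unfolding generic_vector_iff[OF fan'] generic_vector_iff[OF fan''] generic_vector_iff[OF fanT]
    using vc v0 by auto
  interpret edited_pair M n x y "X.star_functional v" "Y.star_functional v" "moment n M T l v"
  proof
    show "X.star_functional v (mvar y * p) = 0" for p
      by (rule X.star_functional_ghost) (use xy in auto)
    show "Y.star_functional v (mvar x * p) = 0" for p
      by (rule Y.star_functional_ghost) (use xy in auto)
    show "moment n M T l v p = 0 \<longleftrightarrow> X.star_functional v p = Y.star_functional v p"
      if "p \<in> hom_operators M n" for p
      unfolding T moment_diff
      using X.moment_rename_star[OF vc hom_operatorsD[OF that]]
        Y.moment_rename_star[OF vc hom_operatorsD[OF that]] by auto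
  qed (use Mf X.functional_star Y.functional_star functional_moment in auto)
  interpret yx: edited_pair M n y x "Y.star_functional v" "X.star_functional v" "moment n M T l v"
    by (rule swapped)
  have cd: "poly_dim (colon d) = poly_dim (yx.colon d)" for d
  proof (cases "\<exists>I0. w I0 \<noteq> 0 \<and> k \<in> I0")
    case True
    then obtain I0 where I0: "w I0 \<noteq> 0" "k \<in> I0" by auto
    \<comment> \<open>The cone \<open>I0\<close> is the same on both sides, but the projections are
      along \<open>l' k\<close> and \<open>l'' k\<close>. The two fans over the link share their
      cycle and may differ in the characteristic function, which is the case covered by
      rigidity.\<close>
    have "component_dim (n - 1) (S - {k}) (vertex_link k w) (\<lambda>i. link_fun n l' I0 k (l' i)) d =
        component_dim (n - 1) (S - {k}) (vertex_link k w) (\<lambda>i. link_fun n l'' I0 k (l'' i)) d"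
      using link_rigid X.link_fan(1)[OF I0] Y.link_fan(1)[OF I0] unfolding rigid_def by blast
    then show ?thesis
      using X.component_dim_link[OF v(1) I0 n, of d] Y.component_dim_link[OF v(2) I0 n, of d]
      unfolding colon_def yx.colon_def by linarith
  next
    case False
    then have ghost_vertex: "w I = 0" if "k \<in> I" for I using that by blast
    have "colon d = hom_operators M d"
      unfolding colon_def by (rule X.star_colon_ghost) (rule ghost_vertex)
    moreover have "yx.colon d = hom_operators M d"
      unfolding yx.colon_def by (rule Y.star_colon_ghost) (rule ghost_vertex)
    ultimately show ?thesis by simp
  qed
  have ed: "colon d \<subseteq> {a + mvar y * b | a b. a \<in> annih M n (moment n M T l v) d \<and> b \<in> pred_operators M d}"
    for d
  proof
    fix D assume "D \<in> colon d"
    then have D: "D \<in> hom_operators M d" "mvar x * D \<in> annih M n (X.star_functional v) (Suc d)"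
      by (auto simp: colon_def)
    \<comment> \<open>Editability speaks about \<open>T\<close> while \<open>colon\<close> is
      defined by the first fan; on multiples of \<open>mvar x\<close> the two annihilators
      agree.\<close>
    have "mvar x * D \<in> annih M n (moment n M T l v) (Suc d)"
      using mult_annih_iff[of D "Suc d"] D by (simp add: pred_operators_def)
    then have "mvar x * D \<in> annihilator n M T l"
      using hom_annihilator_iff[OF fanT v(3), of "mvar x * D" "Suc d"] by (auto simp: annih_def)
    then obtain E where E: "E \<in> pred_operators M d" "D - mvar y * E \<in> annih M n (moment n M T l v) d"
      using editable_annih[OF T_editable fanT v(3) D(1)] by blast
    have "D = (D - mvar y * E) + mvar y * E" by simp
    then show "D \<in> {a + mvar y * b | a b. a \<in> annih M n (moment n M T l v) d \<and> b \<in> pred_operators M d}"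
      using E by blast
  qed
  have "component_dim n S w l' d = component_dim n S w l'' d" for d
    using annih_dim_eq[of d, OF cd ed] X.component_dim_star[OF v(1), of d]
      Y.component_dim_star[OF v(2), of d] by simp
  then show ?thesis by (simp add: Hilb_def cong: if_cong)
qed

end
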